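(* Let $d\in\mathbb N_+$ and $Q\in\mathcal E_{P_1(A)}$. Then there is an isomorphism of algebras $H_{d,Q}^{\operatorname{cyc}}(A,z)\cong H_d^{Q}(A,z)$.
   Context: Conventions. $\Bbbk$ is a commutative ring and $z\in\Bbbk$ is fixed. All algebras are associative unital $\Bbbk$-superalgebras; $\bar f\in\mathbb Z_2$ is the parity of $f$; formulas with parities are for homogeneous elements and extended linearly. $\mathbb N_+=\{1,2,\dots\}$. Tensor products of superalgebras: $(f'\otimes g)(f\otimes g')=(-1)^{\bar f\bar g}f'f\otimes gg'$. For an algebra $F$, $Z(F)=\{f: fg=(-1)^{\bar f\bar g}gf\ \forall g\in F\}$; $f\in F$ is regular if it is neither a left nor a right zero-divisor. $\mathcal E_F$ is the set of even, central, regular elements of $F$, and $\widehat{\mathcal E}_F=\mathcal E_F\cup\{\mathsf I\}$ with $\mathsf I$ a formal symbol. $A$ is a symmetric Frobenius superalgebra with parity-preserving trace map, free over $\Bbbk$ with homogeneous (finite) basis $B$: the trace $\operatorname{tr}\colon A\to\Bbbk$ is even, $\operatorname{tr}(ab)=(-1)^{\bar a\bar b}\operatorname{tr}(ba)$, and there is a left dual basis $\{b^\vee:b\in B\}$ with $\operatorname{tr}(b^\vee c)=\delta_{b,c}$. For $a\in A$, $a_i=1^{\otimes(i-1)}\otimes a\otimes1^{\otimes(n-i)}\in A^{\otimes n}$. $P_n(A)=A^{\otimes n}\otimes\Bbbk[X_1^{\pm1},\dots,X_n^{\pm1}]$ ($X_i$ even, commuting with $A^{\otimes n}$); write $X=X_1\in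 P_1(A)$. For $f=\sum_k a_{(k)}X^k\in P_1(A)$, $f_i=\sum_k(a_{(k)})_iX_i^k\in P_n(A)$. With $t_{i,j}=\sum_{b\in B}b_i(b^\vee)_j$, the $\Bbbk$-linear operators $\Delta_i$ on $P_n(A)$ ($1\le i\le n-1$) are given by $\Delta_i(\mathbf ap)=t_{i,i+1}\mathbf a\,\dfrac{X_{i+1}(s_i(p)-p)}{X_i-X_{i+1}}$ for $\mathbf a\in A^{\otimes n}$, $p\in\Bbbk[X_1^{\pm1},\dots,X_n^{\pm1}]$, where $s_i$ swaps $X_i$ and $X_{i+1}$. A strict $\Bbbk$-linear monoidal supercategory is a strict monoidal category enriched in $\Bbbk$-supermodules with super interchange law $(f'\otimes g)\circ(f\otimes g')=(-1)^{\bar f\bar g}(f'\circ f)\otimes(g\circ g')$; juxtaposition denotes composition. $\mathcal{AH}(A,z)$ is the strict $\Bbbk$-linear monoidal supercategory generated by one object $\mathsf I$ and morphisms: even $T_+,T_-\colon\mathsf I\otimes\mathsf I\to\mathsf I\otimes\mathsf I$, $\langle a\rangle\colon\mathsf I\to\mathsf I$ for $a\in A$ (parity $\bar a$), even $\mathsf X,\mathsf X^{-1}\colon\mathsf I\to\mathsf I$, with relations: $\langle1\rangle=1_{\mathsf I}$, $\lambda\langle a\rangle+\mu\langle b\rangle=\langle\lambda a+\mu b\rangle$, $\langle a\rangle\langle b\rangle=\langle ab\rangle$; $\mathsf X\mathsf X^{-1}=\mathsf X^{-1}\mathsf X=1_{\mathsf I}$, $\langle a\rangle\mathsf X=\mathsf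 X\langle a\rangle$; $T_+T_-=T_-T_+=1$; $(T_+\otimes1_{\mathsf I})(1_{\mathsf I}\otimes T_+)(T_+\otimes1_{\mathsf I})=(1_{\mathsf I}\otimes T_+)(T_+\otimes1_{\mathsf I})(1_{\mathsf I}\otimes T_+)$; $T_+(\langle a\rangle\otimes1_{\mathsf I})=(1_{\mathsf I}\otimes\langle a\rangle)T_+$; $T_+-T_-=z\sum_{b\in B}\langle b\rangle\otimes\langle b^\vee\rangle$; $T_+(\mathsf X\otimes1_{\mathsf I})=(1_{\mathsf I}\otimes\mathsf X)T_-$. The affine Frobenius Hecke algebra is $H_n^{\operatorname{aff}}(A,z)=\operatorname{End}_{\mathcal{AH}(A,z)}(\mathsf I^{\otimes n})$; there is an algebra homomorphism $P_n(A)\to H_n^{\operatorname{aff}}(A,z)$ sending $a_i$ (resp. $X_i$) to the token $\langle a\rangle$ (resp. dot $\mathsf X$) on the $i$-th strand from the left, and elements of $P_n(A)$ are regarded in $H_n^{\operatorname{aff}}(A,z)$ through it. For $Q\in\mathcal E_{P_1(A)}$, the cyclotomic Frobenius Hecke algebra $H_n^Q(A,z)$ is the quotient of $H_n^{\operatorname{aff}}(A,z)$ by the two-sided ideal generated by $Q_1\in P_n(A)$. $\mathcal{LAH}(A,z)$ is the strict $\Bbbk$-linear monoidal supercategory whose objects are generated by $\widehat{\mathcal E}_{P_1(A)}$ (objects are words in this set, tensor product is concatenation), with the generating morphisms and relations of $\mathcal{AH}(A,z)$ together with even generators $\rho_Q\colon Q\otimes\mathsf I\to\mathsf I\otimes Q$,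 $\lambda_Q\colon\mathsf I\otimes Q\to Q\otimes\mathsf I$ for $Q\in\mathcal E_{P_1(A)}$ and the following relations. For $f=\sum_ra_{(r)}X^r\in P_1(A)$ put $[f]=\sum_r\langle a_{(r)}\rangle\mathsf X^r$. For $f=\sum\mu_{b,c,r,s}(b\otimes c)X_1^rX_2^s\in P_2(A)$ put $[f]_Q=\sum\mu_{b,c,r,s}(\langle b\rangle\otimes1_Q\otimes\langle c\rangle)(\mathsf X^r\otimes1_Q\otimes\mathsf X^s)\in\operatorname{End}(\mathsf I\otimes Q\otimes\mathsf I)$. For all $a\in A$, $Q\in\mathcal E_{P_1(A)}$: $\lambda_Q(\langle a\rangle\otimes1_Q)=(1_Q\otimes\langle a\rangle)\lambda_Q$; $\rho_Q(1_Q\otimes\langle a\rangle)=(\langle a\rangle\otimes1_Q)\rho_Q$; the same two relations with $\langle a\rangle$ replaced by $\mathsf X$; $\rho_Q\lambda_Q=[Q]\otimes1_Q$; $\lambda_Q\rho_Q=1_Q\otimes[Q]$; $(T_+\otimes1_Q)(1_{\mathsf I}\otimes\rho_Q)(\rho_Q\otimes1_{\mathsf I})=(1_{\mathsf I}\otimes\rho_Q)(\rho_Q\otimes1_{\mathsf I})(1_Q\otimes T_+)$; $(\lambda_Q\otimes1_{\mathsf I})(1_{\mathsf I}\otimes\lambda_Q)(T_+\otimes1_Q)=(1_Q\otimes T_+)(\lambda_Q\otimes1_{\mathsf I})(1_{\mathsf I}\otimes\lambda_Q)$; $(\rho_Q\otimes1_{\mathsf I})(1_Q\otimes T_+)(\lambda_Q\otimes1_{\mathsf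 I})=(1_{\mathsf I}\otimes\lambda_Q)(T_+\otimes1_Q)(1_{\mathsf I}\otimes\rho_Q)+z[\Delta_1(Q_1)]_Q$. For $d\in\mathbb N_+$ and a word $\mathbf Q$ in $\mathcal E_{P_1(A)}$ (of length $|\mathbf Q|$), $\Lambda_{d,\mathbf Q}$ is the set of words of length $d+|\mathbf Q|$ in $\widehat{\mathcal E}_{P_1(A)}$ containing both $\mathsf I^d$ and $\mathbf Q$ as subwords (a subword is obtained by deleting some, not necessarily consecutive, letters). $H_{d,\mathbf Q}^{\operatorname{aff}}(A,z)=\operatorname{End}_{\operatorname{Add}(\mathcal{LAH}(A,z))}\big(\bigoplus_{\mathbf i\in\Lambda_{d,\mathbf Q}}\mathbf i\big)$, where $\operatorname{Add}$ is the additive envelope. For $|\mathbf Q|\ge1$, the cyclotomic $(d,\mathbf Q)$-Frobenius Hecke algebra $H_{d,\mathbf Q}^{\operatorname{cyc}}(A,z)$ is the quotient of $H_{d,\mathbf Q}^{\operatorname{aff}}(A,z)$ by the two-sided ideal generated by the identity morphisms $1_{\mathbf i}$ of those $\mathbf i\in\Lambda_{d,\mathbf Q}$ whose first letter is $\mathsf I$. In the claim, $Q$ is regarded as a word of length one. *)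

theory Defs
  imports
    "HOL-Algebra.QuotRing"
    "HOL-Algebra.Module"
    "HOL-Library.Poly_Mapping"
    "HOL-Library.Product_Plus"
    "HOL-Library.Sublist"
    "HOL-Library.Z2"
begin

text \<open>
  Parities live in the type \<^typ>\<open>bit\<close> (the field with two elements). The ground ring and the
  Frobenius algebra are types; their sorts are unital rings in which \<open>0 = 1\<close> is permitted (the
  classes \<open>comm_ring_1\<close> and \<open>ring_1\<close> would exclude the zero ring). All algebras constructed from
  them depend on a natural number and are therefore \<open>HOL-Algebra\<close> structures.
\<close>

definition koszul :: "bit \<Rightarrow> 'b::ab_group_add \<Rightarrow> 'b" where
  "koszul p x = (if p = 1 then - x else x)"


section \<open>Superalgebras as structures\<close>

record ('k, 'm) superalgebra = "('k, 'm) module" +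
  homog :: "bit \<Rightarrow> 'm set"

definition superalgebra_iso ::
  "('k, 'm, 'x) superalgebra_scheme \<Rightarrow> ('k, 'n, 'y) superalgebra_scheme \<Rightarrow> ('m \<Rightarrow> 'n) set" where
  "superalgebra_iso M N =
    {h \<in> ring_iso M N.
       (\<forall>c. \<forall>x\<in>carrier M. h (c \<odot>\<^bsub>M\<^esub> x) = c \<odot>\<^bsub>N\<^esub> h x) \<and>
       (\<forall>p. h ` homog M p = homog N p)}"

definition quot_superalgebra ::
  "('k, 'm, 'x) superalgebra_scheme \<Rightarrow> 'm set \<Rightarrow> ('k, 'm set) superalgebra" where
  "quot_superalgebra M J =
    \<lparr> carrier = carrier (M Quot J),
      monoid.mult = monoid.mult (M Quot J),
      one = one (M Quot J),
      zero = zero (M Quot J),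
      add = add (M Quot J),
      smult = (\<lambda>c X. \<Union>x\<in>X. J +>\<^bsub>M\<^esub> (c \<odot>\<^bsub>M\<^esub> x)),
      homog = (\<lambda>p. (\<lambda>x. J +>\<^bsub>M\<^esub> x) ` homog M p) \<rparr>"


section \<open>Symmetric Frobenius superalgebras\<close>

record ('k, 'a) frobenius_data =
  scale :: "'k \<Rightarrow> 'a \<Rightarrow> 'a"
  grade :: "bit \<Rightarrow> 'a set"
  trace :: "'a \<Rightarrow> 'k"
  basis :: "'a set"
  dual :: "'a \<Rightarrow> 'a"

definition is_basis_family ::
  "('k::zero \<Rightarrow> 'a::comm_monoid_add \<Rightarrow> 'a) \<Rightarrow> 'i set \<Rightarrow> ('i \<Rightarrow> 'a) \<Rightarrow> bool" where
  "is_basis_family s J e \<longleftrightarrow> finite J \<and>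
     (\<forall>a. \<exists>!\<kappa>. (\<forall>i. i \<notin> J \<longrightarrow> \<kappa> i = 0) \<and> a = (\<Sum>i\<in>J. s (\<kappa> i) (e i)))"

locale symmetric_frobenius_superalgebra =
  fixes A :: "('k::{comm_ring,comm_monoid_mult}, 'a::{ring,monoid_mult}) frobenius_data"
  assumes scale_add_right: "scale A c (x + y) = scale A c x + scale A c y"
    and scale_add_left: "scale A (c + c') x = scale A c x + scale A c' x"
    and scale_scale: "scale A c (scale A c' x) = scale A (c * c') x"
    and scale_one: "scale A 1 x = x"
    and scale_mult_left: "scale A c x * y = scale A c (x * y)"
    and scale_mult_right: "x * scale A c y = scale A c (x * y)"
    and grade_add: "x \<in> grade A p \<Longrightarrow> y \<in> grade A p \<Longrightarrow> x + y \<in> grade A p"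
    and grade_scale: "x \<in> grade A p \<Longrightarrow> scale A c x \<in> grade A p"
    and grade_decomp: "\<exists>!(u, v). u \<in> grade A 0 \<and> v \<in> grade A 1 \<and> x = u + v"
    and grade_one: "1 \<in> grade A 0"
    and grade_mult: "x \<in> grade A p \<Longrightarrow> y \<in> grade A q \<Longrightarrow> x * y \<in> grade A (p + q)"
    and trace_add: "trace A (x + y) = trace A x + trace A y"
    and trace_scale: "trace A (scale A c x) = c * trace A x"
    and trace_even: "x \<in> grade A 1 \<Longrightarrow> trace A x = 0"
    and trace_sym:
      "x \<in> grade A p \<Longrightarrow> y \<in> grade A q \<Longrightarrow> trace A (x * y) = koszul (p * q) (trace A (y * x))"
    and basis: "is_basis_family (scale A) (basis A) (\<lambda>b. b)"
    and basis_homogeneous: "b \<in> basis A \<Longrightarrow> \<exists>p. b \<in> grade A p"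
    and dual_basis: "is_basis_family (scale A) (basis A) (dual A)"
    and trace_dual:
      "b \<in> basis A \<Longrightarrow> b' \<in> basis A \<Longrightarrow> trace A (dual A b * b') = (if b = b' then 1 else 0)"

definition coord :: "('k::zero, 'a::comm_monoid_add) frobenius_data \<Rightarrow> 'a \<Rightarrow> 'a \<Rightarrow> 'k" where
  "coord A a = (THE \<kappa>. (\<forall>b. b \<notin> basis A \<longrightarrow> \<kappa> b = 0) \<and> a = (\<Sum>b\<in>basis A. scale A (\<kappa> b) b))"

definition par :: "('k, 'a) frobenius_data \<Rightarrow> 'a \<Rightarrow> bit" where
  "par A a = (if a \<in> grade A 0 then 0 else 1)"


section \<open>The algebras \<open>P\<^sub>1(A)\<close> and \<open>P\<^sub>2(A)\<close>\<close>

text \<open>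
  \<open>P\<^sub>1(A) = A[X, X\<^sup>-\<^sup>1]\<close> is the type \<^typ>\<open>int \<Rightarrow>\<^sub>0 'a\<close> with its convolution product.
\<close>

definition P1_grade :: "('k, 'a::zero) frobenius_data \<Rightarrow> bit \<Rightarrow> (int \<Rightarrow>\<^sub>0 'a) set" where
  "P1_grade A p = {f. \<forall>r. Poly_Mapping.lookup f r \<in> grade A p}"

definition regular :: "'r::mult_zero \<Rightarrow> bool" where
  "regular f \<longleftrightarrow> (\<forall>g. f * g = 0 \<longrightarrow> g = 0) \<and> (\<forall>g. g * f = 0 \<longrightarrow> g = 0)"

definition supercentral :: "(bit \<Rightarrow> 'r::ring set) \<Rightarrow> bit \<Rightarrow> 'r \<Rightarrow> bool" where
  "supercentral G p f \<longleftrightarrow> f \<in> G p \<and> (\<forall>q. \<forall>g\<in>G q. f * g = koszul (p * q) (g * f))"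

definition EP1 :: "('k, 'a::ring) frobenius_data \<Rightarrow> (int \<Rightarrow>\<^sub>0 'a) set" where
  "EP1 A = {f. supercentral (P1_grade A) 0 f \<and> regular f}"

text \<open>
  Laurent polynomials in \<open>X\<^sub>1, X\<^sub>2\<close> over the ground ring form the type \<^typ>\<open>int \<times> int \<Rightarrow>\<^sub>0 'k\<close>. The
  divided difference is defined by the equation that characterises the quotient
  \<open>X\<^sub>2(s\<^sub>1(p) - p)/(X\<^sub>1 - X\<^sub>2)\<close>.
\<close>

type_synonym 'k laurent2 = "int \<times> int \<Rightarrow>\<^sub>0 'k"

definition mon2 :: "int \<Rightarrow> int \<Rightarrow> 'k::{zero,one} laurent2" where
  "mon2 r s = Poly_Mapping.single (r, s) 1"

definition divided_difference ::
  "'k::{comm_ring,comm_monoid_mult} laurent2 \<Rightarrow> 'k laurent2" where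
  "divided_difference p =
    (THE q. (mon2 1 0 - mon2 0 1) * q = mon2 0 1 * (Poly_Mapping.map_key prod.swap p - p))"

text \<open>
  \<open>P\<^sub>2(A)\<close> is the free module over the Laurent polynomials with basis \<open>b \<otimes> c\<close>, where \<open>b, c\<close> run through
  the basis of \<open>A\<close>; an element is the function taking \<open>(b, c)\<close> to the coefficient of \<open>b \<otimes> c\<close>.
\<close>

type_synonym ('k, 'a) P2 = "'a \<times> 'a \<Rightarrow> 'k laurent2"

text \<open>\<open>(x \<otimes> y) p\<close> for \<open>x, y \<in> A\<close> and a Laurent polynomial \<open>p\<close>:\<close>

definition P2_tensor ::
  "('k::{comm_ring,comm_monoid_mult}, 'a::ring) frobenius_data \<Rightarrow>
    'a \<Rightarrow> 'a \<Rightarrow> 'k laurent2 \<Rightarrow> ('k, 'a) P2" where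
  "P2_tensor A x y p = (\<lambda>(b, c). Poly_Mapping.single 0 (coord A x b * coord A y c) * p)"

definition P2_mult ::
  "('k::{comm_ring,comm_monoid_mult}, 'a::ring) frobenius_data \<Rightarrow>
    ('k, 'a) P2 \<Rightarrow> ('k, 'a) P2 \<Rightarrow> ('k, 'a) P2" where
  "P2_mult A f g = (\<lambda>u.
     \<Sum>(b, c)\<in>basis A \<times> basis A. \<Sum>(b', c')\<in>basis A \<times> basis A.
       koszul (par A c * par A b') (P2_tensor A (b * b') (c * c') (f (b, c) * g (b', c')) u))"

definition P2_t ::
  "('k::{comm_ring,comm_monoid_mult}, 'a::ring) frobenius_data \<Rightarrow> ('k, 'a) P2" where
  "P2_t A = (\<lambda>u. \<Sum>b\<in>basis A. P2_tensor A b (dual A b) (mon2 0 0) u)"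

text \<open>\<open>f\<^sub>1 \<in> P\<^sub>2(A)\<close> for \<open>f \<in> P\<^sub>1(A)\<close>, and the operator \<open>\<Delta>\<^sub>1\<close> on \<open>P\<^sub>2(A)\<close>:\<close>

definition P2_first ::
  "('k::{comm_ring,comm_monoid_mult}, 'a::{ring,monoid_mult}) frobenius_data \<Rightarrow>
    (int \<Rightarrow>\<^sub>0 'a) \<Rightarrow> ('k, 'a) P2" where
  "P2_first A f = (\<lambda>u. \<Sum>r\<in>Poly_Mapping.keys f. P2_tensor A (Poly_Mapping.lookup f r) 1 (mon2 r 0) u)"

definition P2_Delta ::
  "('k::{comm_ring,comm_monoid_mult}, 'a::ring) frobenius_data \<Rightarrow>
    ('k, 'a) P2 \<Rightarrow> ('k, 'a) P2" where
  "P2_Delta A f = P2_mult A (P2_t A) (\<lambda>u. divided_difference (f u))"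


section \<open>Strict monoidal supercategories by generators and relations\<close>

text \<open>Terms for morphisms; objects are words (lists of letters), and \<open>g \<circ>\<^sub>t f\<close> means \<open>g\<close> after \<open>f\<close>.\<close>

datatype ('k, 'o, 'g) mor =
    Gen 'g
  | Idm "'o list"
  | Comp "('k, 'o, 'g) mor" "('k, 'o, 'g) mor"  (infixr "\<circ>\<^sub>t" 70)
  | Tens "('k, 'o, 'g) mor" "('k, 'o, 'g) mor"  (infixr "\<otimes>\<^sub>t" 75)
  | Zer "'o list" "'o list"
  | Add "('k, 'o, 'g) mor" "('k, 'o, 'g) mor"  (infixr "+\<^sub>t" 65)
  | Scl 'k "('k, 'o, 'g) mor"  (infixr "*\<^sub>t" 68)

text \<open>
  A generator may lack a parity (tokens of inhomogeneous elements), so \<open>gpar\<close> is a relation.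
\<close>

record ('k, 'o, 'g) presentation =
  letters :: "'o set"
  gens :: "'g set"
  src :: "'g \<Rightarrow> 'o list"
  tgt :: "'g \<Rightarrow> 'o list"
  gpar :: "'g \<Rightarrow> bit \<Rightarrow> bool"
  rels :: "(('k, 'o, 'g) mor \<times> ('k, 'o, 'g) mor) set"

inductive arr :: "('k, 'o, 'g) presentation \<Rightarrow> 'o list \<Rightarrow> 'o list \<Rightarrow> ('k, 'o, 'g) mor \<Rightarrow> bool"
  for P where
  arr_Gen: "g \<in> gens P \<Longrightarrow> arr P (src P g) (tgt P g) (Gen g)"
| arr_Id: "set w \<subseteq> letters P \<Longrightarrow> arr P w w (Idm w)"
| arr_Comp: "arr P v w g \<Longrightarrow> arr P u v f \<Longrightarrow> arr P u w (g \<circ>\<^sub>t f)"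
| arr_Tens: "arr P v w f \<Longrightarrow> arr P v' w' g \<Longrightarrow> arr P (v @ v') (w @ w') (f \<otimes>\<^sub>t g)"
| arr_Zer: "set v \<subseteq> letters P \<Longrightarrow> set w \<subseteq> letters P \<Longrightarrow> arr P v w (Zer v w)"
| arr_Add: "arr P v w f \<Longrightarrow> arr P v w g \<Longrightarrow> arr P v w (f +\<^sub>t g)"
| arr_Scl: "arr P v w f \<Longrightarrow> arr P v w (c *\<^sub>t f)"

inductive mpar :: "('k, 'o, 'g) presentation \<Rightarrow> ('k, 'o, 'g) mor \<Rightarrow> bit \<Rightarrow> bool"
  for P where
  mpar_Gen: "gpar P g p \<Longrightarrow> mpar P (Gen g) p"
| mpar_Id: "mpar P (Idm w) 0"
| mpar_Comp: "mpar P g p \<Longrightarrow> mpar P f q \<Longrightarrow> mpar P (g \<circ>\<^sub>t f) (p + q)"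
| mpar_Tens: "mpar P f p \<Longrightarrow> mpar P g q \<Longrightarrow> mpar P (f \<otimes>\<^sub>t g) (p + q)"
| mpar_Zer: "mpar P (Zer v w) p"
| mpar_Add: "mpar P f p \<Longrightarrow> mpar P g p \<Longrightarrow> mpar P (f +\<^sub>t g) p"
| mpar_Scl: "mpar P f p \<Longrightarrow> mpar P (c *\<^sub>t f) p"

text \<open>
  \<open>meq P v w f g\<close> is equality of the morphisms from \<open>v\<close> to \<open>w\<close> denoted by \<open>f\<close> and \<open>g\<close> in the
  presented strict linear monoidal supercategory.
\<close>

inductive meq ::
  "('k::{comm_ring,comm_monoid_mult}, 'o, 'g) presentation \<Rightarrow> 'o list \<Rightarrow> 'o list \<Rightarrow>
    ('k, 'o, 'g) mor \<Rightarrow> ('k, 'o, 'g) mor \<Rightarrow> bool"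
  for P where
  meq_rel: "(f, g) \<in> rels P \<Longrightarrow> arr P v w f \<Longrightarrow> arr P v w g \<Longrightarrow> meq P v w f g"
| meq_refl: "arr P v w f \<Longrightarrow> meq P v w f f"
| meq_sym: "meq P v w f g \<Longrightarrow> meq P v w g f"
| meq_trans: "meq P v w f g \<Longrightarrow> meq P v w g h \<Longrightarrow> meq P v w f h"
| cong_Comp: "meq P v w g g' \<Longrightarrow> meq P u v f f' \<Longrightarrow> meq P u w (g \<circ>\<^sub>t f) (g' \<circ>\<^sub>t f')"
| cong_Tens: "meq P v w f f' \<Longrightarrow> meq P v' w' g g' \<Longrightarrow>
    meq P (v @ v') (w @ w') (f \<otimes>\<^sub>t g) (f' \<otimes>\<^sub>t g')"
| cong_Add: "meq P v w f f' \<Longrightarrow> meq P v w g g' \<Longrightarrow> meq P v w (f +\<^sub>t g) (f' +\<^sub>t g')"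
| cong_Scl: "meq P v w f f' \<Longrightarrow> meq P v w (c *\<^sub>t f) (c *\<^sub>t f')"
  \<comment> \<open>category\<close>
| Comp_assoc: "arr P v w h \<Longrightarrow> arr P u v g \<Longrightarrow> arr P t u f \<Longrightarrow>
    meq P t w ((h \<circ>\<^sub>t g) \<circ>\<^sub>t f) (h \<circ>\<^sub>t (g \<circ>\<^sub>t f))"
| Id_Comp: "arr P v w f \<Longrightarrow> meq P v w (Idm w \<circ>\<^sub>t f) f"
| Comp_Id: "arr P v w f \<Longrightarrow> meq P v w (f \<circ>\<^sub>t Idm v) f"
  \<comment> \<open>module structure on morphism spaces\<close>
| Add_assoc: "arr P v w f \<Longrightarrow> arr P v w g \<Longrightarrow> arr P v w h \<Longrightarrow>
    meq P v w ((f +\<^sub>t g) +\<^sub>t h) (f +\<^sub>t (g +\<^sub>t h))"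
| Add_comm: "arr P v w f \<Longrightarrow> arr P v w g \<Longrightarrow> meq P v w (f +\<^sub>t g) (g +\<^sub>t f)"
| Add_Zer: "arr P v w f \<Longrightarrow> meq P v w (f +\<^sub>t Zer v w) f"
| Scl_zero: "arr P v w f \<Longrightarrow> meq P v w (0 *\<^sub>t f) (Zer v w)"
| Scl_one: "arr P v w f \<Longrightarrow> meq P v w (1 *\<^sub>t f) f"
| Scl_Scl: "arr P v w f \<Longrightarrow> meq P v w (c *\<^sub>t (c' *\<^sub>t f)) ((c * c') *\<^sub>t f)"
| Scl_add: "arr P v w f \<Longrightarrow> meq P v w ((c + c') *\<^sub>t f) ((c *\<^sub>t f) +\<^sub>t (c' *\<^sub>t f))"
| Scl_Add: "arr P v w f \<Longrightarrow> arr P v w g \<Longrightarrow>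
    meq P v w (c *\<^sub>t (f +\<^sub>t g)) ((c *\<^sub>t f) +\<^sub>t (c *\<^sub>t g))"
  \<comment> \<open>bilinearity of composition and of the tensor product\<close>
| Add_Comp: "arr P v w g \<Longrightarrow> arr P v w g' \<Longrightarrow> arr P u v f \<Longrightarrow>
    meq P u w ((g +\<^sub>t g') \<circ>\<^sub>t f) ((g \<circ>\<^sub>t f) +\<^sub>t (g' \<circ>\<^sub>t f))"
| Comp_Add: "arr P v w g \<Longrightarrow> arr P u v f \<Longrightarrow> arr P u v f' \<Longrightarrow>
    meq P u w (g \<circ>\<^sub>t (f +\<^sub>t f')) ((g \<circ>\<^sub>t f) +\<^sub>t (g \<circ>\<^sub>t f'))"
| Scl_Comp: "arr P v w g \<Longrightarrow> arr P u v f \<Longrightarrow> meq P u w ((c *\<^sub>t g) \<circ>\<^sub>t f) (c *\<^sub>t (g \<circ>\<^sub>t f))"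
| Comp_Scl: "arr P v w g \<Longrightarrow> arr P u v f \<Longrightarrow> meq P u w (g \<circ>\<^sub>t (c *\<^sub>t f)) (c *\<^sub>t (g \<circ>\<^sub>t f))"
| Add_Tens: "arr P v w f \<Longrightarrow> arr P v w f' \<Longrightarrow> arr P v' w' g \<Longrightarrow>
    meq P (v @ v') (w @ w') ((f +\<^sub>t f') \<otimes>\<^sub>t g) ((f \<otimes>\<^sub>t g) +\<^sub>t (f' \<otimes>\<^sub>t g))"
| Tens_Add: "arr P v w f \<Longrightarrow> arr P v' w' g \<Longrightarrow> arr P v' w' g' \<Longrightarrow>
    meq P (v @ v') (w @ w') (f \<otimes>\<^sub>t (g +\<^sub>t g')) ((f \<otimes>\<^sub>t g) +\<^sub>t (f \<otimes>\<^sub>t g'))"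
| Scl_Tens: "arr P v w f \<Longrightarrow> arr P v' w' g \<Longrightarrow>
    meq P (v @ v') (w @ w') ((c *\<^sub>t f) \<otimes>\<^sub>t g) (c *\<^sub>t (f \<otimes>\<^sub>t g))"
| Tens_Scl: "arr P v w f \<Longrightarrow> arr P v' w' g \<Longrightarrow>
    meq P (v @ v') (w @ w') (f \<otimes>\<^sub>t (c *\<^sub>t g)) (c *\<^sub>t (f \<otimes>\<^sub>t g))"
  \<comment> \<open>strict monoidal structure\<close>
| Tens_assoc: "arr P u u' f \<Longrightarrow> arr P v v' g \<Longrightarrow> arr P w w' h \<Longrightarrow>
    meq P (u @ v @ w) (u' @ v' @ w') ((f \<otimes>\<^sub>t g) \<otimes>\<^sub>t h) (f \<otimes>\<^sub>t (g \<otimes>\<^sub>t h))"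
| unit_Tens: "arr P v w f \<Longrightarrow> meq P v w (Idm [] \<otimes>\<^sub>t f) f"
| Tens_unit: "arr P v w f \<Longrightarrow> meq P v w (f \<otimes>\<^sub>t Idm []) f"
| Id_Tens_Id: "set v \<subseteq> letters P \<Longrightarrow> set w \<subseteq> letters P \<Longrightarrow>
    meq P (v @ w) (v @ w) (Idm v \<otimes>\<^sub>t Idm w) (Idm (v @ w))"
| interchange: "arr P v w f' \<Longrightarrow> arr P u v f \<Longrightarrow> arr P v' w' g \<Longrightarrow> arr P u' v' g' \<Longrightarrow>
    mpar P f p \<Longrightarrow> mpar P g q \<Longrightarrow>
    meq P (u @ u') (w @ w') ((f' \<otimes>\<^sub>t g) \<circ>\<^sub>t (f \<otimes>\<^sub>t g'))
      (koszul (p * q) 1 *\<^sub>t ((f' \<circ>\<^sub>t f) \<otimes>\<^sub>t (g \<circ>\<^sub>t g')))"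

text \<open>
  A finite sum of terms. The choice of an enumeration is immaterial up to \<^const>\<open>meq\<close>.
\<close>

definition msum ::
  "'o list \<Rightarrow> 'o list \<Rightarrow> ('i \<Rightarrow> ('k, 'o, 'g) mor) \<Rightarrow> 'i set \<Rightarrow> ('k, 'o, 'g) mor" where
  "msum v w F S = foldr (\<lambda>i f. F i +\<^sub>t f) (SOME is. distinct is \<and> set is = S) (Zer v w)"

text \<open>
  Morphism spaces. Morphisms are \<^const>\<open>meq\<close>-classes; in the operations below every union ranges
  over equal classes.
\<close>

definition mclass ::
  "('k::{comm_ring,comm_monoid_mult}, 'o, 'g) presentation \<Rightarrow> 'o list \<Rightarrow> 'o list \<Rightarrow>
    ('k, 'o, 'g) mor \<Rightarrow> ('k, 'o, 'g) mor set" where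
  "mclass P v w f = {g. meq P v w f g}"

definition Hom_set ::
  "('k::{comm_ring,comm_monoid_mult}, 'o, 'g) presentation \<Rightarrow> 'o list \<Rightarrow> 'o list \<Rightarrow>
    ('k, 'o, 'g) mor set set" where
  "Hom_set P v w = mclass P v w ` {f. arr P v w f}"

definition Hom_homog ::
  "('k::{comm_ring,comm_monoid_mult}, 'o, 'g) presentation \<Rightarrow> 'o list \<Rightarrow> 'o list \<Rightarrow> bit \<Rightarrow>
    ('k, 'o, 'g) mor set set" where
  "Hom_homog P v w p = mclass P v w ` {f. arr P v w f \<and> mpar P f p}"

definition Hom_zero ::
  "('k::{comm_ring,comm_monoid_mult}, 'o, 'g) presentation \<Rightarrow> 'o list \<Rightarrow> 'o list \<Rightarrow>
    ('k, 'o, 'g) mor set" where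
  "Hom_zero P v w = mclass P v w (Zer v w)"

definition Hom_id ::
  "('k::{comm_ring,comm_monoid_mult}, 'o, 'g) presentation \<Rightarrow> 'o list \<Rightarrow> ('k, 'o, 'g) mor set" where
  "Hom_id P w = mclass P w w (Idm w)"

definition Hom_add ::
  "('k::{comm_ring,comm_monoid_mult}, 'o, 'g) presentation \<Rightarrow> 'o list \<Rightarrow> 'o list \<Rightarrow>
    ('k, 'o, 'g) mor set \<Rightarrow> ('k, 'o, 'g) mor set \<Rightarrow> ('k, 'o, 'g) mor set" where
  "Hom_add P v w F G = (\<Union>f\<in>F. \<Union>g\<in>G. mclass P v w (f +\<^sub>t g))"

definition Hom_scale ::
  "('k::{comm_ring,comm_monoid_mult}, 'o, 'g) presentation \<Rightarrow> 'o list \<Rightarrow> 'o list \<Rightarrow> 'k \<Rightarrow>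
    ('k, 'o, 'g) mor set \<Rightarrow> ('k, 'o, 'g) mor set" where
  "Hom_scale P v w c F = (\<Union>f\<in>F. mclass P v w (c *\<^sub>t f))"

definition Hom_comp ::
  "('k::{comm_ring,comm_monoid_mult}, 'o, 'g) presentation \<Rightarrow> 'o list \<Rightarrow> 'o list \<Rightarrow>
    ('k, 'o, 'g) mor set \<Rightarrow> ('k, 'o, 'g) mor set \<Rightarrow> ('k, 'o, 'g) mor set" where
  "Hom_comp P u w G F = (\<Union>g\<in>G. \<Union>f\<in>F. mclass P u w (g \<circ>\<^sub>t f))"

definition Hom_sum ::
  "('k::{comm_ring,comm_monoid_mult}, 'o, 'g) presentation \<Rightarrow> 'o list \<Rightarrow> 'o list \<Rightarrow>
    ('i \<Rightarrow> ('k, 'o, 'g) mor set) \<Rightarrow> 'i set \<Rightarrow> ('k, 'o, 'g) mor set" where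
  "Hom_sum P v w F S =
    finprod \<lparr>carrier = Hom_set P v w, monoid.mult = Hom_add P v w, one = Hom_zero P v w\<rparr> F S"

definition End_algebra ::
  "('k::{comm_ring,comm_monoid_mult}, 'o, 'g) presentation \<Rightarrow> 'o list \<Rightarrow>
    ('k, ('k, 'o, 'g) mor set) superalgebra" where
  "End_algebra P w =
    \<lparr> carrier = Hom_set P w w,
      monoid.mult = Hom_comp P w w,
      one = Hom_id P w,
      zero = Hom_zero P w w,
      add = Hom_add P w w,
      smult = Hom_scale P w w,
      homog = Hom_homog P w w \<rparr>"

text \<open>
  The endomorphism algebra, in the additive envelope, of the direct sum of a finite set \<open>L\<close> of
  objects: matrices whose entry at \<open>(j, i)\<close> is a morphism from \<open>i\<close> to \<open>j\<close>.
\<close>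

definition Add_End_algebra ::
  "('k::{comm_ring,comm_monoid_mult}, 'o, 'g) presentation \<Rightarrow> 'o list set \<Rightarrow>
    ('k, 'o list \<times> 'o list \<Rightarrow> ('k, 'o, 'g) mor set) superalgebra" where
  "Add_End_algebra P L =
    \<lparr> carrier = (\<Pi>\<^sub>E (j, i)\<in>L \<times> L. Hom_set P i j),
      monoid.mult = (\<lambda>M N. \<lambda>(j, i)\<in>L \<times> L. Hom_sum P i j (\<lambda>k. Hom_comp P i j (M (j, k)) (N (k, i))) L),
      one = (\<lambda>(j, i)\<in>L \<times> L. if j = i then Hom_id P i else Hom_zero P i j),
      zero = (\<lambda>(j, i)\<in>L \<times> L. Hom_zero P i j),
      add = (\<lambda>M N. \<lambda>(j, i)\<in>L \<times> L. Hom_add P i j (M (j, i)) (N (j, i))),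
      smult = (\<lambda>c M. \<lambda>(j, i)\<in>L \<times> L. Hom_scale P i j c (M (j, i))),
      homog = (\<lambda>p. \<Pi>\<^sub>E (j, i)\<in>L \<times> L. Hom_homog P i j p) \<rparr>"

text \<open>The identity morphism of the summand \<open>k\<close>, as an endomorphism of the direct sum:\<close>

definition summand_id ::
  "('k::{comm_ring,comm_monoid_mult}, 'o, 'g) presentation \<Rightarrow> 'o list set \<Rightarrow> 'o list \<Rightarrow>
    'o list \<times> 'o list \<Rightarrow> ('k, 'o, 'g) mor set" where
  "summand_id P L k = (\<lambda>(j, i)\<in>L \<times> L. if j = k \<and> i = k then Hom_id P k else Hom_zero P i j)"


section \<open>The supercategories \<open>AH(A, z)\<close> and \<open>LAH(A, z)\<close>\<close>

datatype 'q letter = II | Red 'q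

datatype ('a, 'q) gen = Tpos | Tneg | Token 'a | Dot | Dotinv | Rho 'q | Lambda 'q

type_synonym ('k, 'a) amor =
  "('k, (int \<Rightarrow>\<^sub>0 'a) letter, ('a, int \<Rightarrow>\<^sub>0 'a) gen) mor"

type_synonym ('k, 'a) apres =
  "('k, (int \<Rightarrow>\<^sub>0 'a) letter, ('a, int \<Rightarrow>\<^sub>0 'a) gen) presentation"

abbreviation oneI :: "('k, 'a::zero) amor" where
  "oneI \<equiv> Idm [II]"

abbreviation oneQ :: "(int \<Rightarrow>\<^sub>0 'a::zero) \<Rightarrow> ('k, 'a) amor" where
  "oneQ Q \<equiv> Idm [Red Q]"

abbreviation Tp :: "('k, 'a::zero) amor" where "Tp \<equiv> Gen Tpos"
abbreviation Tm :: "('k, 'a::zero) amor" where "Tm \<equiv> Gen Tneg"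
abbreviation tok :: "'a \<Rightarrow> ('k, 'a::zero) amor" where "tok a \<equiv> Gen (Token a)"
abbreviation dot :: "('k, 'a::zero) amor" where "dot \<equiv> Gen Dot"
abbreviation dotinv :: "('k, 'a::zero) amor" where "dotinv \<equiv> Gen Dotinv"
abbreviation rho :: "(int \<Rightarrow>\<^sub>0 'a) \<Rightarrow> ('k, 'a::zero) amor" where "rho Q \<equiv> Gen (Rho Q)"
abbreviation lam :: "(int \<Rightarrow>\<^sub>0 'a) \<Rightarrow> ('k, 'a::zero) amor" where "lam Q \<equiv> Gen (Lambda Q)"

fun gen_src :: "('a, 'q) gen \<Rightarrow> 'q letter list" where
  "gen_src Tpos = [II, II]"
| "gen_src Tneg = [II, II]"
| "gen_src (Token a) = [II]"
| "gen_src Dot = [II]"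
| "gen_src Dotinv = [II]"
| "gen_src (Rho Q) = [Red Q, II]"
| "gen_src (Lambda Q) = [II, Red Q]"

fun gen_tgt :: "('a, 'q) gen \<Rightarrow> 'q letter list" where
  "gen_tgt Tpos = [II, II]"
| "gen_tgt Tneg = [II, II]"
| "gen_tgt (Token a) = [II]"
| "gen_tgt Dot = [II]"
| "gen_tgt Dotinv = [II]"
| "gen_tgt (Rho Q) = [II, Red Q]"
| "gen_tgt (Lambda Q) = [Red Q, II]"

fun gen_par :: "('k, 'a) frobenius_data \<Rightarrow> ('a, 'q) gen \<Rightarrow> bit \<Rightarrow> bool" where
  "gen_par A (Token a) p \<longleftrightarrow> a \<in> grade A p"
| "gen_par A _ p \<longleftrightarrow> p = 0"

definition dot_pow :: "int \<Rightarrow> ('k, 'a::zero) amor" where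
  "dot_pow r =
    (if r \<ge> 0 then foldr (\<circ>\<^sub>t) (replicate (nat r) dot) oneI
     else foldr (\<circ>\<^sub>t) (replicate (nat (- r)) dotinv) oneI)"

inductive_set AH_rels ::
  "('k::{comm_ring,comm_monoid_mult}, 'a::{ring,monoid_mult}) frobenius_data \<Rightarrow> 'k \<Rightarrow>
    (('k, 'a) amor \<times> ('k, 'a) amor) set"
  for A z where
  "(tok 1, oneI) \<in> AH_rels A z"
| "((c *\<^sub>t tok a) +\<^sub>t (c' *\<^sub>t tok b), tok (scale A c a + scale A c' b)) \<in> AH_rels A z"
| "(tok a \<circ>\<^sub>t tok b, tok (a * b)) \<in> AH_rels A z"
| "(dot \<circ>\<^sub>t dotinv, oneI) \<in> AH_rels A z"
| "(dotinv \<circ>\<^sub>t dot, oneI) \<in> AH_rels A z"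
| "(tok a \<circ>\<^sub>t dot, dot \<circ>\<^sub>t tok a) \<in> AH_rels A z"
| "(Tp \<circ>\<^sub>t Tm, Idm [II, II]) \<in> AH_rels A z"
| "(Tm \<circ>\<^sub>t Tp, Idm [II, II]) \<in> AH_rels A z"
| "((Tp \<otimes>\<^sub>t oneI) \<circ>\<^sub>t (oneI \<otimes>\<^sub>t Tp) \<circ>\<^sub>t (Tp \<otimes>\<^sub>t oneI),
    (oneI \<otimes>\<^sub>t Tp) \<circ>\<^sub>t (Tp \<otimes>\<^sub>t oneI) \<circ>\<^sub>t (oneI \<otimes>\<^sub>t Tp)) \<in> AH_rels A z"
| "(Tp \<circ>\<^sub>t (tok a \<otimes>\<^sub>t oneI), (oneI \<otimes>\<^sub>t tok a) \<circ>\<^sub>t Tp) \<in> AH_rels A z"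
| "(Tp +\<^sub>t (- 1) *\<^sub>t Tm,
    z *\<^sub>t msum [II, II] [II, II] (\<lambda>b. tok b \<otimes>\<^sub>t tok (dual A b)) (basis A)) \<in> AH_rels A z"
| "(Tp \<circ>\<^sub>t (dot \<otimes>\<^sub>t oneI), (oneI \<otimes>\<^sub>t dot) \<circ>\<^sub>t Tm) \<in> AH_rels A z"

definition AH ::
  "('k::{comm_ring,comm_monoid_mult}, 'a::{ring,monoid_mult}) frobenius_data \<Rightarrow> 'k \<Rightarrow>
    ('k, 'a) apres" where
  "AH A z =
    \<lparr> letters = {II},
      gens = {Tpos, Tneg, Dot, Dotinv} \<union> range Token,
      src = gen_src, tgt = gen_tgt, gpar = gen_par A,
      rels = AH_rels A z \<rparr>"

text \<open>\<open>[f]\<close> for \<open>f \<in> P\<^sub>1(A)\<close> and \<open>[f]\<^sub>Q\<close> for \<open>f \<in> P\<^sub>2(A)\<close>:\<close>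

definition bracket :: "(int \<Rightarrow>\<^sub>0 'a::zero) \<Rightarrow> ('k, 'a) amor" where
  "bracket f = msum [II] [II] (\<lambda>r. tok (Poly_Mapping.lookup f r) \<circ>\<^sub>t dot_pow r) (Poly_Mapping.keys f)"

definition bracketQ ::
  "('k::zero, 'a::zero) frobenius_data \<Rightarrow> (int \<Rightarrow>\<^sub>0 'a) \<Rightarrow> ('k, 'a) P2 \<Rightarrow> ('k, 'a) amor" where
  "bracketQ A Q f = msum [II, Red Q, II] [II, Red Q, II]
     (\<lambda>(b, c, r, s). Poly_Mapping.lookup (f (b, c)) (r, s) *\<^sub>t
        ((tok b \<otimes>\<^sub>t oneQ Q \<otimes>\<^sub>t tok c) \<circ>\<^sub>t (dot_pow r \<otimes>\<^sub>t oneQ Q \<otimes>\<^sub>t dot_pow s)))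
     {(b, c, r, s). b \<in> basis A \<and> c \<in> basis A \<and> (r, s) \<in> Poly_Mapping.keys (f (b, c))}"

inductive_set LAH_rels ::
  "('k::{comm_ring,comm_monoid_mult}, 'a::{ring,monoid_mult}) frobenius_data \<Rightarrow> 'k \<Rightarrow>
    (('k, 'a) amor \<times> ('k, 'a) amor) set"
  for A z where
  "e \<in> AH_rels A z \<Longrightarrow> e \<in> LAH_rels A z"
| "Q \<in> EP1 A \<Longrightarrow>
    (lam Q \<circ>\<^sub>t (tok a \<otimes>\<^sub>t oneQ Q), (oneQ Q \<otimes>\<^sub>t tok a) \<circ>\<^sub>t lam Q) \<in> LAH_rels A z"
| "Q \<in> EP1 A \<Longrightarrow>
    (rho Q \<circ>\<^sub>t (oneQ Q \<otimes>\<^sub>t tok a), (tok a \<otimes>\<^sub>t oneQ Q) \<circ>\<^sub>t rho Q) \<in> LAH_rels A z"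
| "Q \<in> EP1 A \<Longrightarrow>
    (lam Q \<circ>\<^sub>t (dot \<otimes>\<^sub>t oneQ Q), (oneQ Q \<otimes>\<^sub>t dot) \<circ>\<^sub>t lam Q) \<in> LAH_rels A z"
| "Q \<in> EP1 A \<Longrightarrow>
    (rho Q \<circ>\<^sub>t (oneQ Q \<otimes>\<^sub>t dot), (dot \<otimes>\<^sub>t oneQ Q) \<circ>\<^sub>t rho Q) \<in> LAH_rels A z"
| "Q \<in> EP1 A \<Longrightarrow> (rho Q \<circ>\<^sub>t lam Q, bracket Q \<otimes>\<^sub>t oneQ Q) \<in> LAH_rels A z"
| "Q \<in> EP1 A \<Longrightarrow> (lam Q \<circ>\<^sub>t rho Q, oneQ Q \<otimes>\<^sub>t bracket Q) \<in> LAH_rels A z"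
| "Q \<in> EP1 A \<Longrightarrow>
    ((Tp \<otimes>\<^sub>t oneQ Q) \<circ>\<^sub>t (oneI \<otimes>\<^sub>t rho Q) \<circ>\<^sub>t (rho Q \<otimes>\<^sub>t oneI),
     (oneI \<otimes>\<^sub>t rho Q) \<circ>\<^sub>t (rho Q \<otimes>\<^sub>t oneI) \<circ>\<^sub>t (oneQ Q \<otimes>\<^sub>t Tp)) \<in> LAH_rels A z"
| "Q \<in> EP1 A \<Longrightarrow>
    ((lam Q \<otimes>\<^sub>t oneI) \<circ>\<^sub>t (oneI \<otimes>\<^sub>t lam Q) \<circ>\<^sub>t (Tp \<otimes>\<^sub>t oneQ Q),
     (oneQ Q \<otimes>\<^sub>t Tp) \<circ>\<^sub>t (lam Q \<otimes>\<^sub>t oneI) \<circ>\<^sub>t (oneI \<otimes>\<^sub>t lam Q)) \<in> LAH_rels A z"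
| "Q \<in> EP1 A \<Longrightarrow>
    ((rho Q \<otimes>\<^sub>t oneI) \<circ>\<^sub>t (oneQ Q \<otimes>\<^sub>t Tp) \<circ>\<^sub>t (lam Q \<otimes>\<^sub>t oneI),
     ((oneI \<otimes>\<^sub>t lam Q) \<circ>\<^sub>t (Tp \<otimes>\<^sub>t oneQ Q) \<circ>\<^sub>t (oneI \<otimes>\<^sub>t rho Q))
       +\<^sub>t z *\<^sub>t bracketQ A Q (P2_Delta A (P2_first A Q))) \<in> LAH_rels A z"

definition LAH ::
  "('k::{comm_ring,comm_monoid_mult}, 'a::{ring,monoid_mult}) frobenius_data \<Rightarrow> 'k \<Rightarrow>
    ('k, 'a) apres" where
  "LAH A z =
    \<lparr> letters = insert II (Red ` EP1 A),
      gens = {Tpos, Tneg, Dot, Dotinv} \<union> range Token \<union> Rho ` EP1 A \<union> Lambda ` EP1 A,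
      src = gen_src, tgt = gen_tgt, gpar = gen_par A,
      rels = LAH_rels A z \<rparr>"


section \<open>The algebras\<close>

definition H_aff ::
  "('k::{comm_ring,comm_monoid_mult}, 'a::{ring,monoid_mult}) frobenius_data \<Rightarrow> 'k \<Rightarrow> nat \<Rightarrow>
    ('k, ('k, 'a) amor set) superalgebra" where
  "H_aff A z n = End_algebra (AH A z) (replicate n II)"

text \<open>The image of \<open>f\<^sub>i \<in> P\<^sub>n(A)\<close> in the affine Frobenius Hecke algebra, for \<open>1 \<le> i \<le> n\<close>:\<close>

definition on_strand ::
  "('k::{comm_ring,comm_monoid_mult}, 'a::{ring,monoid_mult}) frobenius_data \<Rightarrow> 'k \<Rightarrow> nat \<Rightarrow> nat \<Rightarrow>
    (int \<Rightarrow>\<^sub>0 'a) \<Rightarrow> ('k, 'a) amor set" where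
  "on_strand A z n i f = mclass (AH A z) (replicate n II) (replicate n II)
     (Idm (replicate (i - 1) II) \<otimes>\<^sub>t bracket f \<otimes>\<^sub>t Idm (replicate (n - i) II))"

definition H_cyclotomic ::
  "('k::{comm_ring,comm_monoid_mult}, 'a::{ring,monoid_mult}) frobenius_data \<Rightarrow> 'k \<Rightarrow> nat \<Rightarrow>
    (int \<Rightarrow>\<^sub>0 'a) \<Rightarrow> ('k, ('k, 'a) amor set set) superalgebra" where
  "H_cyclotomic A z n Q =
    quot_superalgebra (H_aff A z n) (Idl\<^bsub>H_aff A z n\<^esub> {on_strand A z n 1 Q})"

definition Lambda_words ::
  "('k, 'a::ring) frobenius_data \<Rightarrow> nat \<Rightarrow> (int \<Rightarrow>\<^sub>0 'a) list \<Rightarrow>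
    (int \<Rightarrow>\<^sub>0 'a) letter list set" where
  "Lambda_words A d Qs =
    {w. length w = d + length Qs \<and> set w \<subseteq> insert II (Red ` EP1 A) \<and>
        subseq (replicate d II) w \<and> subseq (map Red Qs) w}"

definition HL_aff ::
  "('k::{comm_ring,comm_monoid_mult}, 'a::{ring,monoid_mult}) frobenius_data \<Rightarrow> 'k \<Rightarrow> nat \<Rightarrow>
    (int \<Rightarrow>\<^sub>0 'a) list \<Rightarrow>
    ('k, (int \<Rightarrow>\<^sub>0 'a) letter list \<times> (int \<Rightarrow>\<^sub>0 'a) letter list \<Rightarrow> ('k, 'a) amor set)
      superalgebra" where
  "HL_aff A z d Qs = Add_End_algebra (LAH A z) (Lambda_words A d Qs)"

definition HL_cyclotomic ::
  "('k::{comm_ring,comm_monoid_mult}, 'a::{ring,monoid_mult}) frobenius_data \<Rightarrow> 'k \<Rightarrow> nat \<Rightarrow>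
    (int \<Rightarrow>\<^sub>0 'a) list \<Rightarrow>
    ('k, ((int \<Rightarrow>\<^sub>0 'a) letter list \<times> (int \<Rightarrow>\<^sub>0 'a) letter list \<Rightarrow> ('k, 'a) amor set) set)
      superalgebra" where
  "HL_cyclotomic A z d Qs =
    quot_superalgebra (HL_aff A z d Qs)
      (Idl\<^bsub>HL_aff A z d Qs\<^esub>
        (summand_id (LAH A z) (Lambda_words A d Qs) ` {w \<in> Lambda_words A d Qs. hd w = II}))"

end

theory Submission
  imports Defs "HOL-Library.Multiset"
begin

text \<open>
  Every generator of \<open>LAH(A, z)\<close> permutes the letters of its source, so the summands are the words
  with \<open>d\<close> letters \<open>I\<close> and one letter \<open>Q\<close>, and modulo the ideal only the corner
  \<open>End(Q I\<^sup>d)\<close> survives. Forgetting the letter \<open>Q\<close> in front of a word and killing the generators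
  \<open>\<rho>\<^sub>Q\<close>, \<open>\<lambda>\<^sub>Q\<close> maps this corner to the affine algebra. On endomorphisms of \<open>Q I\<^sup>d\<close> the only
  relation that is violated is \<open>\<lambda>\<^sub>Q \<rho>\<^sub>Q = 1\<^sub>Q \<otimes> [Q]\<close>, which becomes \<open>0 = Q\<^sub>1\<close>; so the map is well
  defined with values in the cyclotomic quotient. Its inverse sends \<open>f\<close> to \<open>1\<^sub>Q \<otimes> f\<close>, because every
  term from \<open>Q I\<^sup>d\<close> to itself that involves \<open>\<rho>\<^sub>Q\<close> or \<open>\<lambda>\<^sub>Q\<close> passes through a word with first
  letter \<open>I\<close>.
\<close>

section \<open>Quotients of superalgebras\<close>

text \<open>Equality of terms is only known through its generating clauses; no basis of a morphism
  space is available, so all maps are defined on terms and checked clause by clause. The obstacle is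
  that killing \<open>Q_1\<close> is compatible with composition and with adding strands on the
  right, but not on the left: a strand on the left turns \<open>Q_1\<close> into \<open>Q_2\<close>,
  which need not lie in the cyclotomic ideal. Hence the evaluation cannot be a monoidal functor into
  a quotient category. Instead it is followed with two degrees of precision: modulo
  \<open>Q_1\<close> between words that begin with \<open>Q\<close>, and exactly everywhere else. A
  tensor product between words beginning with \<open>Q\<close> then splits in one of two harmless
  ways. Either \<open>Q\<close> belongs to the left factor, and the right factor is pure, where
  equality is exact; or the left factor is an endomorphism of the unit object. The latter is a
  scalar, because generators have nonempty source and preserve letters. So no strand is ever placed
  to the left of \<open>Q_1\<close>.\<close>

locale scalar_ring = ring M for M :: "('k, 'm, 'x) superalgebra_scheme" +
  assumes smult_one_closed: "c \<odot>\<^bsub>M\<^esub> \<one>\<^bsub>M\<^esub> \<in> carrier M"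
    and smult_eq_mult: "x \<in> carrier M \<Longrightarrow> c \<odot>\<^bsub>M\<^esub> x = (c \<odot>\<^bsub>M\<^esub> \<one>\<^bsub>M\<^esub>) \<otimes>\<^bsub>M\<^esub> x"
    and homog_carrier: "homog M p \<subseteq> carrier M"
begin

lemma smult_closed: "x \<in> carrier M \<Longrightarrow> c \<odot>\<^bsub>M\<^esub> x \<in> carrier M"
  by (simp add: smult_eq_mult[of x] smult_one_closed)

text \<open>Scalars act as multiplication by the ring element \<open>c \<odot> \<one>\<close>, and
  the coset map is a ring homomorphism. An ideal of the underlying ring is therefore automatically
  stable under scalars.\<close>

lemma rcoset_smult_cong:
  assumes J: "ideal J M" and xy: "x \<in> carrier M" "y \<in> carrier M" "J +>\<^bsub>M\<^esub> x = J +>\<^bsub>M\<^esub> y"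
  shows "J +>\<^bsub>M\<^esub> (c \<odot>\<^bsub>M\<^esub> x) = J +>\<^bsub>M\<^esub> (c \<odot>\<^bsub>M\<^esub> y)"
  unfolding smult_eq_mult[OF xy(1)] smult_eq_mult[OF xy(2)]
  by (simp only: ring_hom_mult[OF ideal.rcos_ring_hom[OF J] smult_one_closed] xy)

lemma quot_smult:
  assumes J: "ideal J M" and x: "x \<in> carrier M"
  shows "c \<odot>\<^bsub>quot_superalgebra M J\<^esub> (J +>\<^bsub>M\<^esub> x) = J +>\<^bsub>M\<^esub> (c \<odot>\<^bsub>M\<^esub> x)"
proof -
  interpret J: abelian_subgroup J M
    by (rule ideal.axioms(1)[OF J, THEN abelian_subgroupI3]) (rule is_abelian_group)
  have "(\<Union>y\<in>J +>\<^bsub>M\<^esub> x. J +>\<^bsub>M\<^esub> (c \<odot>\<^bsub>M\<^esub> y)) = J +>\<^bsub>M\<^esub> (c \<odot>\<^bsub>M\<^esub> x)"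
  proof (rule UN_constant_eq[OF _ ballI])
    show "x \<in> J +>\<^bsub>M\<^esub> x"
      by (rule J.a_rcos_self[OF x])
    fix y assume y: "y \<in> J +>\<^bsub>M\<^esub> x"
    have "y \<in> carrier M"
      using y a_r_coset_subset_G[OF J.a_subset x] by blast
    then show "J +>\<^bsub>M\<^esub> (c \<odot>\<^bsub>M\<^esub> y) = J +>\<^bsub>M\<^esub> (c \<odot>\<^bsub>M\<^esub> x)"
      using rcoset_smult_cong[OF J _ x] J.a_repr_independence'[OF y x] by metis
  qed
  then show ?thesis by (simp add: quot_superalgebra_def)
qed

lemma rcosets_carrier: "carrier (M Quot J) = (\<lambda>x. J +>\<^bsub>M\<^esub> x) ` carrier M"
  by (auto simp: FactRing_def A_RCOSETS_def' a_r_coset_def')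

end

text \<open>The isomorphism is induced by \<open>\<beta>\<close>; the map \<open>\<alpha>\<close>
  merely chooses preimages, and no homomorphism property is asked of it. Every coset of
  \<open>I\<close> meets the image of \<open>\<alpha>\<close>, so the kernel of
  \<open>\<beta>\<close> and the compatibility with scalars can be tested on that image. Parities
  are required in both directions because homogeneous parts must correspond exactly.\<close>

lemma quot_superalgebra_iso:
  assumes M: "scalar_ring M" and N: "scalar_ring N" and I: "ideal I M" and J: "ideal J N"
    and \<alpha>_closed: "\<And>x. x \<in> carrier N \<Longrightarrow> \<alpha> x \<in> carrier M"
    and \<alpha>_ideal: "\<And>x. x \<in> J \<Longrightarrow> \<alpha> x \<in> I"
    and \<alpha>_surj: "\<And>y. y \<in> carrier M \<Longrightarrow> \<exists>x\<in>carrier N. I +>\<^bsub>M\<^esub> y = I +>\<^bsub>M\<^esub> \<alpha> x"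
    and \<alpha>_homog: "\<And>p x. x \<in> homog N p \<Longrightarrow> \<alpha> x \<in> homog M p"
    and \<beta>: "\<beta> \<in> ring_hom M (N Quot J)"
    and \<beta>\<alpha>: "\<And>x. x \<in> carrier N \<Longrightarrow> \<beta> (\<alpha> x) = J +>\<^bsub>N\<^esub> x"
    and \<beta>_ideal: "\<And>y. y \<in> I \<Longrightarrow> \<beta> y = J"
    and \<beta>_smult: "\<And>c x. x \<in> carrier N \<Longrightarrow> \<beta> (c \<odot>\<^bsub>M\<^esub> \<alpha> x) = J +>\<^bsub>N\<^esub> (c \<odot>\<^bsub>N\<^esub> x)"
    and \<beta>_homog: "\<And>p y. y \<in> homog M p \<Longrightarrow> \<exists>x\<in>homog N p. \<beta> y = J +>\<^bsub>N\<^esub> x"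
  shows "\<exists>h. h \<in> superalgebra_iso (quot_superalgebra M I) (quot_superalgebra N J)"
proof -
  interpret M: scalar_ring M by fact
  interpret N: scalar_ring N by fact
  interpret \<beta>: ring_hom_ring M "N Quot J" \<beta>
    by (rule ring_hom_ringI2[OF M.ring_axioms ideal.quotient_is_ring[OF J] \<beta>])
  have zero: "\<zero>\<^bsub>N Quot J\<^esub> = J"
    by (simp add: FactRing_def)
  have I_carrier: "y \<in> carrier M" if "y \<in> I" for y
    using ideal.Icarr[OF I that] .
  have J_carrier: "x \<in> carrier N" if "x \<in> J" for x
    using ideal.Icarr[OF J that] .
  have \<beta>_cong: "\<beta> y = \<beta> y'"
    if y: "y \<in> carrier M" "y' \<in> carrier M" "I +>\<^bsub>M\<^esub> y = I +>\<^bsub>M\<^esub> y'" for y y'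
  proof -
    have "y \<ominus>\<^bsub>M\<^esub> y' \<in> I"
      using y M.quotient_eq_iff_same_a_r_cos[OF I] by blast
    then have "\<beta> (y \<ominus>\<^bsub>M\<^esub> y') = \<zero>\<^bsub>N Quot J\<^esub>"
      unfolding zero by (rule \<beta>_ideal)
    moreover have "y = (y \<ominus>\<^bsub>M\<^esub> y') \<oplus>\<^bsub>M\<^esub> y'"
      using y by (simp add: a_minus_def M.a_assoc M.l_neg)
    moreover have "y \<ominus>\<^bsub>M\<^esub> y' \<in> carrier M"
      using y by simp
    ultimately have "\<beta> y = \<zero>\<^bsub>N Quot J\<^esub> \<oplus>\<^bsub>N Quot J\<^esub> \<beta> y'"
      using \<beta>.hom_add y by metis
    then show ?thesis
      using \<beta>.S.l_zero[OF \<beta>.hom_closed[OF y(2)]] by simp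
  qed
  have kernel: "a_kernel M (N Quot J) \<beta> = I"
  proof (intro equalityI subsetI)
    fix y assume "y \<in> a_kernel M (N Quot J) \<beta>"
    then have y: "y \<in> carrier M" "\<beta> y = J"
      unfolding a_kernel_def' zero by blast+
    \<comment> \<open>Modulo \<open>I\<close> the element \<open>y\<close> may be replaced by
      \<open>\<alpha> x\<close>. Then \<open>\<beta> y = J\<close> says that
      \<open>x \<in> J\<close>, and \<open>\<alpha>\<close> carries \<open>J\<close> into
      \<open>I\<close>.\<close>
    obtain x where x: "x \<in> carrier N" "I +>\<^bsub>M\<^esub> y = I +>\<^bsub>M\<^esub> \<alpha> x"
      using \<alpha>_surj y(1) by blast
    have "J +>\<^bsub>N\<^esub> x = J"
      using \<beta>_cong[OF y(1) \<alpha>_closed[OF x(1)] x(2)] \<beta>\<alpha>[OF x(1)] y(2) by simp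
    then have "x \<in> J"
      using ideal.rcos_const_imp_mem[OF J x(1)] by simp
    then have "I +>\<^bsub>M\<^esub> y = I"
      using x(2) \<alpha>_ideal M.a_rcos_zero[OF I] by simp
    then show "y \<in> I"
      using ideal.rcos_const_imp_mem[OF I y(1)] by simp
  next
    fix y assume "y \<in> I"
    then show "y \<in> a_kernel M (N Quot J) \<beta>"
      unfolding a_kernel_def' zero using \<beta>_ideal I_carrier by blast
  qed
  have surj: "\<beta> ` carrier M = carrier (N Quot J)"
  proof (intro equalityI subsetI)
    fix X assume "X \<in> carrier (N Quot J)"
    then obtain x where "x \<in> carrier N" "X = J +>\<^bsub>N\<^esub> x"
      unfolding N.rcosets_carrier by blast
    then show "X \<in> \<beta> ` carrier M"
      using \<beta>\<alpha> \<alpha>_closed by (metis imageI)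
  qed auto
  define h where "h = (\<lambda>X. the_elem (\<beta> ` X))"
  have h: "h (I +>\<^bsub>M\<^esub> y) = \<beta> y" if "y \<in> carrier M" for y
    using \<beta>.the_elem_simp[OF that] by (simp add: h_def kernel)
  have "h \<in> ring_iso (M Quot I) (N Quot J)"
    using \<beta>.FactRing_iso_set[OF surj] by (simp add: h_def kernel)
  then have "h \<in> ring_iso (quot_superalgebra M I) (quot_superalgebra N J)"
    by (simp add: ring_iso_def ring_hom_def quot_superalgebra_def)
  moreover have "h (c \<odot>\<^bsub>quot_superalgebra M I\<^esub> X) = c \<odot>\<^bsub>quot_superalgebra N J\<^esub> h X"
    if "X \<in> carrier (quot_superalgebra M I)" for c X
  proof -
    have "X \<in> carrier (M Quot I)"
      using that by (simp add: quot_superalgebra_def)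
    then obtain x where x: "x \<in> carrier N" "X = I +>\<^bsub>M\<^esub> \<alpha> x"
      unfolding M.rcosets_carrier using \<alpha>_surj by blast
    note y = \<alpha>_closed[OF x(1)]
    have "h (c \<odot>\<^bsub>quot_superalgebra M I\<^esub> X) = \<beta> (c \<odot>\<^bsub>M\<^esub> \<alpha> x)"
      using h[OF M.smult_closed[OF y]] by (simp only: x(2) M.quot_smult[OF I y])
    also have "\<dots> = c \<odot>\<^bsub>quot_superalgebra N J\<^esub> (J +>\<^bsub>N\<^esub> x)"
      by (simp only: \<beta>_smult[OF x(1)] N.quot_smult[OF J x(1)])
    also have "J +>\<^bsub>N\<^esub> x = h X"
      by (simp only: x(2) h[OF y] \<beta>\<alpha>[OF x(1)])
    finally show ?thesis .
  qed
  moreover have "h ` homog (quot_superalgebra M I) p = homog (quot_superalgebra N J) p" for p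
  proof -
    have "h ` homog (quot_superalgebra M I) p = (\<lambda>y. h (I +>\<^bsub>M\<^esub> y)) ` homog M p"
      unfolding quot_superalgebra_def superalgebra.select_convs image_image ..
    also have "\<dots> = \<beta> ` homog M p"
      using h M.homog_carrier[of p] by (intro image_cong) blast+
    also have "\<dots> = (\<lambda>x. J +>\<^bsub>N\<^esub> x) ` homog N p"
    proof (intro equalityI subsetI)
      fix X assume "X \<in> (\<lambda>x. J +>\<^bsub>N\<^esub> x) ` homog N p"
      then obtain x where x: "x \<in> homog N p" "X = J +>\<^bsub>N\<^esub> x" by blast
      then show "X \<in> \<beta> ` homog M p"
        using \<beta>\<alpha>[of x] \<alpha>_homog[of x p] N.homog_carrier[of p] by (metis imageI subsetD)
    qed (use \<beta>_homog in blast)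
    finally show ?thesis
      unfolding quot_superalgebra_def superalgebra.select_convs .
  qed
  ultimately show ?thesis
    unfolding superalgebra_iso_def by blast
qed


section \<open>Terms and their types\<close>

text \<open>A term determines its own source and target. Typing thus becomes a recursive check
  \<open>wt\<close> with two equations (see \<open>arr_iff\<close>), which rewriting settles without
  inverting the inductive predicate \<open>arr\<close>.\<close>

primrec msrc :: "('k, 'o, 'g) presentation \<Rightarrow> ('k, 'o, 'g) mor \<Rightarrow> 'o list" where
  "msrc P (Gen g) = src P g"
| "msrc P (Idm w) = w"
| "msrc P (g \<circ>\<^sub>t f) = msrc P f"
| "msrc P (f \<otimes>\<^sub>t g) = msrc P f @ msrc P g"
| "msrc P (Zer v w) = v"
| "msrc P (f +\<^sub>t g) = msrc P f"
| "msrc P (c *\<^sub>t f) = msrc P f"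

primrec mtgt :: "('k, 'o, 'g) presentation \<Rightarrow> ('k, 'o, 'g) mor \<Rightarrow> 'o list" where
  "mtgt P (Gen g) = tgt P g"
| "mtgt P (Idm w) = w"
| "mtgt P (g \<circ>\<^sub>t f) = mtgt P g"
| "mtgt P (f \<otimes>\<^sub>t g) = mtgt P f @ mtgt P g"
| "mtgt P (Zer v w) = w"
| "mtgt P (f +\<^sub>t g) = mtgt P f"
| "mtgt P (c *\<^sub>t f) = mtgt P f"

primrec wt :: "('k, 'o, 'g) presentation \<Rightarrow> ('k, 'o, 'g) mor \<Rightarrow> bool" where
  "wt P (Gen g) \<longleftrightarrow> g \<in> gens P"
| "wt P (Idm w) \<longleftrightarrow> set w \<subseteq> letters P"
| "wt P (g \<circ>\<^sub>t f) \<longleftrightarrow> wt P g \<and> wt P f \<and> mtgt P f = msrc P g"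
| "wt P (f \<otimes>\<^sub>t g) \<longleftrightarrow> wt P f \<and> wt P g"
| "wt P (Zer v w) \<longleftrightarrow> set v \<subseteq> letters P \<and> set w \<subseteq> letters P"
| "wt P (f +\<^sub>t g) \<longleftrightarrow> wt P f \<and> wt P g \<and> msrc P f = msrc P g \<and> mtgt P f = mtgt P g"
| "wt P (c *\<^sub>t f) \<longleftrightarrow> wt P f"

lemma arr_imp_wt: "arr P v w f \<Longrightarrow> wt P f \<and> msrc P f = v \<and> mtgt P f = w"
  by (induction rule: arr.induct) auto

lemma wt_imp_arr: "wt P f \<Longrightarrow> arr P (msrc P f) (mtgt P f) f"
proof (induction f)
  case (Comp g f)
  then show ?case by (auto intro: arr_Comp)
qed (auto intro: arr.intros)

lemma arr_iff: "arr P v w f \<longleftrightarrow> wt P f \<and> msrc P f = v \<and> mtgt P f = w"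
  using arr_imp_wt wt_imp_arr by blast

text \<open>Reading the type off the left-hand term turns typed equality into a plain binary
  relation, fit for calculational chains.\<close>

definition eqv :: "('k::{comm_ring,comm_monoid_mult}, 'o, 'g) presentation \<Rightarrow>
    ('k, 'o, 'g) mor \<Rightarrow> ('k, 'o, 'g) mor \<Rightarrow> bool" where
  "eqv P f g \<longleftrightarrow> meq P (msrc P f) (mtgt P f) f g"

locale wf_presentation =
  fixes P :: "('k::{comm_ring,comm_monoid_mult}, 'o, 'g) presentation"
  assumes src_letters: "g \<in> gens P \<Longrightarrow> set (src P g) \<subseteq> letters P"
    and tgt_letters: "g \<in> gens P \<Longrightarrow> set (tgt P g) \<subseteq> letters P"
begin

abbreviation eqvP (infix "\<approx>" 50) where "f \<approx> g \<equiv> eqv P f g"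

lemma wt_letters:
  assumes "wt P f"
  shows "set (msrc P f) \<subseteq> letters P" and "set (mtgt P f) \<subseteq> letters P"
  using assms by (induction f) (use src_letters tgt_letters in auto)

lemma meq_arr: "meq P v w f g \<Longrightarrow> arr P v w f \<and> arr P v w g"
  by (induction rule: meq.induct) (auto simp: arr_iff wt_letters)

lemma meq_iff: "meq P v w f g \<longleftrightarrow> f \<approx> g \<and> msrc P f = v \<and> mtgt P f = w"
  using meq_arr arr_iff unfolding eqv_def by metis

lemma eqvD:
  assumes "f \<approx> g"
  shows "wt P f" "wt P g" "msrc P g = msrc P f" "mtgt P g = mtgt P f"
  using assms meq_arr unfolding eqv_def arr_iff by blast+

lemma eqv_refl: "wt P f \<Longrightarrow> f \<approx> f"
  by (simp add: eqv_def meq_refl wt_imp_arr)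

lemma eqv_sym: "f \<approx> g \<Longrightarrow> g \<approx> f"
  using eqvD unfolding eqv_def by (metis meq_sym)

lemma eqv_trans [trans]: "f \<approx> g \<Longrightarrow> g \<approx> h \<Longrightarrow> f \<approx> h"
  using eqvD unfolding eqv_def by (metis meq_trans)

lemma eqv_cong_Comp:
  "g \<approx> g' \<Longrightarrow> f \<approx> f' \<Longrightarrow> mtgt P f = msrc P g \<Longrightarrow> g \<circ>\<^sub>t f \<approx> g' \<circ>\<^sub>t f'"
  unfolding eqv_def by (auto intro: cong_Comp)

lemma eqv_cong_Tens: "f \<approx> f' \<Longrightarrow> g \<approx> g' \<Longrightarrow> f \<otimes>\<^sub>t g \<approx> f' \<otimes>\<^sub>t g'"
  unfolding eqv_def by (auto intro: cong_Tens)

lemma eqv_cong_Add: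
  "f \<approx> f' \<Longrightarrow> g \<approx> g' \<Longrightarrow> msrc P f = msrc P g \<Longrightarrow> mtgt P f = mtgt P g \<Longrightarrow>
    f +\<^sub>t g \<approx> f' +\<^sub>t g'"
  unfolding eqv_def by (auto intro: cong_Add)

lemma eqv_cong_Scl: "f \<approx> f' \<Longrightarrow> c *\<^sub>t f \<approx> c *\<^sub>t f'"
  unfolding eqv_def by (auto intro: cong_Scl)

lemma eqv_rel: "(f, g) \<in> rels P \<Longrightarrow> wt P f \<Longrightarrow> wt P g \<Longrightarrow> msrc P f = msrc P g \<Longrightarrow>
    mtgt P f = mtgt P g \<Longrightarrow> f \<approx> g"
  unfolding eqv_def by (rule meq_rel) (auto simp: arr_iff)

lemma
  shows eqv_Comp_assoc: "wt P ((h \<circ>\<^sub>t g) \<circ>\<^sub>t f) \<Longrightarrow> (h \<circ>\<^sub>t g) \<circ>\<^sub>t f \<approx> h \<circ>\<^sub>t g \<circ>\<^sub>t f"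
    and eqv_Id_Comp: "wt P f \<Longrightarrow> mtgt P f = w \<Longrightarrow> Idm w \<circ>\<^sub>t f \<approx> f"
    and eqv_Comp_Id: "wt P f \<Longrightarrow> msrc P f = v \<Longrightarrow> f \<circ>\<^sub>t Idm v \<approx> f"
    and eqv_Add_assoc: "wt P ((f +\<^sub>t g) +\<^sub>t h) \<Longrightarrow> (f +\<^sub>t g) +\<^sub>t h \<approx> f +\<^sub>t g +\<^sub>t h"
    and eqv_Add_comm: "wt P (f +\<^sub>t g) \<Longrightarrow> f +\<^sub>t g \<approx> g +\<^sub>t f"
    and eqv_Add_Zer: "wt P (f +\<^sub>t Zer v w) \<Longrightarrow> f +\<^sub>t Zer v w \<approx> f"
    and eqv_Scl_zero: "wt P f \<Longrightarrow> 0 *\<^sub>t f \<approx> Zer (msrc P f) (mtgt P f)"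
    and eqv_Scl_one: "wt P f \<Longrightarrow> 1 *\<^sub>t f \<approx> f"
    and eqv_Scl_Scl: "wt P f \<Longrightarrow> c *\<^sub>t c' *\<^sub>t f \<approx> (c * c') *\<^sub>t f"
    and eqv_Scl_add: "wt P f \<Longrightarrow> (c + c') *\<^sub>t f \<approx> (c *\<^sub>t f) +\<^sub>t (c' *\<^sub>t f)"
    and eqv_Scl_Add: "wt P (f +\<^sub>t g) \<Longrightarrow> c *\<^sub>t (f +\<^sub>t g) \<approx> (c *\<^sub>t f) +\<^sub>t (c *\<^sub>t g)"
    and eqv_Add_Comp: "wt P ((g +\<^sub>t g') \<circ>\<^sub>t f) \<Longrightarrow> (g +\<^sub>t g') \<circ>\<^sub>t f \<approx> (g \<circ>\<^sub>t f) +\<^sub>t (g' \<circ>\<^sub>t f)"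
    and eqv_Comp_Add: "wt P (g \<circ>\<^sub>t (f +\<^sub>t f')) \<Longrightarrow> g \<circ>\<^sub>t (f +\<^sub>t f') \<approx> (g \<circ>\<^sub>t f) +\<^sub>t (g \<circ>\<^sub>t f')"
    and eqv_Scl_Comp: "wt P (g \<circ>\<^sub>t f) \<Longrightarrow> (c *\<^sub>t g) \<circ>\<^sub>t f \<approx> c *\<^sub>t (g \<circ>\<^sub>t f)"
    and eqv_Comp_Scl: "wt P (g \<circ>\<^sub>t f) \<Longrightarrow> g \<circ>\<^sub>t (c *\<^sub>t f) \<approx> c *\<^sub>t (g \<circ>\<^sub>t f)"
    and eqv_Add_Tens: "wt P ((f +\<^sub>t f') \<otimes>\<^sub>t g) \<Longrightarrow> (f +\<^sub>t f') \<otimes>\<^sub>t g \<approx> (f \<otimes>\<^sub>t g) +\<^sub>t (f' \<otimes>\<^sub>t g)"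
    and eqv_Tens_Add: "wt P (f \<otimes>\<^sub>t (g +\<^sub>t g')) \<Longrightarrow> f \<otimes>\<^sub>t (g +\<^sub>t g') \<approx> (f \<otimes>\<^sub>t g) +\<^sub>t (f \<otimes>\<^sub>t g')"
    and eqv_Scl_Tens: "wt P (f \<otimes>\<^sub>t g) \<Longrightarrow> (c *\<^sub>t f) \<otimes>\<^sub>t g \<approx> c *\<^sub>t (f \<otimes>\<^sub>t g)"
    and eqv_Tens_Scl: "wt P (f \<otimes>\<^sub>t g) \<Longrightarrow> f \<otimes>\<^sub>t (c *\<^sub>t g) \<approx> c *\<^sub>t (f \<otimes>\<^sub>t g)"
    and eqv_Tens_assoc: "wt P (f \<otimes>\<^sub>t g \<otimes>\<^sub>t h) \<Longrightarrow> (f \<otimes>\<^sub>t g) \<otimes>\<^sub>t h \<approx> f \<otimes>\<^sub>t g \<otimes>\<^sub>t h"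
    and eqv_unit_Tens: "wt P f \<Longrightarrow> Idm [] \<otimes>\<^sub>t f \<approx> f"
    and eqv_Tens_unit: "wt P f \<Longrightarrow> f \<otimes>\<^sub>t Idm [] \<approx> f"
    and eqv_Id_Tens_Id: "wt P (Idm (v @ w)) \<Longrightarrow> Idm v \<otimes>\<^sub>t Idm w \<approx> Idm (v @ w)"
  unfolding eqv_def
  by (auto simp: arr_iff intro: Comp_assoc Id_Comp Comp_Id Add_assoc Add_comm Add_Zer Scl_zero Scl_one
      Scl_Scl Scl_add Scl_Add Add_Comp Comp_Add Scl_Comp Comp_Scl Add_Tens Tens_Add Scl_Tens Tens_Scl
      Tens_assoc unit_Tens Tens_unit Id_Tens_Id)

lemma eqv_interchange:
  assumes "wt P (f' \<circ>\<^sub>t f)" "wt P (g \<circ>\<^sub>t g')" "mpar P f p" "mpar P g q"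
  shows "(f' \<otimes>\<^sub>t g) \<circ>\<^sub>t (f \<otimes>\<^sub>t g') \<approx> koszul (p * q) 1 *\<^sub>t ((f' \<circ>\<^sub>t f) \<otimes>\<^sub>t (g \<circ>\<^sub>t g'))"
  unfolding eqv_def using assms
  by (simp only: msrc.simps mtgt.simps, intro interchange) (simp_all add: arr_iff)

text \<open>Apart from neutrality for addition, the presentation speaks of zero morphisms only
  through \<open>0 *\<^sub>t f\<close>. This and the following absorption laws all come from writing
  \<open>Zer\<close> as a multiple by 0 and pulling that scalar out.\<close>

lemma eqv_Zer_Scl: "wt P (Zer v w) \<Longrightarrow> c *\<^sub>t Zer v w \<approx> Zer v w"
proof -
  assume wt: "wt P (Zer v w)"
  have "c *\<^sub>t Zer v w \<approx> c *\<^sub>t 0 *\<^sub>t Zer v w"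
    using eqv_Scl_zero[OF wt] eqv_sym eqv_cong_Scl by fastforce
  also have "\<dots> \<approx> (c * 0) *\<^sub>t Zer v w"
    using eqv_Scl_Scl wt by blast
  also have "\<dots> \<approx> Zer v w"
    using eqv_Scl_zero[OF wt] by simp
  finally show ?thesis .
qed

lemma eqv_Zer_Comp:
  assumes "wt P f" "mtgt P f = v" "set w \<subseteq> letters P"
  shows "Zer v w \<circ>\<^sub>t f \<approx> Zer (msrc P f) w"
proof -
  have wt: "wt P (Zer v w \<circ>\<^sub>t f)"
    using assms wt_letters[OF assms(1)] by auto
  have "Zer v w \<circ>\<^sub>t f \<approx> (0 *\<^sub>t Zer v w) \<circ>\<^sub>t f"
    using eqv_Scl_zero[of "Zer v w"] wt assms by (intro eqv_cong_Comp eqv_refl) (auto intro: eqv_sym)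
  also have "\<dots> \<approx> 0 *\<^sub>t (Zer v w \<circ>\<^sub>t f)"
    by (rule eqv_Scl_Comp[OF wt])
  also have "\<dots> \<approx> Zer (msrc P f) w"
    using eqv_Scl_zero[OF wt] by simp
  finally show ?thesis .
qed

lemma eqv_Comp_Zer:
  assumes "wt P f" "msrc P f = w" "set v \<subseteq> letters P"
  shows "f \<circ>\<^sub>t Zer v w \<approx> Zer v (mtgt P f)"
proof -
  have wt: "wt P (f \<circ>\<^sub>t Zer v w)"
    using assms wt_letters[OF assms(1)] by auto
  have "f \<circ>\<^sub>t Zer v w \<approx> f \<circ>\<^sub>t (0 *\<^sub>t Zer v w)"
    using eqv_Scl_zero[of "Zer v w"] wt assms by (intro eqv_cong_Comp eqv_refl) (auto intro: eqv_sym)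
  also have "\<dots> \<approx> 0 *\<^sub>t (f \<circ>\<^sub>t Zer v w)"
    by (rule eqv_Comp_Scl[OF wt])
  also have "\<dots> \<approx> Zer v (mtgt P f)"
    using eqv_Scl_zero[OF wt] by simp
  finally show ?thesis .
qed

lemma eqv_Zer_Tens:
  assumes "wt P f" "set v \<subseteq> letters P" "set w \<subseteq> letters P"
  shows "Zer v w \<otimes>\<^sub>t f \<approx> Zer (v @ msrc P f) (w @ mtgt P f)"
proof -
  have wt: "wt P (Zer v w \<otimes>\<^sub>t f)"
    using assms by auto
  have "Zer v w \<otimes>\<^sub>t f \<approx> (0 *\<^sub>t Zer v w) \<otimes>\<^sub>t f"
    using eqv_Scl_zero[of "Zer v w"] wt assms by (intro eqv_cong_Tens eqv_refl) (auto intro: eqv_sym)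
  also have "\<dots> \<approx> 0 *\<^sub>t (Zer v w \<otimes>\<^sub>t f)"
    by (rule eqv_Scl_Tens[OF wt])
  also have "\<dots> \<approx> Zer (v @ msrc P f) (w @ mtgt P f)"
    using eqv_Scl_zero[OF wt] by simp
  finally show ?thesis .
qed

lemma eqv_Tens_Zer:
  assumes "wt P f" "set v \<subseteq> letters P" "set w \<subseteq> letters P"
  shows "f \<otimes>\<^sub>t Zer v w \<approx> Zer (msrc P f @ v) (mtgt P f @ w)"
proof -
  have wt: "wt P (f \<otimes>\<^sub>t Zer v w)"
    using assms by auto
  have "f \<otimes>\<^sub>t Zer v w \<approx> f \<otimes>\<^sub>t (0 *\<^sub>t Zer v w)"
    using eqv_Scl_zero[of "Zer v w"] wt assms by (intro eqv_cong_Tens eqv_refl) (auto intro: eqv_sym)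
  also have "\<dots> \<approx> 0 *\<^sub>t (f \<otimes>\<^sub>t Zer v w)"
    by (rule eqv_Tens_Scl[OF wt])
  also have "\<dots> \<approx> Zer (msrc P f @ v) (mtgt P f @ w)"
    using eqv_Scl_zero[OF wt] by simp
  finally show ?thesis .
qed

section \<open>Vanishing morphisms\<close>

definition null :: "('k, 'o, 'g) mor \<Rightarrow> bool" where
  "null f \<longleftrightarrow> f \<approx> Zer (msrc P f) (mtgt P f)"

lemma null_wt: "null f \<Longrightarrow> wt P f"
  unfolding null_def using eqvD by blast

lemma null_Zer [simp]: "null (Zer v w) \<longleftrightarrow> set v \<subseteq> letters P \<and> set w \<subseteq> letters P"
  using eqv_refl[of "Zer v w"] eqvD(1)[of "Zer v w"] unfolding null_def by auto

lemma null_eqv: "f \<approx> g \<Longrightarrow> null g \<Longrightarrow> null f"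
  unfolding null_def using eqv_trans eqvD by metis

lemma null_null: "null f \<Longrightarrow> null g \<Longrightarrow> msrc P f = msrc P g \<Longrightarrow> mtgt P f = mtgt P g \<Longrightarrow> f \<approx> g"
  unfolding null_def using eqv_trans eqv_sym by metis

lemma null_Comp_left:
  assumes "null g" "wt P (g \<circ>\<^sub>t f)"
  shows "null (g \<circ>\<^sub>t f)"
proof (rule null_eqv)
  show "g \<circ>\<^sub>t f \<approx> Zer (msrc P g) (mtgt P g) \<circ>\<^sub>t f"
    using assms by (intro eqv_cong_Comp eqv_refl) (auto simp: null_def)
  show "null (Zer (msrc P g) (mtgt P g) \<circ>\<^sub>t f)"
    using assms wt_letters[of g] by (simp add: null_def eqv_Zer_Comp)
qed

lemma null_Comp_right:
  assumes "null f" "wt P (g \<circ>\<^sub>t f)"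
  shows "null (g \<circ>\<^sub>t f)"
proof (rule null_eqv)
  show "g \<circ>\<^sub>t f \<approx> g \<circ>\<^sub>t Zer (msrc P f) (mtgt P f)"
    using assms by (intro eqv_cong_Comp eqv_refl) (auto simp: null_def)
  show "null (g \<circ>\<^sub>t Zer (msrc P f) (mtgt P f))"
    using assms wt_letters[of f] by (simp add: null_def eqv_Comp_Zer)
qed

lemma null_Tens_left:
  assumes "null f" "wt P g"
  shows "null (f \<otimes>\<^sub>t g)"
proof (rule null_eqv)
  show "f \<otimes>\<^sub>t g \<approx> Zer (msrc P f) (mtgt P f) \<otimes>\<^sub>t g"
    using assms by (intro eqv_cong_Tens eqv_refl) (auto simp: null_def)
  show "null (Zer (msrc P f) (mtgt P f) \<otimes>\<^sub>t g)"
    using assms wt_letters[of f] null_wt[of f] by (simp add: null_def eqv_Zer_Tens)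
qed

lemma null_Tens_right:
  assumes "null g" "wt P f"
  shows "null (f \<otimes>\<^sub>t g)"
proof (rule null_eqv)
  show "f \<otimes>\<^sub>t g \<approx> f \<otimes>\<^sub>t Zer (msrc P g) (mtgt P g)"
    using assms by (intro eqv_cong_Tens eqv_refl) (auto simp: null_def)
  show "null (f \<otimes>\<^sub>t Zer (msrc P g) (mtgt P g))"
    using assms wt_letters[of g] null_wt[of g] by (simp add: null_def eqv_Tens_Zer)
qed

lemma null_Add:
  assumes "null f" "null g" "wt P (f +\<^sub>t g)"
  shows "null (f +\<^sub>t g)"
proof (rule null_eqv)
  show "f +\<^sub>t g \<approx> Zer (msrc P f) (mtgt P f) +\<^sub>t Zer (msrc P f) (mtgt P f)"
    using assms by (intro eqv_cong_Add) (auto simp: null_def)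
  show "null (Zer (msrc P f) (mtgt P f) +\<^sub>t Zer (msrc P f) (mtgt P f))"
    using wt_letters[of f] null_wt[OF assms(1)] by (simp add: null_def eqv_Add_Zer)
qed

lemma null_Scl:
  assumes "null f"
  shows "null (c *\<^sub>t f)"
proof (rule null_eqv)
  show "c *\<^sub>t f \<approx> c *\<^sub>t Zer (msrc P f) (mtgt P f)"
    using assms by (intro eqv_cong_Scl) (auto simp: null_def)
  show "null (c *\<^sub>t Zer (msrc P f) (mtgt P f))"
    using wt_letters[of f] null_wt[OF assms(1)] by (simp add: null_def eqv_Zer_Scl)
qed

text \<open>Generators permute letters, so the category splits into blocks indexed by multisets of
  letters. If a composite or a tensor product changes the multiset, one of its factors already
  does.\<close>

lemma null_if_mset_neq:
  assumes "\<And>g. g \<in> gens P \<Longrightarrow> mset (src P g) = mset (tgt P g)"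
  shows "wt P f \<Longrightarrow> mset (msrc P f) \<noteq> mset (mtgt P f) \<Longrightarrow> null f"
proof (induction f)
  case (Comp g f)
  then show ?case
    using null_Comp_left[of g f] null_Comp_right[of f g] by (cases "mset (mtgt P f) = mset (msrc P f)") auto
next
  case (Tens f g)
  then show ?case
    using null_Tens_left[of f g] null_Tens_right[of g f]
    by (cases "mset (mtgt P f) = mset (msrc P f)") auto
next
  case (Add f g)
  then show ?case by (intro null_Add) auto
next
  case (Scl c f)
  then show ?case by (intro null_Scl) auto
qed (use assms in auto)

text \<open>No generator starts at the empty word. A composite may still visit a nonempty word, but
  then its first factor changes the letters and vanishes, which gives the scalar 0. This controls
  whatever can stand to the left of a leading \<open>Q\<close>.\<close>

lemma endomorphism_of_unit_scalar:
  assumes mset: "\<And>g. g \<in> gens P \<Longrightarrow> mset (src P g) = mset (tgt P g)"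
    and pos: "\<And>g. g \<in> gens P \<Longrightarrow> src P g \<noteq> []"
  shows "wt P f \<Longrightarrow> msrc P f = [] \<Longrightarrow> mtgt P f = [] \<Longrightarrow> \<exists>c. f \<approx> c *\<^sub>t Idm []"
proof (induction f)
  case (Gen g)
  then show ?case using pos by auto
next
  case (Idm w)
  then show ?case using eqv_sym[OF eqv_Scl_one[of "Idm []"]] by auto
next
  case (Comp g f)
  show ?case
  proof (cases "mtgt P f = []")
    case True
    then obtain c c' where "g \<approx> c *\<^sub>t Idm []" "f \<approx> c' *\<^sub>t Idm []"
      using Comp by auto
    then have "g \<circ>\<^sub>t f \<approx> (c *\<^sub>t Idm []) \<circ>\<^sub>t (c' *\<^sub>t Idm [])"
      using Comp True by (intro eqv_cong_Comp) auto
    also have "\<dots> \<approx> c *\<^sub>t (Idm [] \<circ>\<^sub>t (c' *\<^sub>t Idm []))"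
      by (rule eqv_Scl_Comp) auto
    also have "\<dots> \<approx> c *\<^sub>t (c' *\<^sub>t Idm [])"
      by (rule eqv_cong_Scl, rule eqv_Id_Comp) auto
    also have "\<dots> \<approx> (c * c') *\<^sub>t Idm []"
      by (rule eqv_Scl_Scl) auto
    finally show ?thesis by blast
  next
    case False
    then have "null f"
      using Comp.prems by (intro null_if_mset_neq[OF mset]) auto
    then have "null (g \<circ>\<^sub>t f)"
      using Comp.prems null_Comp_right by blast
    then have "g \<circ>\<^sub>t f \<approx> Zer [] []"
      using Comp.prems by (simp add: null_def)
    also have "Zer [] [] \<approx> 0 *\<^sub>t Idm []"
      using eqv_sym[OF eqv_Scl_zero[of "Idm []"]] by simp
    finally have "g \<circ>\<^sub>t f \<approx> 0 *\<^sub>t Idm []" .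
    then show ?thesis by blast
  qed
next
  case (Tens f g)
  then obtain c c' where cc: "f \<approx> c *\<^sub>t Idm []" "g \<approx> c' *\<^sub>t Idm []"
    by auto
  then have "f \<otimes>\<^sub>t g \<approx> (c *\<^sub>t Idm []) \<otimes>\<^sub>t (c' *\<^sub>t Idm [])"
    by (rule eqv_cong_Tens)
  also have "\<dots> \<approx> c *\<^sub>t (Idm [] \<otimes>\<^sub>t (c' *\<^sub>t Idm []))"
    by (rule eqv_Scl_Tens) auto
  also have "\<dots> \<approx> c *\<^sub>t (c' *\<^sub>t Idm [])"
    by (rule eqv_cong_Scl, rule eqv_unit_Tens) auto
  also have "\<dots> \<approx> (c * c') *\<^sub>t Idm []"
    by (rule eqv_Scl_Scl) auto
  finally show ?case by blast
next
  case (Zer v w)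
  then show ?case using eqv_sym[OF eqv_Scl_zero[of "Idm []"]] by auto
next
  case (Add f g)
  then obtain c c' where "f \<approx> c *\<^sub>t Idm []" "g \<approx> c' *\<^sub>t Idm []"
    by auto
  then have "f +\<^sub>t g \<approx> (c *\<^sub>t Idm []) +\<^sub>t (c' *\<^sub>t Idm [])"
    using Add by (intro eqv_cong_Add) auto
  also have "\<dots> \<approx> (c + c') *\<^sub>t Idm []"
    by (rule eqv_sym, rule eqv_Scl_add) auto
  finally show ?case by blast
next
  case (Scl c f)
  then obtain c' where "f \<approx> c' *\<^sub>t Idm []"
    by auto
  then have "c *\<^sub>t f \<approx> c *\<^sub>t (c' *\<^sub>t Idm [])"
    by (rule eqv_cong_Scl)
  also have "\<dots> \<approx> (c * c') *\<^sub>t Idm []"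
    by (rule eqv_Scl_Scl) auto
  finally show ?case by blast
qed

end


section \<open>Bilinear expansions and the interchange law\<close>

context wf_presentation
begin

lemma eqv_Add_shuffle:
  assumes "wt P ((a +\<^sub>t b) +\<^sub>t (c +\<^sub>t d))"
  shows "(a +\<^sub>t b) +\<^sub>t (c +\<^sub>t d) \<approx> (a +\<^sub>t d) +\<^sub>t (b +\<^sub>t c)"
proof -
  have "(a +\<^sub>t b) +\<^sub>t (c +\<^sub>t d) \<approx> a +\<^sub>t (b +\<^sub>t (c +\<^sub>t d))"
    using assms by (intro eqv_Add_assoc) auto
  also have "\<dots> \<approx> a +\<^sub>t ((b +\<^sub>t c) +\<^sub>t d)"
    using assms by (intro eqv_cong_Add eqv_refl eqv_sym[OF eqv_Add_assoc]) auto
  also have "\<dots> \<approx> a +\<^sub>t (d +\<^sub>t (b +\<^sub>t c))"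
    using assms by (intro eqv_cong_Add eqv_refl eqv_Add_comm) auto
  also have "\<dots> \<approx> (a +\<^sub>t d) +\<^sub>t (b +\<^sub>t c)"
    using assms by (intro eqv_sym[OF eqv_Add_assoc]) auto
  finally show ?thesis .
qed

text \<open>The terms are grouped by parity: with \<open>a\<close>, \<open>c\<close> even and
  \<open>b\<close>, \<open>d\<close> odd, the first bracket is even and the second one odd.\<close>

lemma eqv_Comp_Add_Add:
  assumes "wt P ((a +\<^sub>t b) \<circ>\<^sub>t (c +\<^sub>t d))"
  shows "(a +\<^sub>t b) \<circ>\<^sub>t (c +\<^sub>t d) \<approx> ((a \<circ>\<^sub>t c) +\<^sub>t (b \<circ>\<^sub>t d)) +\<^sub>t ((a \<circ>\<^sub>t d) +\<^sub>t (b \<circ>\<^sub>t c))"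
proof -
  have "(a +\<^sub>t b) \<circ>\<^sub>t (c +\<^sub>t d) \<approx> (a \<circ>\<^sub>t (c +\<^sub>t d)) +\<^sub>t (b \<circ>\<^sub>t (c +\<^sub>t d))"
    using assms by (intro eqv_Add_Comp) auto
  also have "\<dots> \<approx> ((a \<circ>\<^sub>t c) +\<^sub>t (a \<circ>\<^sub>t d)) +\<^sub>t ((b \<circ>\<^sub>t c) +\<^sub>t (b \<circ>\<^sub>t d))"
    using assms by (intro eqv_cong_Add eqv_Comp_Add) auto
  also have "\<dots> \<approx> ((a \<circ>\<^sub>t c) +\<^sub>t (b \<circ>\<^sub>t d)) +\<^sub>t ((a \<circ>\<^sub>t d) +\<^sub>t (b \<circ>\<^sub>t c))"
    using assms by (intro eqv_Add_shuffle) auto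
  finally show ?thesis .
qed

lemma eqv_Tens_Add_Add:
  assumes "wt P ((a +\<^sub>t b) \<otimes>\<^sub>t (c +\<^sub>t d))"
  shows "(a +\<^sub>t b) \<otimes>\<^sub>t (c +\<^sub>t d) \<approx> ((a \<otimes>\<^sub>t c) +\<^sub>t (b \<otimes>\<^sub>t d)) +\<^sub>t ((a \<otimes>\<^sub>t d) +\<^sub>t (b \<otimes>\<^sub>t c))"
proof -
  have "(a +\<^sub>t b) \<otimes>\<^sub>t (c +\<^sub>t d) \<approx> (a \<otimes>\<^sub>t (c +\<^sub>t d)) +\<^sub>t (b \<otimes>\<^sub>t (c +\<^sub>t d))"
    using assms by (intro eqv_Add_Tens) auto
  also have "\<dots> \<approx> ((a \<otimes>\<^sub>t c) +\<^sub>t (a \<otimes>\<^sub>t d)) +\<^sub>t ((b \<otimes>\<^sub>t c) +\<^sub>t (b \<otimes>\<^sub>t d))"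
    using assms by (intro eqv_cong_Add eqv_Tens_Add) auto
  also have "\<dots> \<approx> ((a \<otimes>\<^sub>t c) +\<^sub>t (b \<otimes>\<^sub>t d)) +\<^sub>t ((a \<otimes>\<^sub>t d) +\<^sub>t (b \<otimes>\<^sub>t c))"
    using assms by (intro eqv_Add_shuffle) auto
  finally show ?thesis .
qed

lemma eqv_Comp_Tens_homog:
  assumes "wt P (f' \<circ>\<^sub>t f)" "wt P (g \<circ>\<^sub>t g')" "mpar P f p" "mpar P g q" "p * q = 0"
  shows "(f' \<otimes>\<^sub>t g) \<circ>\<^sub>t (f \<otimes>\<^sub>t g') \<approx> (f' \<circ>\<^sub>t f) \<otimes>\<^sub>t (g \<circ>\<^sub>t g')"
proof -
  have "(f' \<otimes>\<^sub>t g) \<circ>\<^sub>t (f \<otimes>\<^sub>t g') \<approx> 1 *\<^sub>t ((f' \<circ>\<^sub>t f) \<otimes>\<^sub>t (g \<circ>\<^sub>t g'))"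
    using eqv_interchange[OF assms(1-4)] unfolding assms(5) by (simp add: koszul_def)
  also have "\<dots> \<approx> (f' \<circ>\<^sub>t f) \<otimes>\<^sub>t (g \<circ>\<^sub>t g')"
    using assms by (intro eqv_Scl_one) auto
  finally show ?thesis .
qed

text \<open>Identities are even, so no sign appears even if \<open>f\<close> and \<open>g\<close>
  have no parity. Tensoring by an arbitrary morphism is thereby reduced to tensoring by
  identities.\<close>

lemma eqv_Tens_split:
  assumes "wt P f" "wt P g"
  shows "f \<otimes>\<^sub>t g \<approx> (f \<otimes>\<^sub>t Idm (mtgt P g)) \<circ>\<^sub>t (Idm (msrc P f) \<otimes>\<^sub>t g)"
proof -
  have "(f \<otimes>\<^sub>t Idm (mtgt P g)) \<circ>\<^sub>t (Idm (msrc P f) \<otimes>\<^sub>t g) \<approx>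
      (f \<circ>\<^sub>t Idm (msrc P f)) \<otimes>\<^sub>t (Idm (mtgt P g) \<circ>\<^sub>t g)"
    using assms wt_letters[of f] wt_letters[of g] mpar_Id
    by (intro eqv_Comp_Tens_homog[where p = 0 and q = 0]) auto
  also have "\<dots> \<approx> f \<otimes>\<^sub>t g"
    using assms by (intro eqv_cong_Tens eqv_Comp_Id eqv_Id_Comp) auto
  finally show ?thesis by (rule eqv_sym)
qed

end

text \<open>
  The interchange law of the presentation only covers homogeneous terms, whereas tokens of
  inhomogeneous elements have no parity. Splitting a term into homogeneous parts extends the law to
  arbitrary terms next to an even one.
\<close>

locale super_presentation = wf_presentation +
  assumes gen_decomp:
    "g \<in> gens P \<Longrightarrow> \<exists>f0 f1. mpar P f0 0 \<and> mpar P f1 1 \<and> eqv P (Gen g) (f0 +\<^sub>t f1)"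
begin

lemma homogeneous_decomposition:
  "wt P f \<Longrightarrow> \<exists>f0 f1. mpar P f0 0 \<and> mpar P f1 1 \<and> f \<approx> f0 +\<^sub>t f1"
proof (induction f)
  case (Gen g)
  then show ?case using gen_decomp by auto
next
  case (Idm w)
  then have "Idm w \<approx> Idm w +\<^sub>t Zer w w"
    by (intro eqv_sym[OF eqv_Add_Zer]) auto
  then show ?case using mpar_Id mpar_Zer by blast
next
  case (Comp g f)
  then obtain g0 g1 f0 f1 where h: "mpar P g0 0" "mpar P g1 1" "g \<approx> g0 +\<^sub>t g1"
    "mpar P f0 0" "mpar P f1 1" "f \<approx> f0 +\<^sub>t f1" by auto
  have "g \<circ>\<^sub>t f \<approx> (g0 +\<^sub>t g1) \<circ>\<^sub>t (f0 +\<^sub>t f1)"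
    using h Comp.prems by (intro eqv_cong_Comp) auto
  also have "\<dots> \<approx> ((g0 \<circ>\<^sub>t f0) +\<^sub>t (g1 \<circ>\<^sub>t f1)) +\<^sub>t ((g0 \<circ>\<^sub>t f1) +\<^sub>t (g1 \<circ>\<^sub>t f0))"
    using eqvD(2)[OF calculation] by (rule eqv_Comp_Add_Add)
  finally show ?case
    using h mpar_Comp[of P g0 0 f0 0] mpar_Comp[of P g1 1 f1 1] mpar_Comp[of P g0 0 f1 1]
      mpar_Comp[of P g1 1 f0 0] mpar_Add[of P "g0 \<circ>\<^sub>t f0" 0 "g1 \<circ>\<^sub>t f1"]
      mpar_Add[of P "g0 \<circ>\<^sub>t f1" 1 "g1 \<circ>\<^sub>t f0"] by auto
next
  case (Tens f g)
  then obtain g0 g1 f0 f1 where h: "mpar P g0 0" "mpar P g1 1" "g \<approx> g0 +\<^sub>t g1"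
    "mpar P f0 0" "mpar P f1 1" "f \<approx> f0 +\<^sub>t f1" by auto
  have "f \<otimes>\<^sub>t g \<approx> (f0 +\<^sub>t f1) \<otimes>\<^sub>t (g0 +\<^sub>t g1)"
    using h by (intro eqv_cong_Tens) auto
  also have "\<dots> \<approx> ((f0 \<otimes>\<^sub>t g0) +\<^sub>t (f1 \<otimes>\<^sub>t g1)) +\<^sub>t ((f0 \<otimes>\<^sub>t g1) +\<^sub>t (f1 \<otimes>\<^sub>t g0))"
    using eqvD(2)[OF calculation] by (rule eqv_Tens_Add_Add)
  finally show ?case
    using h mpar_Tens[of P f0 0 g0 0] mpar_Tens[of P f1 1 g1 1] mpar_Tens[of P f0 0 g1 1]
      mpar_Tens[of P f1 1 g0 0] mpar_Add[of P "f0 \<otimes>\<^sub>t g0" 0 "f1 \<otimes>\<^sub>t g1"]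
      mpar_Add[of P "f0 \<otimes>\<^sub>t g1" 1 "f1 \<otimes>\<^sub>t g0"] by auto
next
  case (Zer v w)
  then have "Zer v w \<approx> Zer v w +\<^sub>t Zer v w"
    by (intro eqv_sym[OF eqv_Add_Zer]) auto
  then show ?case using mpar_Zer by blast
next
  case (Add f g)
  then obtain g0 g1 f0 f1 where h: "mpar P g0 0" "mpar P g1 1" "g \<approx> g0 +\<^sub>t g1"
    "mpar P f0 0" "mpar P f1 1" "f \<approx> f0 +\<^sub>t f1" by auto
  have wt: "wt P ((f0 +\<^sub>t f1) +\<^sub>t (g0 +\<^sub>t g1))"
    using Add.prems eqvD[OF h(3)] eqvD[OF h(6)] by auto
  have "f +\<^sub>t g \<approx> (f0 +\<^sub>t f1) +\<^sub>t (g0 +\<^sub>t g1)"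
    using h Add.prems by (intro eqv_cong_Add) auto
  also have "\<dots> \<approx> (f0 +\<^sub>t f1) +\<^sub>t (g1 +\<^sub>t g0)"
    using wt by (intro eqv_cong_Add eqv_refl eqv_Add_comm) auto
  also have "\<dots> \<approx> (f0 +\<^sub>t g0) +\<^sub>t (f1 +\<^sub>t g1)"
    using wt by (intro eqv_Add_shuffle) auto
  finally show ?case using h mpar_Add[of P f0 0 g0] mpar_Add[of P f1 1 g1] by auto
next
  case (Scl c f)
  then obtain f0 f1 where h: "mpar P f0 0" "mpar P f1 1" "f \<approx> f0 +\<^sub>t f1" by auto
  have "c *\<^sub>t f \<approx> c *\<^sub>t (f0 +\<^sub>t f1)"
    using h by (intro eqv_cong_Scl)
  also have "\<dots> \<approx> (c *\<^sub>t f0) +\<^sub>t (c *\<^sub>t f1)"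
    using eqvD(2)[OF h(3)] by (intro eqv_Scl_Add) auto
  finally show ?case using h mpar_Scl[of P f0 0 c] mpar_Scl[of P f1 1 c] by auto
qed

lemma eqv_Comp_Tens_right_even:
  assumes "wt P (f' \<circ>\<^sub>t f)" "wt P (g \<circ>\<^sub>t g')" "mpar P g 0"
  shows "(f' \<otimes>\<^sub>t g) \<circ>\<^sub>t (f \<otimes>\<^sub>t g') \<approx> (f' \<circ>\<^sub>t f) \<otimes>\<^sub>t (g \<circ>\<^sub>t g')"
proof -
  obtain f0 f1 where h: "mpar P f0 0" "mpar P f1 1" "f \<approx> f0 +\<^sub>t f1"
    using homogeneous_decomposition[of f] assms(1) by auto
  note t = eqvD[OF h(3)] assms(1,2)
  have "(f' \<otimes>\<^sub>t g) \<circ>\<^sub>t (f \<otimes>\<^sub>t g') \<approx> (f' \<otimes>\<^sub>t g) \<circ>\<^sub>t ((f0 +\<^sub>t f1) \<otimes>\<^sub>t g')"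
    using h t by (intro eqv_cong_Comp eqv_cong_Tens eqv_refl) auto
  also have "\<dots> \<approx> (f' \<otimes>\<^sub>t g) \<circ>\<^sub>t ((f0 \<otimes>\<^sub>t g') +\<^sub>t (f1 \<otimes>\<^sub>t g'))"
    using t by (intro eqv_cong_Comp eqv_Add_Tens eqv_refl) auto
  also have "\<dots> \<approx> ((f' \<otimes>\<^sub>t g) \<circ>\<^sub>t (f0 \<otimes>\<^sub>t g')) +\<^sub>t ((f' \<otimes>\<^sub>t g) \<circ>\<^sub>t (f1 \<otimes>\<^sub>t g'))"
    using t by (intro eqv_Comp_Add) auto
  also have "\<dots> \<approx> ((f' \<circ>\<^sub>t f0) \<otimes>\<^sub>t (g \<circ>\<^sub>t g')) +\<^sub>t ((f' \<circ>\<^sub>t f1) \<otimes>\<^sub>t (g \<circ>\<^sub>t g'))"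
    using t h assms(3)
    by (intro eqv_cong_Add eqv_Comp_Tens_homog[where p = 0 and q = 0]
        eqv_Comp_Tens_homog[where p = 1 and q = 0]) auto
  also have "\<dots> \<approx> ((f' \<circ>\<^sub>t f0) +\<^sub>t (f' \<circ>\<^sub>t f1)) \<otimes>\<^sub>t (g \<circ>\<^sub>t g')"
    using t by (intro eqv_sym[OF eqv_Add_Tens]) auto
  also have "\<dots> \<approx> (f' \<circ>\<^sub>t (f0 +\<^sub>t f1)) \<otimes>\<^sub>t (g \<circ>\<^sub>t g')"
    using t by (intro eqv_cong_Tens eqv_refl eqv_sym[OF eqv_Comp_Add]) auto
  also have "\<dots> \<approx> (f' \<circ>\<^sub>t f) \<otimes>\<^sub>t (g \<circ>\<^sub>t g')"
    using t h by (intro eqv_cong_Tens eqv_cong_Comp eqv_refl) (auto intro: eqv_sym)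
  finally show ?thesis .
qed

lemma eqv_Comp_Tens_left_even:
  assumes "wt P (f' \<circ>\<^sub>t f)" "wt P (g \<circ>\<^sub>t g')" "mpar P f 0"
  shows "(f' \<otimes>\<^sub>t g) \<circ>\<^sub>t (f \<otimes>\<^sub>t g') \<approx> (f' \<circ>\<^sub>t f) \<otimes>\<^sub>t (g \<circ>\<^sub>t g')"
proof -
  obtain g0 g1 where h: "mpar P g0 0" "mpar P g1 1" "g \<approx> g0 +\<^sub>t g1"
    using homogeneous_decomposition[of g] assms(2) by auto
  note t = eqvD[OF h(3)] assms(1,2)
  have "(f' \<otimes>\<^sub>t g) \<circ>\<^sub>t (f \<otimes>\<^sub>t g') \<approx> (f' \<otimes>\<^sub>t (g0 +\<^sub>t g1)) \<circ>\<^sub>t (f \<otimes>\<^sub>t g')"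
    using h t by (intro eqv_cong_Comp eqv_cong_Tens eqv_refl) auto
  also have "\<dots> \<approx> ((f' \<otimes>\<^sub>t g0) +\<^sub>t (f' \<otimes>\<^sub>t g1)) \<circ>\<^sub>t (f \<otimes>\<^sub>t g')"
    using t by (intro eqv_cong_Comp eqv_Tens_Add eqv_refl) auto
  also have "\<dots> \<approx> ((f' \<otimes>\<^sub>t g0) \<circ>\<^sub>t (f \<otimes>\<^sub>t g')) +\<^sub>t ((f' \<otimes>\<^sub>t g1) \<circ>\<^sub>t (f \<otimes>\<^sub>t g'))"
    using t by (intro eqv_Add_Comp) auto
  also have "\<dots> \<approx> ((f' \<circ>\<^sub>t f) \<otimes>\<^sub>t (g0 \<circ>\<^sub>t g')) +\<^sub>t ((f' \<circ>\<^sub>t f) \<otimes>\<^sub>t (g1 \<circ>\<^sub>t g'))"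
    using t h assms(3)
    by (intro eqv_cong_Add eqv_Comp_Tens_homog[where p = 0 and q = 0]
        eqv_Comp_Tens_homog[where p = 0 and q = 1]) auto
  also have "\<dots> \<approx> (f' \<circ>\<^sub>t f) \<otimes>\<^sub>t ((g0 \<circ>\<^sub>t g') +\<^sub>t (g1 \<circ>\<^sub>t g'))"
    using t by (intro eqv_sym[OF eqv_Tens_Add]) auto
  also have "\<dots> \<approx> (f' \<circ>\<^sub>t f) \<otimes>\<^sub>t ((g0 +\<^sub>t g1) \<circ>\<^sub>t g')"
    using t by (intro eqv_cong_Tens eqv_refl eqv_sym[OF eqv_Add_Comp]) auto
  also have "\<dots> \<approx> (f' \<circ>\<^sub>t f) \<otimes>\<^sub>t (g \<circ>\<^sub>t g')"
    using t h by (intro eqv_cong_Tens eqv_cong_Comp eqv_refl) (auto intro: eqv_sym)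
  finally show ?thesis .
qed

lemma eqv_Comp_Tens_Id:
  assumes "wt P (g \<circ>\<^sub>t f)" "set u \<subseteq> letters P"
  shows "(g \<circ>\<^sub>t f) \<otimes>\<^sub>t Idm u \<approx> (g \<otimes>\<^sub>t Idm u) \<circ>\<^sub>t (f \<otimes>\<^sub>t Idm u)"
proof -
  have "(g \<otimes>\<^sub>t Idm u) \<circ>\<^sub>t (f \<otimes>\<^sub>t Idm u) \<approx> (g \<circ>\<^sub>t f) \<otimes>\<^sub>t (Idm u \<circ>\<^sub>t Idm u)"
    using assms by (intro eqv_Comp_Tens_right_even mpar_Id) auto
  also have "\<dots> \<approx> (g \<circ>\<^sub>t f) \<otimes>\<^sub>t Idm u"
    using assms by (intro eqv_cong_Tens eqv_refl eqv_Id_Comp) auto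
  finally show ?thesis by (rule eqv_sym)
qed

lemma eqv_Id_Tens_Comp:
  assumes "wt P (g \<circ>\<^sub>t f)" "set u \<subseteq> letters P"
  shows "Idm u \<otimes>\<^sub>t (g \<circ>\<^sub>t f) \<approx> (Idm u \<otimes>\<^sub>t g) \<circ>\<^sub>t (Idm u \<otimes>\<^sub>t f)"
proof -
  have "(Idm u \<otimes>\<^sub>t g) \<circ>\<^sub>t (Idm u \<otimes>\<^sub>t f) \<approx> (Idm u \<circ>\<^sub>t Idm u) \<otimes>\<^sub>t (g \<circ>\<^sub>t f)"
    using assms by (intro eqv_Comp_Tens_left_even mpar_Id) auto
  also have "\<dots> \<approx> Idm u \<otimes>\<^sub>t (g \<circ>\<^sub>t f)"
    using assms by (intro eqv_cong_Tens eqv_refl eqv_Id_Comp) auto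
  finally show ?thesis by (rule eqv_sym)
qed

end


section \<open>Congruences generated by null morphisms\<close>

text \<open>The congruence for composition and linear structure that sets the terms of
  \<open>B\<close> to zero. It deliberately has no tensor clause: the ideals in question live in
  endomorphism algebras and are not tensor ideals. Stability under strands on the right is proved
  separately for suitable \<open>B\<close>.\<close>

inductive qeq :: "('k::{comm_ring,comm_monoid_mult}, 'o, 'g) presentation \<Rightarrow>
    ('k, 'o, 'g) mor set \<Rightarrow> ('k, 'o, 'g) mor \<Rightarrow> ('k, 'o, 'g) mor \<Rightarrow> bool"
  for P B where
  qeq_eqv: "eqv P f g \<Longrightarrow> qeq P B f g"
| qeq_null: "f \<in> B \<Longrightarrow> wt P f \<Longrightarrow> qeq P B f (Zer (msrc P f) (mtgt P f))"
| qeq_sym: "qeq P B f g \<Longrightarrow> qeq P B g f"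
| qeq_trans: "qeq P B f g \<Longrightarrow> qeq P B g h \<Longrightarrow> qeq P B f h"
| qeq_Comp: "qeq P B g g' \<Longrightarrow> qeq P B f f' \<Longrightarrow> mtgt P f = msrc P g \<Longrightarrow>
    qeq P B (g \<circ>\<^sub>t f) (g' \<circ>\<^sub>t f')"
| qeq_Add: "qeq P B f f' \<Longrightarrow> qeq P B g g' \<Longrightarrow> msrc P f = msrc P g \<Longrightarrow> mtgt P f = mtgt P g \<Longrightarrow>
    qeq P B (f +\<^sub>t g) (f' +\<^sub>t g')"
| qeq_Scl: "qeq P B f f' \<Longrightarrow> qeq P B (c *\<^sub>t f) (c *\<^sub>t f')"

declare qeq_trans [trans]

lemma qeq_eqv_trans [trans]:
  "qeq P B f g \<Longrightarrow> eqv P g h \<Longrightarrow> qeq P B f h"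
  "eqv P f g \<Longrightarrow> qeq P B g h \<Longrightarrow> qeq P B f h"
  by (meson qeq_eqv qeq_trans)+

context wf_presentation
begin

lemma qeq_typed: "qeq P B f g \<Longrightarrow>
    wt P f \<and> wt P g \<and> msrc P g = msrc P f \<and> mtgt P g = mtgt P f"
  by (induction rule: qeq.induct) (auto dest: eqvD wt_letters)

lemma qeqD:
  assumes "qeq P B f g"
  shows "wt P f" "wt P g" "msrc P g = msrc P f" "mtgt P g = mtgt P f"
  using qeq_typed[OF assms] by auto

lemma qeq_imp_eq:
  assumes eqv: "\<And>f g. f \<approx> g \<Longrightarrow> msrc P f \<in> L \<Longrightarrow> mtgt P f \<in> L \<Longrightarrow> \<theta> f = \<theta> g"
    and Comp: "\<And>g f. wt P (g \<circ>\<^sub>t f) \<Longrightarrow> msrc P f \<in> L \<Longrightarrow> mtgt P f \<in> L \<Longrightarrow> mtgt P g \<in> L \<Longrightarrow>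
      \<theta> (g \<circ>\<^sub>t f) = mul (\<theta> g) (\<theta> f)"
    and outside: "\<And>f. wt P f \<Longrightarrow> msrc P f \<in> L \<Longrightarrow> mtgt P f \<notin> L \<Longrightarrow> null f"
    and Add: "\<And>f g. wt P (f +\<^sub>t g) \<Longrightarrow> msrc P f \<in> L \<Longrightarrow> mtgt P f \<in> L \<Longrightarrow>
      \<theta> (f +\<^sub>t g) = pl (\<theta> f) (\<theta> g)"
    and Scl: "\<And>c f. wt P f \<Longrightarrow> msrc P f \<in> L \<Longrightarrow> mtgt P f \<in> L \<Longrightarrow> \<theta> (c *\<^sub>t f) = sc c (\<theta> f)"
    and B: "\<And>f. f \<in> B \<Longrightarrow> wt P f \<Longrightarrow> msrc P f \<in> L \<Longrightarrow> mtgt P f \<in> L \<Longrightarrow>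
      \<theta> f = \<theta> (Zer (msrc P f) (mtgt P f))"
  shows "qeq P B f g \<Longrightarrow> msrc P f \<in> L \<Longrightarrow> mtgt P f \<in> L \<Longrightarrow> \<theta> f = \<theta> g"
proof (induction rule: qeq.induct)
  case (qeq_eqv f g)
  then show ?case by (rule eqv)
next
  case (qeq_null f)
  then show ?case by (intro B)
next
  case (qeq_sym f g)
  then show ?case using qeqD[OF qeq_sym.hyps] by simp
next
  case (qeq_trans f g h)
  then show ?case using qeqD[OF qeq_trans.hyps(1)] by simp
next
  case (qeq_Comp g g' f f')
  note t = qeqD[OF qeq_Comp.hyps(1)] qeqD[OF qeq_Comp.hyps(2)] qeq_Comp.hyps(3) qeq_Comp.prems
  show ?case
  proof (cases "mtgt P f \<in> L")
    case True
    then show ?thesis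
      using qeq_Comp.IH t by (simp add: Comp)
  next
    \<comment> \<open>Outside \<open>L\<close> the induction hypotheses say nothing; both composites
      are zero for their first factor is.\<close>
    case False
    have "null (g \<circ>\<^sub>t f)"
      using t False by (intro null_Comp_right outside) auto
    moreover have "null (g' \<circ>\<^sub>t f')"
      using t False by (intro null_Comp_right outside) auto
    ultimately show ?thesis
      using t by (intro eqv null_null) auto
  qed
next
  case (qeq_Add f f' g g')
  note t = qeqD[OF qeq_Add.hyps(1)] qeqD[OF qeq_Add.hyps(2)] qeq_Add.hyps(3-) qeq_Add.prems
  show ?case using qeq_Add.IH t by (simp add: Add)
next
  case (qeq_Scl f f' c)
  note t = qeqD[OF qeq_Scl.hyps(1)] qeq_Scl.prems
  show ?case using qeq_Scl.IH t by (simp add: Scl)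
qed

end

text \<open>By \<open>eqv_Tens_split\<close> it suffices to tensor with identities, which commutes
  with every operation generating the congruence. Only the generators \<open>B\<close> themselves
  have to be inspected.\<close>

lemma (in super_presentation) qeq_Tens_right:
  assumes B: "\<And>f u. f \<in> B \<Longrightarrow> wt P f \<Longrightarrow> set u \<subseteq> letters P \<Longrightarrow>
      qeq P B (f \<otimes>\<^sub>t Idm u) (Zer (msrc P f @ u) (mtgt P f @ u))"
    and q: "qeq P B f f'" and g: "wt P g"
  shows "qeq P B (f \<otimes>\<^sub>t g) (f' \<otimes>\<^sub>t g)"
proof -
  have Id: "qeq P B (f \<otimes>\<^sub>t Idm u) (f' \<otimes>\<^sub>t Idm u)" if u: "set u \<subseteq> letters P" for u
    using q
  proof (induction rule: qeq.induct)
    case (qeq_eqv f g)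
    then show ?case using u by (intro qeq.qeq_eqv eqv_cong_Tens eqv_refl) auto
  next
    case (qeq_null f)
    then have "qeq P B (f \<otimes>\<^sub>t Idm u) (Zer (msrc P f @ u) (mtgt P f @ u))"
      using B u by blast
    also have "eqv P \<dots> (Zer (msrc P f) (mtgt P f) \<otimes>\<^sub>t Idm u)"
      using wt_letters[OF qeq_null(2)] u
      by (intro eqv_sym[OF eqv_Zer_Tens[of "Idm u", simplified]]) auto
    finally show ?case .
  next
    case (qeq_sym f g)
    show ?case by (rule qeq.qeq_sym[OF qeq_sym.IH])
  next
    case (qeq_trans f g h)
    then show ?case by (blast intro: qeq.qeq_trans)
  next
    case (qeq_Comp g g' f f')
    note t = qeqD[OF qeq_Comp.hyps(1)] qeqD[OF qeq_Comp.hyps(2)] qeq_Comp.hyps(3) u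
    have "eqv P ((g \<circ>\<^sub>t f) \<otimes>\<^sub>t Idm u) ((g \<otimes>\<^sub>t Idm u) \<circ>\<^sub>t (f \<otimes>\<^sub>t Idm u))"
      using t by (intro eqv_Comp_Tens_Id) auto
    also have "qeq P B \<dots> ((g' \<otimes>\<^sub>t Idm u) \<circ>\<^sub>t (f' \<otimes>\<^sub>t Idm u))"
      using t by (intro qeq.qeq_Comp qeq_Comp.IH) auto
    also have "eqv P \<dots> ((g' \<circ>\<^sub>t f') \<otimes>\<^sub>t Idm u)"
      using t by (intro eqv_sym[OF eqv_Comp_Tens_Id]) auto
    finally show ?case .
  next
    case (qeq_Add f f' g g')
    note t = qeqD[OF qeq_Add.hyps(1)] qeqD[OF qeq_Add.hyps(2)] qeq_Add.hyps(3-) u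
    have "eqv P ((f +\<^sub>t g) \<otimes>\<^sub>t Idm u) ((f \<otimes>\<^sub>t Idm u) +\<^sub>t (g \<otimes>\<^sub>t Idm u))"
      using t by (intro eqv_Add_Tens) auto
    also have "qeq P B \<dots> ((f' \<otimes>\<^sub>t Idm u) +\<^sub>t (g' \<otimes>\<^sub>t Idm u))"
      using t by (intro qeq.qeq_Add qeq_Add.IH) auto
    also have "eqv P \<dots> ((f' +\<^sub>t g') \<otimes>\<^sub>t Idm u)"
      using t by (intro eqv_sym[OF eqv_Add_Tens]) auto
    finally show ?case .
  next
    case (qeq_Scl f f' c)
    note t = qeqD[OF qeq_Scl.hyps(1)] u
    have "eqv P ((c *\<^sub>t f) \<otimes>\<^sub>t Idm u) (c *\<^sub>t (f \<otimes>\<^sub>t Idm u))"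
      using t by (intro eqv_Scl_Tens) auto
    also have "qeq P B \<dots> (c *\<^sub>t (f' \<otimes>\<^sub>t Idm u))"
      by (intro qeq.qeq_Scl qeq_Scl.IH)
    also have "eqv P \<dots> ((c *\<^sub>t f') \<otimes>\<^sub>t Idm u)"
      using t by (intro eqv_sym[OF eqv_Scl_Tens]) auto
    finally show ?case .
  qed
  note t = qeqD[OF q] g wt_letters[OF g] wt_letters[OF qeqD(1)[OF q]]
  have "eqv P (f \<otimes>\<^sub>t g) ((f \<otimes>\<^sub>t Idm (mtgt P g)) \<circ>\<^sub>t (Idm (msrc P f) \<otimes>\<^sub>t g))"
    using t by (intro eqv_Tens_split)
  also have "qeq P B \<dots> ((f' \<otimes>\<^sub>t Idm (mtgt P g)) \<circ>\<^sub>t (Idm (msrc P f) \<otimes>\<^sub>t g))"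
    using t by (intro qeq.qeq_Comp Id qeq_eqv eqv_refl) auto
  also have "eqv P \<dots> (f' \<otimes>\<^sub>t g)"
    using eqv_sym[OF eqv_Tens_split[of f' g]] t by simp
  finally show ?thesis .
qed


section \<open>Morphism spaces\<close>

lemma finprod_hom:
  assumes "comm_group G" "comm_group H" "h \<in> hom G H" "F \<in> S \<rightarrow> carrier G"
  shows "h (finprod G F S) = finprod H (\<lambda>k. h (F k)) S"
proof -
  interpret G: comm_group G by fact
  interpret H: comm_group H by fact
  interpret group_hom G H h
    by unfold_locales fact
  show ?thesis
    using assms(4)
  proof (induction S rule: infinite_finite_induct)
    case (insert k S)
    then have "F \<in> S \<rightarrow> carrier G" "F k \<in> carrier G" by auto
    moreover have "(\<lambda>k. h (F k)) \<in> S \<rightarrow> carrier H"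
      using insert.prems by (auto intro: hom_closed)
    ultimately show ?case
      using insert by simp
  qed auto
qed

context wf_presentation
begin

lemma mclass_cong: "f \<approx> g \<Longrightarrow> mclass P v w f = mclass P v w g"
  unfolding mclass_def meq_iff using eqvD eqv_trans eqv_sym by (metis (lifting))

lemma Hom_setI [intro]: "arr P v w f \<Longrightarrow> mclass P v w f \<in> Hom_set P v w"
  by (simp add: Hom_set_def)

lemma Hom_setE:
  assumes "X \<in> Hom_set P v w"
  obtains f where "arr P v w f" "X = mclass P v w f"
  using assms by (auto simp: Hom_set_def)

lemma Hom_set_letters: "X \<in> Hom_set P v w \<Longrightarrow> set v \<subseteq> letters P \<and> set w \<subseteq> letters P"
  by (metis Hom_setE arr_iff wt_letters)

lemma mclassD: "arr P v w f \<Longrightarrow> g \<in> mclass P v w f \<Longrightarrow> f \<approx> g"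
  by (simp add: mclass_def meq_iff)

lemma mclass_refl: "arr P v w f \<Longrightarrow> f \<in> mclass P v w f"
  by (simp add: mclass_def meq_refl)

text \<open>Operations on classes are defined as unions over representatives; a family that is
  constant on the class collapses the union to its common value.\<close>

lemma UN_mclass:
  assumes "arr P v w f" "\<And>g. f \<approx> g \<Longrightarrow> F g = c"
  shows "(\<Union>g\<in>mclass P v w f. F g) = c"
  using assms mclassD mclass_refl by (intro UN_constant_eq) blast+

lemma Hom_comp_mclass:
  assumes "arr P v w g" "arr P u v f"
  shows "Hom_comp P u w (mclass P v w g) (mclass P u v f) = mclass P u w (g \<circ>\<^sub>t f)"
proof -
  have "mclass P u w (g' \<circ>\<^sub>t f') = mclass P u w (g \<circ>\<^sub>t f)" if "g \<approx> g'" "f \<approx> f'" for g' f'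
    using assms eqvD(3,4)[OF that(1)] eqvD(3,4)[OF that(2)] that
    by (intro mclass_cong eqv_cong_Comp) (auto simp: arr_iff intro: eqv_sym)
  then show ?thesis
    unfolding Hom_comp_def by (intro UN_mclass[OF assms(1)] UN_mclass[OF assms(2)])
qed

lemma Hom_add_mclass:
  assumes "arr P v w f" "arr P v w g"
  shows "Hom_add P v w (mclass P v w f) (mclass P v w g) = mclass P v w (f +\<^sub>t g)"
proof -
  have "mclass P v w (f' +\<^sub>t g') = mclass P v w (f +\<^sub>t g)" if "f \<approx> f'" "g \<approx> g'" for f' g'
    using assms eqvD(3,4)[OF that(1)] eqvD(3,4)[OF that(2)] that
    by (intro mclass_cong eqv_cong_Add) (auto simp: arr_iff intro: eqv_sym)
  then show ?thesis
    unfolding Hom_add_def by (intro UN_mclass[OF assms(1)] UN_mclass[OF assms(2)])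
qed

lemma Hom_scale_mclass:
  assumes "arr P v w f"
  shows "Hom_scale P v w c (mclass P v w f) = mclass P v w (c *\<^sub>t f)"
  unfolding Hom_scale_def using assms
  by (intro UN_mclass[OF assms] mclass_cong eqv_cong_Scl) (auto intro: eqv_sym)

lemma Hom_zero_closed: "set v \<subseteq> letters P \<Longrightarrow> set w \<subseteq> letters P \<Longrightarrow> Hom_zero P v w \<in> Hom_set P v w"
  unfolding Hom_zero_def by (intro Hom_setI arr_Zer)

lemma Hom_id_closed: "set w \<subseteq> letters P \<Longrightarrow> Hom_id P w \<in> Hom_set P w w"
  unfolding Hom_id_def by (intro Hom_setI arr_Id)

lemma Hom_comp_closed:
  "X \<in> Hom_set P v w \<Longrightarrow> Y \<in> Hom_set P u v \<Longrightarrow> Hom_comp P u w X Y \<in> Hom_set P u w"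
  by (elim Hom_setE) (auto simp: Hom_comp_mclass intro: arr_Comp)

lemma Hom_add_closed:
  "X \<in> Hom_set P v w \<Longrightarrow> Y \<in> Hom_set P v w \<Longrightarrow> Hom_add P v w X Y \<in> Hom_set P v w"
  by (elim Hom_setE) (auto simp: Hom_add_mclass intro: arr_Add)

lemma Hom_scale_closed: "X \<in> Hom_set P v w \<Longrightarrow> Hom_scale P v w c X \<in> Hom_set P v w"
  by (elim Hom_setE) (auto simp: Hom_scale_mclass intro: arr_Scl)

lemma Hom_comp_assoc:
  "Z \<in> Hom_set P v w \<Longrightarrow> Y \<in> Hom_set P u v \<Longrightarrow> X \<in> Hom_set P t u \<Longrightarrow>
    Hom_comp P t w (Hom_comp P u w Z Y) X = Hom_comp P t w Z (Hom_comp P t v Y X)"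
  by (elim Hom_setE)
    (auto simp: Hom_comp_mclass arr_Comp arr_iff intro!: mclass_cong eqv_Comp_assoc)

lemma Hom_id_comp: "X \<in> Hom_set P v w \<Longrightarrow> Hom_comp P v w (Hom_id P w) X = X"
  unfolding Hom_id_def 
  by (frule Hom_set_letters, elim Hom_setE, simp add: Hom_comp_mclass arr_iff, rule mclass_cong)
    (use eqv_Id_Comp in force)

lemma Hom_comp_id: "X \<in> Hom_set P v w \<Longrightarrow> Hom_comp P v w X (Hom_id P v) = X"
  unfolding Hom_id_def 
  by (frule Hom_set_letters, elim Hom_setE, simp add: Hom_comp_mclass arr_iff, rule mclass_cong)
    (use eqv_Comp_Id in force)

lemma Hom_add_comp:
  "X \<in> Hom_set P v w \<Longrightarrow> X' \<in> Hom_set P v w \<Longrightarrow> Y \<in> Hom_set P u v \<Longrightarrow>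
    Hom_comp P u w (Hom_add P v w X X') Y = Hom_add P u w (Hom_comp P u w X Y) (Hom_comp P u w X' Y)"
  by (elim Hom_setE)
    (auto simp: Hom_comp_mclass Hom_add_mclass arr_iff intro!: mclass_cong eqv_Add_Comp)

lemma Hom_comp_add:
  "X \<in> Hom_set P v w \<Longrightarrow> Y \<in> Hom_set P u v \<Longrightarrow> Y' \<in> Hom_set P u v \<Longrightarrow>
    Hom_comp P u w X (Hom_add P u v Y Y') = Hom_add P u w (Hom_comp P u w X Y) (Hom_comp P u w X Y')"
  by (elim Hom_setE)
    (auto simp: Hom_comp_mclass Hom_add_mclass arr_iff intro!: mclass_cong eqv_Comp_Add)

lemma Hom_scale_comp:
  "X \<in> Hom_set P v w \<Longrightarrow> Y \<in> Hom_set P u v \<Longrightarrow>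
    Hom_comp P u w (Hom_scale P v w c X) Y = Hom_scale P u w c (Hom_comp P u w X Y)"
  by (elim Hom_setE)
    (auto simp: Hom_comp_mclass Hom_scale_mclass arr_iff intro!: mclass_cong eqv_Scl_Comp)

lemma Hom_zero_comp:
  "set w \<subseteq> letters P \<Longrightarrow> Y \<in> Hom_set P u v \<Longrightarrow> Hom_comp P u w (Hom_zero P v w) Y = Hom_zero P u w"
  unfolding Hom_zero_def 
  by (frule Hom_set_letters, elim Hom_setE, simp add: Hom_comp_mclass arr_iff, rule mclass_cong)
    (use eqv_Zer_Comp in force)

lemma Hom_comp_zero:
  "set u \<subseteq> letters P \<Longrightarrow> X \<in> Hom_set P v w \<Longrightarrow> Hom_comp P u w X (Hom_zero P u v) = Hom_zero P u w"
  unfolding Hom_zero_def 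
  by (frule Hom_set_letters, elim Hom_setE, simp add: Hom_comp_mclass arr_iff, rule mclass_cong)
    (use eqv_Comp_Zer in force)

lemma Hom_add_zero: "X \<in> Hom_set P v w \<Longrightarrow> Hom_add P v w X (Hom_zero P v w) = X"
  unfolding Hom_zero_def 
  by (frule Hom_set_letters, elim Hom_setE, simp add: Hom_add_mclass arr_iff, rule mclass_cong)
    (use eqv_Add_Zer in force)

lemma Hom_add_comm:
  "X \<in> Hom_set P v w \<Longrightarrow> Y \<in> Hom_set P v w \<Longrightarrow> Hom_add P v w X Y = Hom_add P v w Y X"
  by (elim Hom_setE) (auto simp: Hom_add_mclass arr_iff intro!: mclass_cong eqv_Add_comm)

lemma Hom_add_assoc:
  "X \<in> Hom_set P v w \<Longrightarrow> Y \<in> Hom_set P v w \<Longrightarrow> Z \<in> Hom_set P v w \<Longrightarrow>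
    Hom_add P v w (Hom_add P v w X Y) Z = Hom_add P v w X (Hom_add P v w Y Z)"
  by (elim Hom_setE) (auto simp: Hom_add_mclass arr_iff intro!: mclass_cong eqv_Add_assoc)

lemma Hom_scale_zero:
  "set v \<subseteq> letters P \<Longrightarrow> set w \<subseteq> letters P \<Longrightarrow> Hom_scale P v w c (Hom_zero P v w) = Hom_zero P v w"
  unfolding Hom_zero_def
  by (auto simp: Hom_scale_mclass arr_iff intro!: mclass_cong eqv_Zer_Scl)

text \<open>Terms have no negation, so additive inverses are multiples by \<open>- 1\<close>, and
  \<open>- 1 + 1 = 0\<close> acts as zero.\<close>

lemma Hom_add_inverse:
  assumes "X \<in> Hom_set P v w"
  shows "Hom_add P v w (Hom_scale P v w (- 1) X) X = Hom_zero P v w"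
proof -
  obtain f where f: "arr P v w f" "X = mclass P v w f"
    using assms by (rule Hom_setE)
  have "(- 1 *\<^sub>t f) +\<^sub>t f \<approx> (- 1 *\<^sub>t f) +\<^sub>t (1 *\<^sub>t f)"
    using f(1) by (intro eqv_cong_Add eqv_refl eqv_sym[OF eqv_Scl_one]) (auto simp: arr_iff)
  also have "\<dots> \<approx> (- 1 + 1) *\<^sub>t f"
    using f(1) by (intro eqv_sym[OF eqv_Scl_add]) (auto simp: arr_iff)
  also have "\<dots> \<approx> Zer v w"
    using f(1) eqv_Scl_zero[of f] by (simp add: arr_iff)
  finally show ?thesis
    using f by (simp add: Hom_scale_mclass Hom_add_mclass arr_Scl Hom_zero_def mclass_cong)
qed

section \<open>Finite sums in morphism spaces\<close>

definition hom_group :: "'o list \<Rightarrow> 'o list \<Rightarrow> ('k, 'o, 'g) mor set monoid" where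
  "hom_group v w =
    \<lparr>carrier = Hom_set P v w, monoid.mult = Hom_add P v w, one = Hom_zero P v w\<rparr>"

lemma hom_group_simps [simp]:
  "carrier (hom_group v w) = Hom_set P v w"
  "monoid.mult (hom_group v w) = Hom_add P v w"
  "one (hom_group v w) = Hom_zero P v w"
  by (simp_all add: hom_group_def)

lemma hom_comm_group:
  assumes "set v \<subseteq> letters P" "set w \<subseteq> letters P"
  shows "comm_group (hom_group v w)"
proof (rule comm_groupI)
  fix X assume "X \<in> carrier (hom_group v w)"
  then show "\<exists>Y\<in>carrier (hom_group v w). Y \<otimes>\<^bsub>hom_group v w\<^esub> X = \<one>\<^bsub>hom_group v w\<^esub>"
    using Hom_add_inverse[of X v w] Hom_scale_closed[of X v w "- 1"] by auto
next
  fix X assume "X \<in> carrier (hom_group v w)"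
  then show "\<one>\<^bsub>hom_group v w\<^esub> \<otimes>\<^bsub>hom_group v w\<^esub> X = X"
    using Hom_add_zero Hom_add_comm Hom_zero_closed assms by simp
next
  fix X Y assume "X \<in> carrier (hom_group v w)" "Y \<in> carrier (hom_group v w)"
  then show "X \<otimes>\<^bsub>hom_group v w\<^esub> Y = Y \<otimes>\<^bsub>hom_group v w\<^esub> X"
    using Hom_add_comm by simp
qed (simp_all add: assms Hom_add_closed Hom_zero_closed Hom_add_assoc)

lemma Hom_sum_finprod: "Hom_sum P v w F S = finprod (hom_group v w) F S"
  by (simp add: Hom_sum_def hom_group_def)

lemma Hom_sum_closed:
  assumes "set v \<subseteq> letters P" "set w \<subseteq> letters P" "\<And>k. k \<in> S \<Longrightarrow> F k \<in> Hom_set P v w"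
  shows "Hom_sum P v w F S \<in> Hom_set P v w"
proof -
  interpret comm_group "hom_group v w" using hom_comm_group assms by blast
  show ?thesis
    using assms finprod_closed[of F S] by (auto simp: Hom_sum_finprod)
qed

lemma Hom_sum_cong:
  assumes "set v \<subseteq> letters P" "set w \<subseteq> letters P" "\<And>k. k \<in> S \<Longrightarrow> G k \<in> Hom_set P v w"
    "\<And>k. k \<in> S \<Longrightarrow> F k = G k"
  shows "Hom_sum P v w F S = Hom_sum P v w G S"
proof -
  interpret comm_group "hom_group v w" using hom_comm_group assms by blast
  show ?thesis
    unfolding Hom_sum_finprod using assms by (intro finprod_cong') auto
qed

lemma Hom_sum_add:
  assumes "set v \<subseteq> letters P" "set w \<subseteq> letters P"
    "\<And>k. k \<in> S \<Longrightarrow> F k \<in> Hom_set P v w" "\<And>k. k \<in> S \<Longrightarrow> G k \<in> Hom_set P v w"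
  shows "Hom_sum P v w (\<lambda>k. Hom_add P v w (F k) (G k)) S =
    Hom_add P v w (Hom_sum P v w F S) (Hom_sum P v w G S)"
proof -
  interpret comm_group "hom_group v w" using hom_comm_group assms by blast
  show ?thesis
    using finprod_multf[of F S G] assms by (auto simp: Hom_sum_finprod)
qed

lemma Hom_sum_zero:
  assumes "set v \<subseteq> letters P" "set w \<subseteq> letters P" "\<And>k. k \<in> S \<Longrightarrow> F k = Hom_zero P v w"
  shows "Hom_sum P v w F S = Hom_zero P v w"
proof -
  interpret comm_group "hom_group v w" using hom_comm_group assms by blast
  show ?thesis
    using finprod_one_eqI[of S F] assms by (auto simp: Hom_sum_finprod)
qed

lemma Hom_sum_single:
  assumes "set v \<subseteq> letters P" "set w \<subseteq> letters P" "finite S" "k0 \<in> S"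
    and "F k0 \<in> Hom_set P v w" "\<And>k. k \<in> S \<Longrightarrow> k \<noteq> k0 \<Longrightarrow> F k = Hom_zero P v w"
  shows "Hom_sum P v w F S = F k0"
proof -
  interpret comm_group "hom_group v w" using hom_comm_group assms by blast
  have "Hom_sum P v w F S = Hom_sum P v w (\<lambda>k. if k0 = k then F k0 else Hom_zero P v w) S"
    using assms Hom_zero_closed by (intro Hom_sum_cong) auto
  then show ?thesis
    using finprod_singleton[of k0 S "\<lambda>_. F k0"] assms
    by (simp add: Hom_sum_finprod cong: if_cong)
qed

lemma Hom_sum_comp:
  assumes "set u \<subseteq> letters P" "set v \<subseteq> letters P" "set w \<subseteq> letters P"
    "\<And>k. k \<in> S \<Longrightarrow> F k \<in> Hom_set P v w" "Y \<in> Hom_set P u v"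
  shows "Hom_comp P u w (Hom_sum P v w F S) Y = Hom_sum P u w (\<lambda>k. Hom_comp P u w (F k) Y) S"
  unfolding Hom_sum_finprod
  using assms
  by (intro finprod_hom hom_comm_group) (auto simp: hom_def Hom_comp_closed Hom_add_comp)

lemma Hom_comp_sum:
  assumes "set u \<subseteq> letters P" "set v \<subseteq> letters P" "set w \<subseteq> letters P"
    "\<And>k. k \<in> S \<Longrightarrow> F k \<in> Hom_set P u v" "X \<in> Hom_set P v w"
  shows "Hom_comp P u w X (Hom_sum P u v F S) = Hom_sum P u w (\<lambda>k. Hom_comp P u w X (F k)) S"
  unfolding Hom_sum_finprod
  using assms
  by (intro finprod_hom hom_comm_group) (auto simp: hom_def Hom_comp_closed Hom_comp_add)

lemma Hom_sum_swap:
  assumes "set v \<subseteq> letters P" "set w \<subseteq> letters P" "finite S"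
    "\<And>k l. k \<in> S \<Longrightarrow> l \<in> T \<Longrightarrow> F k l \<in> Hom_set P v w"
  shows "Hom_sum P v w (\<lambda>k. Hom_sum P v w (F k) T) S = Hom_sum P v w (\<lambda>l. Hom_sum P v w (\<lambda>k. F k l) S) T"
proof -
  interpret comm_group "hom_group v w" using hom_comm_group assms by blast
  show ?thesis
    using assms(3,4)
  proof (induction S rule: finite_induct)
    case empty
    then show ?case using assms(1,2) Hom_sum_zero[of v w T] by (simp add: Hom_sum_finprod)
  next
    case (insert k S)
    have "Hom_sum P v w (\<lambda>l. Hom_sum P v w (\<lambda>k. F k l) (insert k S)) T =
        Hom_sum P v w (\<lambda>l. Hom_add P v w (F k l) (Hom_sum P v w (\<lambda>k. F k l) S)) T"
      using assms(1,2) insert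
      by (intro Hom_sum_cong) (auto simp: Hom_sum_finprod intro!: Hom_add_closed finprod_closed[simplified] Pi_I)
    also have "\<dots> = Hom_add P v w (Hom_sum P v w (F k) T) (Hom_sum P v w (\<lambda>k. Hom_sum P v w (F k) T) S)"
      using assms(1,2) insert by (simp add: Hom_sum_add Hom_sum_closed)
    also have "\<dots> = Hom_sum P v w (\<lambda>k. Hom_sum P v w (F k) T) (insert k S)"
      using finprod_insert[of S k "\<lambda>k. Hom_sum P v w (F k) T"] insert assms(1,2)
      by (simp add: Hom_sum_finprod[of v w _ "insert k S"] Hom_sum_finprod[of v w _ S] Hom_sum_closed)
    finally show ?case by simp
  qed
qed

lemma ring_End_algebra:
  assumes "set w \<subseteq> letters P"
  shows "ring (End_algebra P w)"
proof (rule ringI)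
  show "abelian_group (End_algebra P w)"
  proof (rule abelian_groupI)
    fix X assume "X \<in> carrier (End_algebra P w)"
    then show "\<exists>Y\<in>carrier (End_algebra P w). Y \<oplus>\<^bsub>End_algebra P w\<^esub> X = \<zero>\<^bsub>End_algebra P w\<^esub>"
      using Hom_add_inverse[of X w w] Hom_scale_closed[of X w w "- 1"] by (auto simp: End_algebra_def)
  next
    fix X assume "X \<in> carrier (End_algebra P w)"
    then show "\<zero>\<^bsub>End_algebra P w\<^esub> \<oplus>\<^bsub>End_algebra P w\<^esub> X = X"
      using Hom_add_zero Hom_add_comm Hom_zero_closed assms by (simp add: End_algebra_def)
  next
    fix X Y assume "X \<in> carrier (End_algebra P w)" "Y \<in> carrier (End_algebra P w)"
    then show "X \<oplus>\<^bsub>End_algebra P w\<^esub> Y = Y \<oplus>\<^bsub>End_algebra P w\<^esub> X"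
      using Hom_add_comm by (simp add: End_algebra_def)
  qed (simp_all add: assms End_algebra_def Hom_add_closed Hom_zero_closed Hom_add_assoc)
  show "Group.monoid (End_algebra P w)"
    by (rule monoidI)
      (use assms in \<open>auto simp: End_algebra_def Hom_comp_closed Hom_id_closed Hom_comp_assoc
        Hom_id_comp Hom_comp_id\<close>)
qed (auto simp: End_algebra_def Hom_add_comp Hom_comp_add)

end


section \<open>Matrix algebras\<close>

lemma (in wf_presentation) Hom_zero_add:
  assumes "X \<in> Hom_set P v w"
  shows "Hom_add P v w (Hom_zero P v w) X = X"
proof -
  have "Hom_zero P v w \<in> Hom_set P v w"
    using Hom_set_letters[OF assms] by (simp add: Hom_zero_closed)
  then show ?thesis
    using Hom_add_comm[OF assms] Hom_add_zero[OF assms] by simp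
qed

locale word_matrices = wf_presentation +
  fixes L :: "'b list set"
  assumes finite_words: "finite L"
    and word_letters: "w \<in> L \<Longrightarrow> set w \<subseteq> letters P"
begin

declare word_letters [simp]

lemma Hom_zero_word [simp]: "v \<in> L \<Longrightarrow> w \<in> L \<Longrightarrow> Hom_zero P v w \<in> Hom_set P v w"
  by (simp add: Hom_zero_closed)

lemma Hom_id_word [simp]: "w \<in> L \<Longrightarrow> Hom_id P w \<in> Hom_set P w w"
  by (simp add: Hom_id_closed)

lemma Hom_zero_comp_word:
  "w \<in> L \<Longrightarrow> Y \<in> Hom_set P u v \<Longrightarrow> Hom_comp P u w (Hom_zero P v w) Y = Hom_zero P u w"
  by (simp add: Hom_zero_comp)

lemma Hom_comp_zero_word:
  "u \<in> L \<Longrightarrow> X \<in> Hom_set P v w \<Longrightarrow> Hom_comp P u w X (Hom_zero P u v) = Hom_zero P u w"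
  by (simp add: Hom_comp_zero)

abbreviation Mat where "Mat \<equiv> Add_End_algebra P L"

lemma Mat_carrierD: "M \<in> carrier Mat \<Longrightarrow> j \<in> L \<Longrightarrow> i \<in> L \<Longrightarrow> M (j, i) \<in> Hom_set P i j"
  by (auto simp: Add_End_algebra_def)

lemma Mat_carrierI:
  "(\<And>j i. j \<in> L \<Longrightarrow> i \<in> L \<Longrightarrow> F j i \<in> Hom_set P i j) \<Longrightarrow> (\<lambda>(j, i)\<in>L \<times> L. F j i) \<in> carrier Mat"
  by (auto simp: Add_End_algebra_def)

lemma Mat_eqI:
  assumes "M \<in> carrier Mat" "N \<in> carrier Mat" "\<And>j i. j \<in> L \<Longrightarrow> i \<in> L \<Longrightarrow> M (j, i) = N (j, i)"
  shows "M = N"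
  using assms by (intro PiE_ext[of M "L \<times> L" _ N]) (auto simp: Add_End_algebra_def)

lemma Mat_apply:
  assumes "j \<in> L" "i \<in> L"
  shows Mat_mult_apply: "(M \<otimes>\<^bsub>Mat\<^esub> N) (j, i) = Hom_sum P i j (\<lambda>k. Hom_comp P i j (M (j, k)) (N (k, i))) L"
    and Mat_add_apply: "(M \<oplus>\<^bsub>Mat\<^esub> N) (j, i) = Hom_add P i j (M (j, i)) (N (j, i))"
    and Mat_smult_apply: "(c \<odot>\<^bsub>Mat\<^esub> M) (j, i) = Hom_scale P i j c (M (j, i))"
    and Mat_one_apply: "\<one>\<^bsub>Mat\<^esub> (j, i) = (if j = i then Hom_id P i else Hom_zero P i j)"
    and Mat_zero_apply: "\<zero>\<^bsub>Mat\<^esub> (j, i) = Hom_zero P i j"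
  using assms by (simp_all add: Add_End_algebra_def)

lemma Mat_comp_closed:
  "M \<in> carrier Mat \<Longrightarrow> N \<in> carrier Mat \<Longrightarrow> j \<in> L \<Longrightarrow> k \<in> L \<Longrightarrow> i \<in> L \<Longrightarrow>
    Hom_comp P i j (M (j, k)) (N (k, i)) \<in> Hom_set P i j"
  by (intro Hom_comp_closed[OF Mat_carrierD Mat_carrierD])

lemma Mat_mult_closed:
  assumes "M \<in> carrier Mat" "N \<in> carrier Mat"
  shows "M \<otimes>\<^bsub>Mat\<^esub> N \<in> carrier Mat"
proof -
  have "(\<lambda>(j, i)\<in>L \<times> L. Hom_sum P i j (\<lambda>k. Hom_comp P i j (M (j, k)) (N (k, i))) L) \<in> carrier Mat"
    using assms by (intro Mat_carrierI Hom_sum_closed Mat_comp_closed) auto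
  then show ?thesis
    by (simp add: Add_End_algebra_def)
qed

lemma Mat_add_closed: "M \<in> carrier Mat \<Longrightarrow> N \<in> carrier Mat \<Longrightarrow> M \<oplus>\<^bsub>Mat\<^esub> N \<in> carrier Mat"
  by (auto simp: Add_End_algebra_def intro!: Hom_add_closed)

lemma Mat_smult_closed: "M \<in> carrier Mat \<Longrightarrow> c \<odot>\<^bsub>Mat\<^esub> M \<in> carrier Mat"
  by (auto simp: Add_End_algebra_def intro!: Hom_scale_closed)

lemma Mat_zero_closed: "\<zero>\<^bsub>Mat\<^esub> \<in> carrier Mat"
  using Mat_carrierI[of "\<lambda>j i. Hom_zero P i j"] by (simp add: Add_End_algebra_def)

lemma Mat_one_closed: "\<one>\<^bsub>Mat\<^esub> \<in> carrier Mat"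
  using Mat_carrierI[of "\<lambda>j i. if j = i then Hom_id P i else Hom_zero P i j"] by (simp add: Add_End_algebra_def)

lemma Mat_sum_single:
  assumes "j \<in> L" "i \<in> L" "k0 \<in> L" "F k0 \<in> Hom_set P i j"
    "\<And>k. k \<in> L \<Longrightarrow> k \<noteq> k0 \<Longrightarrow> F k = Hom_zero P i j"
  shows "Hom_sum P i j F L = F k0"
  using assms by (intro Hom_sum_single) (auto simp: finite_words)

lemma ring_Mat: "ring Mat"
proof (rule ringI)
  show "abelian_group Mat"
  proof (rule abelian_groupI)
    fix M assume M: "M \<in> carrier Mat"
    then show "\<exists>N\<in>carrier Mat. N \<oplus>\<^bsub>Mat\<^esub> M = \<zero>\<^bsub>Mat\<^esub>"
      by (intro bexI[of _ "(- 1) \<odot>\<^bsub>Mat\<^esub> M"] Mat_eqI)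
        (auto simp: Mat_apply Mat_smult_closed Mat_add_closed Mat_zero_closed Mat_carrierD Hom_add_inverse)
    show "\<zero>\<^bsub>Mat\<^esub> \<oplus>\<^bsub>Mat\<^esub> M = M"
      using M by (intro Mat_eqI)
        (simp_all add: Mat_apply Mat_add_closed Mat_zero_closed Mat_carrierD Hom_zero_add)
  next
    fix M N assume "M \<in> carrier Mat" "N \<in> carrier Mat"
    then show "M \<oplus>\<^bsub>Mat\<^esub> N = N \<oplus>\<^bsub>Mat\<^esub> M"
      by (intro Mat_eqI) (simp_all add: Mat_apply Mat_add_closed Mat_carrierD Hom_add_comm)
  next
    fix M N K assume "M \<in> carrier Mat" "N \<in> carrier Mat" "K \<in> carrier Mat"
    then show "M \<oplus>\<^bsub>Mat\<^esub> N \<oplus>\<^bsub>Mat\<^esub> K = M \<oplus>\<^bsub>Mat\<^esub> (N \<oplus>\<^bsub>Mat\<^esub> K)"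
      by (intro Mat_eqI) (simp_all add: Mat_apply Mat_add_closed Mat_carrierD Hom_add_assoc)
  qed (auto simp: Mat_add_closed Mat_zero_closed)
  show "Group.monoid Mat"
  proof (rule monoidI)
    fix M assume M: "M \<in> carrier Mat"
    show "\<one>\<^bsub>Mat\<^esub> \<otimes>\<^bsub>Mat\<^esub> M = M"
    proof (rule Mat_eqI)
      fix j i assume ji: "j \<in> L" "i \<in> L"
      let ?F = "\<lambda>k. Hom_comp P i j (\<one>\<^bsub>Mat\<^esub> (j, k)) (M (k, i))"
      have "Hom_sum P i j ?F L = ?F j"
        using M ji
        by (intro Mat_sum_single Mat_comp_closed Mat_one_closed)
          (auto simp: Mat_apply Hom_zero_comp_word Mat_carrierD)
      then show "(\<one>\<^bsub>Mat\<^esub> \<otimes>\<^bsub>Mat\<^esub> M) (j, i) = M (j, i)"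
        using M ji by (simp add: Mat_apply Mat_carrierD Hom_id_comp)
    qed (use M in \<open>simp_all add: Mat_mult_closed Mat_one_closed\<close>)
    show "M \<otimes>\<^bsub>Mat\<^esub> \<one>\<^bsub>Mat\<^esub> = M"
    proof (rule Mat_eqI)
      fix j i assume ji: "j \<in> L" "i \<in> L"
      let ?F = "\<lambda>k. Hom_comp P i j (M (j, k)) (\<one>\<^bsub>Mat\<^esub> (k, i))"
      have "Hom_sum P i j ?F L = ?F i"
        using M ji
        by (intro Mat_sum_single Mat_comp_closed Mat_one_closed)
          (auto simp: Mat_apply Hom_comp_zero_word Mat_carrierD)
      then show "(M \<otimes>\<^bsub>Mat\<^esub> \<one>\<^bsub>Mat\<^esub>) (j, i) = M (j, i)"
        using M ji by (simp add: Mat_apply Mat_carrierD Hom_comp_id)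
    qed (use M in \<open>simp_all add: Mat_mult_closed Mat_one_closed\<close>)
  next
    fix M N K assume MNK: "M \<in> carrier Mat" "N \<in> carrier Mat" "K \<in> carrier Mat"
    note closed = Hom_comp_closed[OF Mat_carrierD[OF MNK(1)]
        Hom_comp_closed[OF Mat_carrierD[OF MNK(2)] Mat_carrierD[OF MNK(3)]]]
    show "M \<otimes>\<^bsub>Mat\<^esub> N \<otimes>\<^bsub>Mat\<^esub> K = M \<otimes>\<^bsub>Mat\<^esub> (N \<otimes>\<^bsub>Mat\<^esub> K)"
    proof (rule Mat_eqI)
      fix j i assume ji: "j \<in> L" "i \<in> L"
      have "(M \<otimes>\<^bsub>Mat\<^esub> N \<otimes>\<^bsub>Mat\<^esub> K) (j, i) =
          Hom_sum P i j (\<lambda>k. Hom_comp P i j ((M \<otimes>\<^bsub>Mat\<^esub> N) (j, k)) (K (k, i))) L"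
        using ji by (rule Mat_mult_apply)
      also have "\<dots> = Hom_sum P i j (\<lambda>k. Hom_sum P i j (\<lambda>l.
          Hom_comp P i j (M (j, l)) (Hom_comp P i l (N (l, k)) (K (k, i)))) L) L"
      proof (rule Hom_sum_cong)
        fix k assume k: "k \<in> L"
        have "Hom_comp P i j ((M \<otimes>\<^bsub>Mat\<^esub> N) (j, k)) (K (k, i)) =
            Hom_sum P i j (\<lambda>l. Hom_comp P i j (Hom_comp P k j (M (j, l)) (N (l, k))) (K (k, i))) L"
          unfolding Mat_mult_apply[OF ji(1) k] using MNK ji k
          by (intro Hom_sum_comp Hom_comp_closed[OF Mat_carrierD[of M] Mat_carrierD[of N]])
            (auto simp: Mat_carrierD)
        also have "\<dots> = Hom_sum P i j (\<lambda>l.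
            Hom_comp P i j (M (j, l)) (Hom_comp P i l (N (l, k)) (K (k, i)))) L"
          using MNK ji k
          by (intro Hom_sum_cong Hom_comp_assoc Mat_carrierD[of M] Mat_carrierD[of N] Mat_carrierD[of K] closed)
            (auto simp: Mat_carrierD)
        finally show "Hom_comp P i j ((M \<otimes>\<^bsub>Mat\<^esub> N) (j, k)) (K (k, i)) = \<dots>" .
      qed (use ji in \<open>simp_all add: Hom_sum_closed closed\<close>)
      \<comment> \<open>Both bracketings are double sums over the two intermediate words
        \<open>k\<close> and \<open>l\<close>; they differ in the order of summation.\<close>
      also have "\<dots> = Hom_sum P i j (\<lambda>l. Hom_sum P i j (\<lambda>k.
          Hom_comp P i j (M (j, l)) (Hom_comp P i l (N (l, k)) (K (k, i)))) L) L"
        using MNK ji finite_words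
        by (intro Hom_sum_swap closed)
          (auto simp: Mat_carrierD)
      also have "\<dots> = Hom_sum P i j (\<lambda>l. Hom_comp P i j (M (j, l)) ((N \<otimes>\<^bsub>Mat\<^esub> K) (l, i))) L"
      proof (rule Hom_sum_cong)
        fix l assume l: "l \<in> L"
        show "Hom_sum P i j (\<lambda>k. Hom_comp P i j (M (j, l)) (Hom_comp P i l (N (l, k)) (K (k, i)))) L =
            Hom_comp P i j (M (j, l)) ((N \<otimes>\<^bsub>Mat\<^esub> K) (l, i))"
          unfolding Mat_mult_apply[OF l ji(2)] using MNK ji l
          by (intro Hom_comp_sum[symmetric] Hom_comp_closed[OF Mat_carrierD[of N] Mat_carrierD[of K]])
            (auto simp: Mat_carrierD)
        show "Hom_comp P i j (M (j, l)) ((N \<otimes>\<^bsub>Mat\<^esub> K) (l, i)) \<in> Hom_set P i j"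
          using MNK ji l by (intro Hom_comp_closed[OF Mat_carrierD[of M] Mat_carrierD] Mat_mult_closed)
      qed (use ji in auto)
      also have "\<dots> = (M \<otimes>\<^bsub>Mat\<^esub> (N \<otimes>\<^bsub>Mat\<^esub> K)) (j, i)"
        using ji by (rule Mat_mult_apply[symmetric])
      finally show "(M \<otimes>\<^bsub>Mat\<^esub> N \<otimes>\<^bsub>Mat\<^esub> K) (j, i) = (M \<otimes>\<^bsub>Mat\<^esub> (N \<otimes>\<^bsub>Mat\<^esub> K)) (j, i)" .
    qed (use MNK in \<open>simp_all add: Mat_mult_closed\<close>)
  qed (auto simp: Mat_mult_closed Mat_one_closed)
next
  fix M N K assume MNK: "M \<in> carrier Mat" "N \<in> carrier Mat" "K \<in> carrier Mat"
  show "(M \<oplus>\<^bsub>Mat\<^esub> N) \<otimes>\<^bsub>Mat\<^esub> K = M \<otimes>\<^bsub>Mat\<^esub> K \<oplus>\<^bsub>Mat\<^esub> N \<otimes>\<^bsub>Mat\<^esub> K"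
  proof (rule Mat_eqI)
    fix j i assume ji: "j \<in> L" "i \<in> L"
    have "Hom_sum P i j (\<lambda>k. Hom_comp P i j ((M \<oplus>\<^bsub>Mat\<^esub> N) (j, k)) (K (k, i))) L =
        Hom_sum P i j (\<lambda>k. Hom_add P i j (Hom_comp P i j (M (j, k)) (K (k, i)))
          (Hom_comp P i j (N (j, k)) (K (k, i)))) L"
      using MNK ji
      by (intro Hom_sum_cong)
        (simp_all add: Mat_apply Mat_carrierD Hom_add_comp Hom_add_closed Mat_comp_closed)
    then show "((M \<oplus>\<^bsub>Mat\<^esub> N) \<otimes>\<^bsub>Mat\<^esub> K) (j, i) = (M \<otimes>\<^bsub>Mat\<^esub> K \<oplus>\<^bsub>Mat\<^esub> N \<otimes>\<^bsub>Mat\<^esub> K) (j, i)"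
      unfolding Mat_mult_apply[OF ji] Mat_add_apply[OF ji] using MNK ji
      by (subst Hom_sum_add[symmetric]) (simp_all add: Mat_comp_closed)
  qed (use MNK in \<open>simp_all add: Mat_mult_closed Mat_add_closed\<close>)
  show "K \<otimes>\<^bsub>Mat\<^esub> (M \<oplus>\<^bsub>Mat\<^esub> N) = K \<otimes>\<^bsub>Mat\<^esub> M \<oplus>\<^bsub>Mat\<^esub> K \<otimes>\<^bsub>Mat\<^esub> N"
  proof (rule Mat_eqI)
    fix j i assume ji: "j \<in> L" "i \<in> L"
    have "Hom_sum P i j (\<lambda>k. Hom_comp P i j (K (j, k)) ((M \<oplus>\<^bsub>Mat\<^esub> N) (k, i))) L =
        Hom_sum P i j (\<lambda>k. Hom_add P i j (Hom_comp P i j (K (j, k)) (M (k, i)))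
          (Hom_comp P i j (K (j, k)) (N (k, i)))) L"
      using MNK ji
      by (intro Hom_sum_cong)
        (simp_all add: Mat_apply Mat_carrierD Hom_comp_add Hom_add_closed Mat_comp_closed)
    then show "(K \<otimes>\<^bsub>Mat\<^esub> (M \<oplus>\<^bsub>Mat\<^esub> N)) (j, i) = (K \<otimes>\<^bsub>Mat\<^esub> M \<oplus>\<^bsub>Mat\<^esub> K \<otimes>\<^bsub>Mat\<^esub> N) (j, i)"
      unfolding Mat_mult_apply[OF ji] Mat_add_apply[OF ji] using MNK ji
      by (subst Hom_sum_add[symmetric]) (simp_all add: Mat_comp_closed)
  qed (use MNK in \<open>simp_all add: Mat_mult_closed Mat_add_closed\<close>)
qed

text \<open>The matrix \<open>c \<odot> \<one>\<close> is diagonal with entries the scaled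
  identities, so a single intermediate word survives in the product.\<close>

lemma Mat_smult:
  assumes "M \<in> carrier Mat"
  shows "c \<odot>\<^bsub>Mat\<^esub> M = (c \<odot>\<^bsub>Mat\<^esub> \<one>\<^bsub>Mat\<^esub>) \<otimes>\<^bsub>Mat\<^esub> M"
proof (rule Mat_eqI)
  fix j i assume ji: "j \<in> L" "i \<in> L"
  let ?F = "\<lambda>k. Hom_comp P i j ((c \<odot>\<^bsub>Mat\<^esub> \<one>\<^bsub>Mat\<^esub>) (j, k)) (M (k, i))"
  have "Hom_sum P i j ?F L = ?F j"
    using assms ji
    by (intro Mat_sum_single Mat_comp_closed Mat_smult_closed Mat_one_closed)
      (auto simp: Mat_apply Hom_scale_zero Hom_zero_comp_word Mat_carrierD)
  then show "(c \<odot>\<^bsub>Mat\<^esub> M) (j, i) = ((c \<odot>\<^bsub>Mat\<^esub> \<one>\<^bsub>Mat\<^esub>) \<otimes>\<^bsub>Mat\<^esub> M) (j, i)"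
    using assms ji
    by (simp add: Mat_apply Mat_carrierD Hom_id_comp Hom_scale_comp[OF Hom_id_closed])
qed (use assms in \<open>simp_all add: Mat_mult_closed Mat_smult_closed Mat_one_closed\<close>)

section \<open>Matrix units, diagonal idempotents and corners\<close>

definition mat_unit :: "'b list \<Rightarrow> 'b list \<Rightarrow> ('a, 'b, 'c) mor set \<Rightarrow>
    'b list \<times> 'b list \<Rightarrow> ('a, 'b, 'c) mor set" where
  "mat_unit w v X = (\<lambda>(j, i)\<in>L \<times> L. if j = w \<and> i = v then X else Hom_zero P i j)"

text \<open>The projection onto the summands in \<open>S\<close>. It interpolates between the
  generators of the ideal, where \<open>S\<close> is a singleton, and the unit matrix, where
  \<open>S\<close> is all of \<open>L\<close>.\<close>

definition mat_diag :: "'b list set \<Rightarrow> 'b list \<times> 'b list \<Rightarrow> ('a, 'b, 'c) mor set" where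
  "mat_diag S = (\<lambda>(j, i)\<in>L \<times> L. if j = i \<and> j \<in> S then Hom_id P i else Hom_zero P i j)"

lemma mat_unit_apply:
  "j \<in> L \<Longrightarrow> i \<in> L \<Longrightarrow> mat_unit w v X (j, i) = (if j = w \<and> i = v then X else Hom_zero P i j)"
  by (simp add: mat_unit_def)

lemma mat_diag_apply:
  "j \<in> L \<Longrightarrow> i \<in> L \<Longrightarrow> mat_diag S (j, i) = (if j = i \<and> j \<in> S then Hom_id P i else Hom_zero P i j)"
  by (simp add: mat_diag_def)

lemma mat_unit_closed: "X \<in> Hom_set P v w \<Longrightarrow> mat_unit w v X \<in> carrier Mat"
  unfolding mat_unit_def by (intro Mat_carrierI) simp

lemma mat_diag_closed: "mat_diag S \<in> carrier Mat"
  unfolding mat_diag_def by (intro Mat_carrierI) simp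

lemma mat_unit_zero: "mat_unit w v (Hom_zero P v w) = \<zero>\<^bsub>Mat\<^esub>"
  by (auto simp: mat_unit_def Add_End_algebra_def restrict_def fun_eq_iff)

lemma mat_unit_add:
  assumes "X \<in> Hom_set P v w" "Y \<in> Hom_set P v w"
  shows "mat_unit w v (Hom_add P v w X Y) = mat_unit w v X \<oplus>\<^bsub>Mat\<^esub> mat_unit w v Y"
  using assms
  by (intro Mat_eqI)
    (auto simp: mat_unit_closed Mat_add_closed Hom_add_closed Mat_apply mat_unit_apply Hom_add_zero
      Hom_zero_closed)

lemma mat_unit_scale:
  assumes "X \<in> Hom_set P v w"
  shows "mat_unit w v (Hom_scale P v w c X) = c \<odot>\<^bsub>Mat\<^esub> mat_unit w v X"
  using assms
  by (intro Mat_eqI)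
    (auto simp: mat_unit_closed Mat_smult_closed Hom_scale_closed Mat_apply mat_unit_apply Hom_scale_zero)

lemma mat_unit_mult:
  assumes "X \<in> Hom_set P u w" "Y \<in> Hom_set P v u" "u \<in> L" "v \<in> L" "w \<in> L"
  shows "mat_unit w u X \<otimes>\<^bsub>Mat\<^esub> mat_unit u v Y = mat_unit w v (Hom_comp P v w X Y)"
proof (rule Mat_eqI)
  fix j i assume ji: "j \<in> L" "i \<in> L"
  let ?F = "\<lambda>k. Hom_comp P i j (mat_unit w u X (j, k)) (mat_unit u v Y (k, i))"
  note closed = mat_unit_closed[OF assms(1)] mat_unit_closed[OF assms(2)]
  have "Hom_sum P i j ?F L = ?F u"
    using assms ji
    by (intro Mat_sum_single Mat_comp_closed closed)
      (auto simp: mat_unit_apply Hom_comp_zero_word[OF _ Hom_zero_word])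
  also have "\<dots> = mat_unit w v (Hom_comp P v w X Y) (j, i)"
    using assms ji
    by (auto simp: mat_unit_apply Hom_comp_zero_word Hom_zero_comp_word)
  finally show "(mat_unit w u X \<otimes>\<^bsub>Mat\<^esub> mat_unit u v Y) (j, i) = mat_unit w v (Hom_comp P v w X Y) (j, i)"
    by (simp only: Mat_mult_apply[OF ji])
qed (use assms in \<open>simp_all add: Mat_mult_closed mat_unit_closed Hom_comp_closed\<close>)

text \<open>The Peirce corner of \<open>M\<close> at the idempotent of the summand
  \<open>w\<close>.\<close>

lemma mat_diag_corner:
  assumes "w \<in> L" "M \<in> carrier Mat"
  shows "mat_diag {w} \<otimes>\<^bsub>Mat\<^esub> M \<otimes>\<^bsub>Mat\<^esub> mat_diag {w} = mat_unit w w (M (w, w))"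
proof (rule Mat_eqI)
  fix j i assume ji: "j \<in> L" "i \<in> L"
  have left: "(mat_diag {w} \<otimes>\<^bsub>Mat\<^esub> M) (j, k) = (if j = w then M (w, k) else Hom_zero P k j)"
    if k: "k \<in> L" for k
  proof -
    let ?F = "\<lambda>l. Hom_comp P k j (mat_diag {w} (j, l)) (M (l, k))"
    have "Hom_sum P k j ?F L = ?F j"
      using assms ji k mat_diag_closed
      by (intro Mat_sum_single Mat_comp_closed)
        (auto simp: mat_diag_apply Mat_carrierD Hom_zero_comp_word)
    then show ?thesis
      using assms ji k
      by (auto simp: Mat_apply mat_diag_apply Mat_carrierD Hom_id_comp
          Hom_zero_comp_word)
  qed
  let ?N = "mat_diag {w} \<otimes>\<^bsub>Mat\<^esub> M"
  have N: "?N \<in> carrier Mat"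
    using assms by (simp add: Mat_mult_closed mat_diag_closed)
  let ?F = "\<lambda>k. Hom_comp P i j (?N (j, k)) (mat_diag {w} (k, i))"
  have "Hom_sum P i j ?F L = ?F i"
    using ji N mat_diag_closed
    by (intro Mat_sum_single Mat_comp_closed)
      (auto simp: mat_diag_apply Mat_carrierD Hom_comp_zero_word)
  also have "\<dots> = mat_unit w w (M (w, w)) (j, i)"
    using ji assms
    by (auto simp: mat_diag_apply mat_unit_apply left Hom_comp_id Hom_comp_zero_word Mat_carrierD)
  finally show "(?N \<otimes>\<^bsub>Mat\<^esub> mat_diag {w}) (j, i) = mat_unit w w (M (w, w)) (j, i)"
    by (simp only: Mat_mult_apply[OF ji])
qed (use assms in \<open>simp_all add: Mat_mult_closed mat_unit_closed mat_diag_closed Mat_carrierD\<close>)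

lemma mat_diag_all: "mat_diag L = \<one>\<^bsub>Mat\<^esub>"
  by (intro Mat_eqI) (auto simp: mat_diag_closed Mat_one_closed mat_diag_apply Mat_apply)

lemma mat_diag_empty: "mat_diag {} = \<zero>\<^bsub>Mat\<^esub>"
  by (intro Mat_eqI) (auto simp: mat_diag_closed Mat_zero_closed mat_diag_apply Mat_apply)

lemma mat_diag_singleton: "mat_diag {w} = summand_id P L w"
  by (auto simp: mat_diag_def summand_id_def restrict_def fun_eq_iff)

lemma mat_diag_insert:
  assumes "w \<notin> S"
  shows "mat_diag (insert w S) = mat_diag {w} \<oplus>\<^bsub>Mat\<^esub> mat_diag S"
proof (intro Mat_eqI)
  fix j i assume ji: "j \<in> L" "i \<in> L"
  then have "Hom_zero P i j \<in> Hom_set P i j" "Hom_id P i \<in> Hom_set P i i"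
    using word_letters by (simp_all add: Hom_zero_closed Hom_id_closed)
  then show "mat_diag (insert w S) (j, i) = (mat_diag {w} \<oplus>\<^bsub>Mat\<^esub> mat_diag S) (j, i)"
    using ji assms by (auto simp: mat_diag_apply Mat_apply Hom_add_zero Hom_zero_add)
qed (simp_all add: mat_diag_closed Mat_add_closed)

lemma mat_diag_in_ideal:
  assumes "ideal I Mat" "finite S" "\<And>w. w \<in> S \<Longrightarrow> summand_id P L w \<in> I"
  shows "mat_diag S \<in> I"
proof -
  note I = ideal.axioms(1)[OF assms(1)]
  show ?thesis
    using assms(2,3)
  proof (induction S rule: finite_induct)
    case empty
    show ?case
      using additive_subgroup.zero_closed[OF I] by (simp only: mat_diag_empty)
  next
    case (insert w S)
    have "mat_diag {w} \<in> I" "mat_diag S \<in> I"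
      using insert by (simp_all add: mat_diag_singleton)
    then show ?case
      unfolding mat_diag_insert[OF insert.hyps(2)] by (rule additive_subgroup.a_closed[OF I])
  qed
qed

text \<open>The unit is the sum of the idempotents of all summands. Those other than
  \<open>w\<close> lie in \<open>I\<close>, so modulo \<open>I\<close> the idempotent of
  \<open>w\<close> is the unit, and \<open>M\<close> agrees with its Peirce corner.\<close>

lemma corner_mod_ideal:
  assumes I: "ideal I Mat" and w: "w \<in> L"
    and summands: "\<And>v. v \<in> L \<Longrightarrow> v \<noteq> w \<Longrightarrow> summand_id P L v \<in> I" and M: "M \<in> carrier Mat"
  shows "I +>\<^bsub>Mat\<^esub> M = I +>\<^bsub>Mat\<^esub> mat_unit w w (M (w, w))"
proof -
  let ?Q = "Mat Quot I" and ?h = "(+>\<^bsub>Mat\<^esub>) I"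
  note hom = ideal.rcos_ring_hom[OF I]
  interpret Q: ring ?Q
    by (rule ideal.quotient_is_ring[OF I])
  have h: "?h N \<in> carrier ?Q" if "N \<in> carrier Mat" for N
    using hom that by (rule ring_hom_closed)
  have "mat_diag (L - {w}) \<in> I"
    using I summands finite_words by (intro mat_diag_in_ideal) auto
  then have zero: "?h (mat_diag (L - {w})) = \<zero>\<^bsub>?Q\<^esub>"
    using ring.a_rcos_zero[OF ring_Mat I] by (simp add: FactRing_def)
  have "\<one>\<^bsub>?Q\<^esub> = ?h (mat_diag (insert w (L - {w})))"
    using ring_hom_one[OF hom] w by (simp add: insert_absorb mat_diag_all)
  also have "\<dots> = ?h (mat_diag {w}) \<oplus>\<^bsub>?Q\<^esub> ?h (mat_diag (L - {w}))"
    by (subst mat_diag_insert) (auto intro!: ring_hom_add[OF hom] mat_diag_closed)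
  also have "\<dots> = ?h (mat_diag {w})"
    unfolding zero by (rule Q.r_zero[OF h[OF mat_diag_closed]])
  finally have one: "?h (mat_diag {w}) = \<one>\<^bsub>?Q\<^esub>" by (rule sym)
  have "?h (mat_unit w w (M (w, w))) = ?h (mat_diag {w} \<otimes>\<^bsub>Mat\<^esub> M \<otimes>\<^bsub>Mat\<^esub> mat_diag {w})"
    by (simp only: mat_diag_corner[OF w M])
  also have "\<dots> = ?h (mat_diag {w}) \<otimes>\<^bsub>?Q\<^esub> ?h M \<otimes>\<^bsub>?Q\<^esub> ?h (mat_diag {w})"
    using M mat_diag_closed Mat_mult_closed by (simp only: ring_hom_mult[OF hom])
  also have "\<dots> = ?h M"
    unfolding one using h[OF M] by (simp only: Q.l_one Q.r_one)
  finally show ?thesis by (rule sym)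
qed

end


section \<open>The categories \<open>AH(A, z)\<close> and \<open>LAH(A, z)\<close>\<close>

lemma arr_mono:
  assumes "letters P \<subseteq> letters P'" "gens P \<subseteq> gens P'" "src P = src P'" "tgt P = tgt P'"
  shows "arr P v w f \<Longrightarrow> arr P' v w f"
proof (induction rule: arr.induct)
  case (arr_Gen g)
  then show ?case using assms arr.arr_Gen[of g P'] by auto
next
  case (arr_Comp v w g u f)
  show ?case by (rule arr.arr_Comp[OF arr_Comp.IH])
qed (use assms in \<open>auto intro: arr_Id arr_Tens arr_Zer arr_Add arr_Scl\<close>)

lemma mpar_mono:
  assumes "gpar P = gpar P'"
  shows "mpar P f p \<Longrightarrow> mpar P' f p"
proof (induction rule: mpar.induct)
  case (mpar_Gen g p)
  then show ?case using assms by (intro mpar.mpar_Gen) simp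
qed (blast intro: mpar.intros)+

lemma meq_mono:
  assumes sub: "letters P \<subseteq> letters P'" "gens P \<subseteq> gens P'" "src P = src P'" "tgt P = tgt P'"
    and gpar: "gpar P = gpar P'" and rels: "rels P \<subseteq> rels P'"
  shows "meq P v w f g \<Longrightarrow> meq P' v w f g"
proof (induction rule: meq.induct)
  case (meq_rel f g v w)
  then show ?case using rels arr_mono[OF sub] by (intro meq.meq_rel) auto
next
  case (meq_sym v w f g)
  show ?case by (rule meq.meq_sym[OF meq_sym.IH])
next
  case (meq_trans v w f g h)
  show ?case by (rule meq.meq_trans[OF meq_trans.IH])
next
  case (cong_Comp v w g g' u f f')
  show ?case by (rule meq.cong_Comp[OF cong_Comp.IH])
next
  case (interchange v w f' u f v' w' g u' g' p q)
  then show ?case using arr_mono[OF sub] mpar_mono[OF gpar] by (intro meq.interchange) auto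
next
  case (Id_Tens_Id v w)
  then show ?case using sub by (intro meq.Id_Tens_Id) auto
qed (rule meq_refl cong_Tens cong_Add cong_Scl Comp_assoc Id_Comp Comp_Id
    Add_assoc Add_comm Add_Zer Scl_zero Scl_one Scl_Scl Scl_add Scl_Add Add_Comp Comp_Add Scl_Comp
    Comp_Scl Add_Tens Tens_Add Scl_Tens Tens_Scl Tens_assoc unit_Tens Tens_unit;
    (assumption | erule arr_mono[OF sub]))+

text \<open>The fold is well typed for every list, hence for whichever enumeration the choice
  operator selects.\<close>

lemma wt_msum:
  assumes "\<And>i. wt P (F i) \<and> msrc P (F i) = v \<and> mtgt P (F i) = w"
    and "set v \<subseteq> letters P" "set w \<subseteq> letters P"
  shows "wt P (msum v w F S)" "msrc P (msum v w F S) = v" "mtgt P (msum v w F S) = w"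
proof -
  have "wt P (foldr (\<lambda>i f. F i +\<^sub>t f) is (Zer v w)) \<and>
      msrc P (foldr (\<lambda>i f. F i +\<^sub>t f) is (Zer v w)) = v \<and>
      mtgt P (foldr (\<lambda>i f. F i +\<^sub>t f) is (Zer v w)) = w" for "is"
    using assms by (induction "is") auto
  then show "wt P (msum v w F S)" "msrc P (msum v w F S) = v" "mtgt P (msum v w F S) = w"
    unfolding msum_def by auto
qed

lemma AH_simps [simp]:
  "letters (AH A z) = {II}" "gens (AH A z) = {Tpos, Tneg, Dot, Dotinv} \<union> range Token"
  "src (AH A z) = gen_src" "tgt (AH A z) = gen_tgt" "gpar (AH A z) = gen_par A"
  "rels (AH A z) = AH_rels A z"
  by (simp_all add: AH_def)

lemma LAH_simps [simp]:
  "letters (LAH A z) = insert II (Red ` EP1 A)"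
  "gens (LAH A z) = {Tpos, Tneg, Dot, Dotinv} \<union> range Token \<union> Rho ` EP1 A \<union> Lambda ` EP1 A"
  "src (LAH A z) = gen_src" "tgt (LAH A z) = gen_tgt" "gpar (LAH A z) = gen_par A"
  "rels (LAH A z) = LAH_rels A z"
  by (simp_all add: LAH_def)

lemma meq_LAH: "meq (AH A z) v w f g \<Longrightarrow> meq (LAH A z) v w f g"
  by (rule meq_mono) (auto intro: LAH_rels.intros(1))

lemma wt_dot_pow:
  "wt (AH A z) (dot_pow r) \<and> msrc (AH A z) (dot_pow r) = [II] \<and> mtgt (AH A z) (dot_pow r) = [II]"
proof -
  have "wt (AH A z) (foldr (\<circ>\<^sub>t) (replicate n (Gen g)) oneI) \<and>
      msrc (AH A z) (foldr (\<circ>\<^sub>t) (replicate n (Gen g)) oneI) = [II] \<and>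
      mtgt (AH A z) (foldr (\<circ>\<^sub>t) (replicate n (Gen g)) oneI) = [II]"
    if "g \<in> {Dot, Dotinv}" for n g
    using that by (induction n) auto
  then show ?thesis by (simp add: dot_pow_def)
qed

lemma wt_bracket:
  "wt (AH A z) (bracket f)" "msrc (AH A z) (bracket f) = [II]" "mtgt (AH A z) (bracket f) = [II]"
  unfolding bracket_def by (rule wt_msum; simp add: wt_dot_pow)+

lemma AH_rels_wt:
  "(f, g) \<in> AH_rels A z \<Longrightarrow> wt (AH A z) f \<and> wt (AH A z) g \<and>
    msrc (AH A z) f = msrc (AH A z) g \<and> mtgt (AH A z) f = mtgt (AH A z) g"
  by (cases rule: AH_rels.cases) (auto simp: wt_msum)

lemma mset_gen: "mset (gen_src g) = mset (gen_tgt g)"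
  by (cases g) auto

lemma gen_src_nonempty: "gen_src g \<noteq> []"
  by (cases g) auto

context symmetric_frobenius_superalgebra
begin

text \<open>The linearity relation with coefficients 1 splits a token along the even and odd parts
  of its label. The presentation is left general so that the argument serves both
  categories.\<close>

lemma token_decomposition:
  assumes "\<And>f g. (f, g) \<in> AH_rels A z \<Longrightarrow> wt P f \<Longrightarrow> wt P g \<Longrightarrow> msrc P f = msrc P g \<Longrightarrow>
      mtgt P f = mtgt P g \<Longrightarrow> eqv P f g"
    and "\<And>f g. eqv P f g \<Longrightarrow> eqv P g f"
    and "range Token \<subseteq> gens P" "src P = gen_src" "tgt P = gen_tgt" "gpar P = gen_par A"
  shows "\<exists>f0 f1. mpar P f0 0 \<and> mpar P f1 1 \<and> eqv P (tok a) (f0 +\<^sub>t f1)"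
proof -
  obtain u v where uv: "u \<in> grade A 0" "v \<in> grade A 1" "a = u + v"
    using grade_decomp[of a] by auto
  have "eqv P ((1 *\<^sub>t tok u) +\<^sub>t (1 *\<^sub>t tok v)) (tok (scale A 1 u + scale A 1 v))"
    using assms(3-) by (intro assms(1) AH_rels.intros) auto
  then have "eqv P (tok a) ((1 *\<^sub>t tok u) +\<^sub>t (1 *\<^sub>t tok v))"
    using assms(2) uv(3) by (simp add: scale_one)
  moreover have "mpar P (1 *\<^sub>t tok u) 0" "mpar P (1 *\<^sub>t tok v) 1"
    using uv assms(6) by (auto intro!: mpar_Scl mpar_Gen)
  ultimately show ?thesis by blast
qed

lemma super_presentation_AH: "super_presentation (AH A z)"
proof -
  interpret H: wf_presentation "AH A z"
    by unfold_locales auto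
  show ?thesis
  proof
    fix g :: "('a, int \<Rightarrow>\<^sub>0 'a) gen" assume g: "g \<in> gens (AH A z)"
    show "\<exists>f0 f1. mpar (AH A z) f0 0 \<and> mpar (AH A z) f1 1 \<and> eqv (AH A z) (Gen g) (f0 +\<^sub>t f1)"
    proof (cases "\<exists>a. g = Token a")
      case True
      then obtain a where a: "g = Token a" ..
      show ?thesis
        unfolding a
      proof (rule token_decomposition)
        show "eqv (AH A z) f g"
          if "(f, g) \<in> AH_rels A z" "wt (AH A z) f" "wt (AH A z) g"
            "msrc (AH A z) f = msrc (AH A z) g" "mtgt (AH A z) f = mtgt (AH A z) g" for f g
          using that by (intro H.eqv_rel) (simp_all)
      qed (auto intro: H.eqv_sym)
    next
      case False
      \<comment> \<open>A generator other than a token is even; its odd part is the zero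
        morphism.\<close>
      then have "mpar (AH A z) (Gen g) 0"
        by (intro mpar_Gen) (cases g, auto)
      moreover have "mpar (AH A z) (Zer (gen_src g) (gen_tgt g)) 1"
        by (rule mpar_Zer)
      moreover have "eqv (AH A z) (Gen g) (Gen g +\<^sub>t Zer (gen_src g) (gen_tgt g))"
        using g H.src_letters[OF g] H.tgt_letters[OF g] by (intro H.eqv_sym[OF H.eqv_Add_Zer]) auto
      ultimately show ?thesis by blast
    qed
  qed
qed

lemma super_presentation_LAH: "super_presentation (LAH A z)"
proof -
  interpret L: wf_presentation "LAH A z"
    by unfold_locales auto
  show ?thesis
  proof
    fix g :: "('a, int \<Rightarrow>\<^sub>0 'a) gen" assume g: "g \<in> gens (LAH A z)"
    show "\<exists>f0 f1. mpar (LAH A z) f0 0 \<and> mpar (LAH A z) f1 1 \<and> eqv (LAH A z) (Gen g) (f0 +\<^sub>t f1)"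
    proof (cases "\<exists>a. g = Token a")
      case True
      then obtain a where a: "g = Token a" ..
      show ?thesis
        unfolding a
      proof (rule token_decomposition)
        show "eqv (LAH A z) f g"
          if "(f, g) \<in> AH_rels A z" "wt (LAH A z) f" "wt (LAH A z) g"
            "msrc (LAH A z) f = msrc (LAH A z) g" "mtgt (LAH A z) f = mtgt (LAH A z) g" for f g
          using that by (intro L.eqv_rel) (simp_all add: LAH_rels.intros(1))
      qed (auto intro: L.eqv_sym)
    next
      case False
      then have "mpar (LAH A z) (Gen g) 0"
        by (intro mpar_Gen) (cases g, auto)
      moreover have "mpar (LAH A z) (Zer (gen_src g) (gen_tgt g)) 1"
        by (rule mpar_Zer)
      moreover have "eqv (LAH A z) (Gen g) (Gen g +\<^sub>t Zer (gen_src g) (gen_tgt g))"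
        using g L.src_letters[OF g] L.tgt_letters[OF g] by (intro L.eqv_sym[OF L.eqv_Add_Zer]) auto
      ultimately show ?thesis by blast
    qed
  qed
qed

end

section \<open>The two categories side by side\<close>

locale cyclotomic = symmetric_frobenius_superalgebra A
  for A :: "('k::{comm_ring,comm_monoid_mult}, 'a::{ring,monoid_mult}) frobenius_data" +
  fixes z :: 'k and Q :: "int \<Rightarrow>\<^sub>0 'a"
  assumes Q: "Q \<in> EP1 A"
begin

abbreviation H where "H \<equiv> AH A z"
abbreviation LP where "LP \<equiv> LAH A z"

sublocale H: super_presentation H
  by (rule super_presentation_AH)

sublocale L: super_presentation LP
  by (rule super_presentation_LAH)

lemma eqv_H_imp_LAH: "eqv H f g \<Longrightarrow> eqv LP f g"
  using meq_LAH by (metis H.meq_iff L.meq_iff)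

lemma wt_H_imp_LAH: "wt H f \<Longrightarrow> wt LP f \<and> msrc LP f = msrc H f \<and> mtgt LP f = mtgt H f"
  by (induction f) auto

end


section \<open>Evaluation of morphisms\<close>

lemma (in wf_presentation) eqv_scalar_Tens:
  assumes "a \<approx> c *\<^sub>t Idm []" "wt P b"
  shows "a \<otimes>\<^sub>t b \<approx> c *\<^sub>t b"
proof -
  have "a \<otimes>\<^sub>t b \<approx> (c *\<^sub>t Idm []) \<otimes>\<^sub>t b"
    using assms by (intro eqv_cong_Tens eqv_refl)
  also have "\<dots> \<approx> c *\<^sub>t (Idm [] \<otimes>\<^sub>t b)"
    using assms by (intro eqv_Scl_Tens) auto
  also have "\<dots> \<approx> c *\<^sub>t b"
    using assms by (intro eqv_cong_Scl eqv_unit_Tens)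
  finally show ?thesis .
qed

context cyclotomic
begin

section \<open>Shapes of words\<close>

abbreviation pure :: "(int \<Rightarrow>\<^sub>0 'a) letter list \<Rightarrow> bool" where
  "pure w \<equiv> set w \<subseteq> {II}"

primrec qtype :: "(int \<Rightarrow>\<^sub>0 'a) letter list \<Rightarrow> bool" where
  "qtype [] \<longleftrightarrow> False"
| "qtype (l # w) \<longleftrightarrow> l = Red Q \<and> pure w"

definition good :: "(int \<Rightarrow>\<^sub>0 'a) letter list \<Rightarrow> bool" where
  "good w \<longleftrightarrow> pure w \<or> qtype w"

text \<open>The pairs of ends between which an evaluation can be nonzero: \<open>Q\<close> is absent
  from both words or leads both, and the number of strands is preserved. Every unmatched pair leads
  to zero, see \<open>ev_null\<close>.\<close>

definition matched :: "(int \<Rightarrow>\<^sub>0 'a) letter list \<Rightarrow> (int \<Rightarrow>\<^sub>0 'a) letter list \<Rightarrow> bool" where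
  "matched v w \<longleftrightarrow> (pure v \<and> pure w \<or> qtype v \<and> qtype w) \<and> length v = length w"

abbreviation strip :: "(int \<Rightarrow>\<^sub>0 'a) letter list \<Rightarrow> (int \<Rightarrow>\<^sub>0 'a) letter list" where
  "strip w \<equiv> filter (\<lambda>l. l = II) w"

text \<open>A leading \<open>Q\<close> comes from the left part, or from the right part behind an
  empty left one. The second alternative is the reason why endomorphisms of the unit object have to
  be controlled.\<close>

lemma qtype_append: "qtype (v @ w) \<longleftrightarrow> qtype v \<and> pure w \<or> v = [] \<and> qtype w"
  by (cases v) auto

lemma not_pure_qtype: "pure w \<Longrightarrow> \<not> qtype w"
  by (cases w) auto

lemma good_append:
  "good (v @ w) \<longleftrightarrow> pure v \<and> pure w \<or> qtype v \<and> pure w \<or> v = [] \<and> qtype w"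
  unfolding good_def qtype_append by auto

lemma strip_pure: "pure w \<Longrightarrow> strip w = w"
  by (auto simp: filter_id_conv)

lemma strip_qtype: "qtype w \<Longrightarrow> strip w = tl w"
  by (cases w) (auto simp: filter_id_conv)

lemma qtype_eq: "qtype w \<Longrightarrow> w = Red Q # strip w"
  by (cases w) (auto simp: strip_pure)

lemma matched_good: "matched v w \<Longrightarrow> good v \<and> good w"
  by (auto simp: matched_def good_def)

lemma matched_trans: "matched u v \<Longrightarrow> matched v w \<Longrightarrow> matched u w"
  using not_pure_qtype by (auto simp: matched_def)

lemma matched_append:
  assumes "matched v w" "matched v' w'" "good (v @ v')"
  shows "matched (v @ v') (w @ w')"
  using assms not_pure_qtype unfolding good_append matched_def qtype_append by auto

text \<open>A word with the letters of a pure word is pure, so \<open>v\<close> must contain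
  \<open>Q\<close>, in front. If \<open>w\<close> began with \<open>Q\<close> too, its remaining
  letters would be pure and the words would match; hence \<open>w\<close> begins with
  \<open>I\<close>.\<close>

lemma matched_mset_cases:
  assumes "mset v = mset w" "good v" "\<not> matched v w"
  shows "qtype v \<and> w \<noteq> [] \<and> hd w = II"
proof -
  have len: "length v = length w" and set: "set v = set w"
    using assms(1) by (auto dest: mset_eq_length mset_eq_setD)
  have v: "qtype v"
    using assms(2,3) len set by (auto simp: good_def matched_def)
  then obtain t where t: "v = Red Q # t" "pure t"
    by (cases v) auto
  then obtain l u where w: "w = l # u"
    using len by (cases w) auto
  have "l = II"
  proof (rule ccontr)
    assume "l \<noteq> II"
    then have "l = Red Q"
      using set t w by auto
    then have "mset u = mset t"
      using assms(1) t w by simp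
    then have "set u = set t"
      by (rule mset_eq_setD)
    then have "qtype w"
      using \<open>l = Red Q\<close> t w by simp
    then show False
      using assms(3) v len by (simp add: matched_def)
  qed
  then show ?thesis using v w by simp
qed

text \<open>
  The evaluation forgets a letter \<open>Q\<close> in front of a word and kills every morphism that passes
  through a word in which \<open>Q\<close> is not the first letter.
\<close>

primrec ev :: "('k, 'a) amor \<Rightarrow> ('k, 'a) amor" where
  "ev (Gen g) = (if g \<in> gens H then Gen g else Zer [II] [II])"
| "ev (Idm w) = (if good w then Idm (strip w) else Zer (strip w) (strip w))"
| "ev (g \<circ>\<^sub>t f) = ev g \<circ>\<^sub>t ev f"
| "ev (f \<otimes>\<^sub>t g) =
    (if good (msrc LP f @ msrc LP g) \<and> good (mtgt LP f @ mtgt LP g) then ev f \<otimes>\<^sub>t ev g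
     else Zer (strip (msrc LP f @ msrc LP g)) (strip (mtgt LP f @ mtgt LP g)))"
| "ev (Zer v w) = Zer (strip v) (strip w)"
| "ev (f +\<^sub>t g) = ev f +\<^sub>t ev g"
| "ev (c *\<^sub>t f) = c *\<^sub>t ev f"

text \<open>Source and target of \<open>Rho\<close> and \<open>Lambda\<close> both lose their red
  letter, whatever its label, and become \<open>[II]\<close>; this is the type of the zero that
  replaces these generators.\<close>

lemma ev_wt:
  "wt LP f \<Longrightarrow> wt H (ev f) \<and> msrc H (ev f) = strip (msrc LP f) \<and> mtgt H (ev f) = strip (mtgt LP f)"
proof (induction f)
  case (Gen g)
  then show ?case by (cases g) auto
qed auto

lemma ev_mpar: "mpar LP f p \<Longrightarrow> mpar H (ev f) p"
proof (induction rule: mpar.induct)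
  case (mpar_Gen g p)
  then show ?case by (auto intro: mpar_Zer mpar.mpar_Gen)
next
  case (mpar_Id w)
  then show ?case by (simp del: AH_simps add: mpar_Zer mpar.mpar_Id)
next
  case (mpar_Comp g p f q)
  then show ?case by (simp only: ev.simps) (rule mpar.mpar_Comp)
next
  case (mpar_Tens f p g q)
  then have "mpar H (ev f \<otimes>\<^sub>t ev g) (p + q)"
    by (intro mpar.mpar_Tens)
  then show ?case by (simp only: ev.simps split: if_split) (blast intro: mpar_Zer)
qed (auto intro: mpar.intros)

lemma ev_AH: "wt H f \<Longrightarrow> ev f = f"
proof (induction f)
  case (Tens f g)
  have "good (msrc LP f @ msrc LP g)" "good (mtgt LP f @ mtgt LP g)"
    using Tens.prems H.wt_letters[of f] H.wt_letters[of g] wt_H_imp_LAH[of f] wt_H_imp_LAH[of g]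
    by (auto simp: good_def)
  then show ?case using Tens by simp
qed (auto simp: good_def strip_pure)

text \<open>The shape test in the tensor clause of \<open>ev\<close> matters here:
  \<open>oneI\<close> and \<open>oneQ Q\<close> both evaluate to identities, yet their tensor
  product lives on a word where \<open>Q\<close> is not first and must vanish. If the test succeeds
  but the ends do not match, then by \<open>matched_append\<close> one factor has unmatched ends and
  vanishes by induction.\<close>

lemma ev_null: "wt LP f \<Longrightarrow> \<not> matched (msrc LP f) (mtgt LP f) \<Longrightarrow> H.null (ev f)"
proof (induction f)
  case (Gen g)
  then show ?case by (cases g) (auto simp: matched_def)
next
  case (Idm w)
  then show ?case by (auto simp: matched_def good_def)
next
  case (Comp g f)
  note t = Comp.prems(1) ev_wt[of f] ev_wt[of g]
  show ?case
  proof (cases "matched (msrc LP f) (mtgt LP f)")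
    case True
    then have "H.null (ev g)"
      using Comp matched_trans by auto
    then show ?thesis using t by (auto intro: H.null_Comp_left)
  next
    case False
    then have "H.null (ev f)"
      using Comp by auto
    then show ?thesis using t by (auto intro: H.null_Comp_right)
  qed
next
  case (Tens f g)
  note t = Tens.prems(1) ev_wt[of f] ev_wt[of g]
  show ?case
  proof (cases "good (msrc LP f @ msrc LP g) \<and> good (mtgt LP f @ mtgt LP g)")
    case True
    then have "\<not> matched (msrc LP f) (mtgt LP f) \<or> \<not> matched (msrc LP g) (mtgt LP g)"
      using Tens.prems matched_append by auto
    then have "H.null (ev f) \<or> H.null (ev g)"
      using Tens by auto
    then show ?thesis
      using True t by (auto intro: H.null_Tens_left H.null_Tens_right)
  next
    case False
    then show ?thesis by auto
  qed
next
  case (Add f g)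
  then show ?case using ev_wt[of f] ev_wt[of g] by (auto intro!: H.null_Add)
next
  case (Scl c f)
  then show ?case by (auto intro!: H.null_Scl)
qed auto

text \<open>The elements \<open>Q_1\<close> for all numbers of strands at once, so that the family
  is stable under adding strands on the right.\<close>

definition first_Q :: "('k, 'a) amor set" where
  "first_Q = {bracket Q \<otimes>\<^sub>t Idm u | u. pure u}"

text \<open>Composites through a word with first letter \<open>I\<close>: a syntactic substitute for
  the ideal generated by the identities of such words, free of any restriction on the ends.\<close>

definition via_I :: "('k, 'a) amor set" where
  "via_I = {g \<circ>\<^sub>t f | g f. mtgt LP f \<noteq> [] \<and> hd (mtgt LP f) = II}"

lemma first_Q_Tens_right:
  assumes "qeq H first_Q f f'" "wt H g"
  shows "qeq H first_Q (f \<otimes>\<^sub>t g) (f' \<otimes>\<^sub>t g)"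
proof (rule H.qeq_Tens_right[OF _ assms])
  fix f :: "('k, 'a) amor" and u
  assume f: "f \<in> first_Q" "wt H f" and u: "set u \<subseteq> letters H"
  then obtain w where w: "f = bracket Q \<otimes>\<^sub>t Idm w" "pure w"
    by (auto simp: first_Q_def)
  have "eqv H (f \<otimes>\<^sub>t Idm u) (bracket Q \<otimes>\<^sub>t Idm w \<otimes>\<^sub>t Idm u)"
    unfolding w(1) using w u by (intro H.eqv_Tens_assoc) (auto simp: wt_bracket)
  also have "eqv H \<dots> (bracket Q \<otimes>\<^sub>t Idm (w @ u))"
    using w u by (intro H.eqv_cong_Tens H.eqv_refl H.eqv_Id_Tens_Id) (auto simp: wt_bracket)
  also have "qeq H first_Q \<dots> (Zer (msrc H (bracket Q \<otimes>\<^sub>t Idm (w @ u))) (mtgt H (bracket Q \<otimes>\<^sub>t Idm (w @ u))))"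
    using w u by (intro qeq_null) (auto simp: wt_bracket first_Q_def)
  finally show "qeq H first_Q (f \<otimes>\<^sub>t Idm u) (Zer (msrc H f @ u) (mtgt H f @ u))"
    by (simp add: w wt_bracket)
qed

text \<open>Strands on the right do not change the first letter of the middle word; this is why
  \<open>via_I\<close> asks that word to be nonempty.\<close>

lemma via_I_Tens_right:
  assumes "qeq LP via_I f f'" "wt LP g"
  shows "qeq LP via_I (f \<otimes>\<^sub>t g) (f' \<otimes>\<^sub>t g)"
proof (rule L.qeq_Tens_right[OF _ assms])
  fix f :: "('k, 'a) amor" and u
  assume f: "f \<in> via_I" "wt LP f" and u: "set u \<subseteq> letters LP"
  then obtain g h where gh: "f = g \<circ>\<^sub>t h" "mtgt LP h \<noteq> []" "hd (mtgt LP h) = II"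
    by (auto simp: via_I_def)
  have "eqv LP (f \<otimes>\<^sub>t Idm u) ((g \<otimes>\<^sub>t Idm u) \<circ>\<^sub>t (h \<otimes>\<^sub>t Idm u))"
    unfolding gh(1) using f u gh by (intro L.eqv_Comp_Tens_Id) auto
  also have "qeq LP via_I \<dots> (Zer (msrc LP ((g \<otimes>\<^sub>t Idm u) \<circ>\<^sub>t (h \<otimes>\<^sub>t Idm u)))
      (mtgt LP ((g \<otimes>\<^sub>t Idm u) \<circ>\<^sub>t (h \<otimes>\<^sub>t Idm u))))"
  proof (rule qeq_null)
    have "mtgt LP (h \<otimes>\<^sub>t Idm u) \<noteq> [] \<and> hd (mtgt LP (h \<otimes>\<^sub>t Idm u)) = II"
      using gh by simp
    then show "(g \<otimes>\<^sub>t Idm u) \<circ>\<^sub>t (h \<otimes>\<^sub>t Idm u) \<in> via_I"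
      unfolding via_I_def by blast
  qed (use f u gh in auto)
  finally show "qeq LP via_I (f \<otimes>\<^sub>t Idm u) (Zer (msrc LP f @ u) (mtgt LP f @ u))"
    by (simp add: gh)
qed

text \<open>The two degrees of precision. Between pure words equality must be exact: such a morphism
  may stand to the right of \<open>Q\<close> in a tensor product, and a congruence modulo
  \<open>Q_1\<close> in it would become one modulo \<open>Q\<close> on a later strand.\<close>

definition evrel :: "('k, 'a) amor \<Rightarrow> ('k, 'a) amor \<Rightarrow> bool" where
  "evrel f g \<longleftrightarrow>
    (if qtype (msrc LP f) \<and> qtype (mtgt LP f) then qeq H first_Q (ev f) (ev g) else eqv H (ev f) (ev g))"

lemma evrelI: "eqv H (ev f) (ev g) \<Longrightarrow> evrel f g"
  by (simp add: evrel_def qeq_eqv)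

lemma evrel_qeq: "evrel f g \<Longrightarrow> qeq H first_Q (ev f) (ev g)"
  by (auto simp: evrel_def qeq_eqv split: if_splits)

lemma evrel_pure: "evrel f g \<Longrightarrow> pure (msrc LP f) \<Longrightarrow> eqv H (ev f) (ev g)"
  using not_pure_qtype by (auto simp: evrel_def)

text \<open>Both evaluations vanish. This settles every clause of the presentation whose ends do not
  match.\<close>

lemma evrel_unmatched:
  assumes "arr LP v w f" "arr LP v w g" "\<not> matched v w"
  shows "evrel f g"
  using assms ev_null[of f] ev_null[of g] ev_wt[of f] ev_wt[of g]
  by (intro evrelI H.null_null) (auto simp: arr_iff)

text \<open>Among the relations with a red letter, those carrying \<open>Q\<close> across strands
  start or end with \<open>Q\<close> on the far side, and those for
  \<open>\<rho>\<^sub>Q \<lambda>\<^sub>Q\<close> and for the correction term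
  \<open>z[\<Delta>\<^sub>1(Q\<^sub>1)]\<^sub>Q\<close> live on words that begin with
  \<open>I\<close> and contain \<open>Q\<close>. None of these has matched ends, so the divided
  difference is never computed. What remains are the relations of \<open>AH\<close> and the one for
  \<open>\<lambda>\<^sub>Q \<rho>\<^sub>Q\<close>.\<close>

lemma evrel_LAH_rels:
  assumes "(f, g) \<in> LAH_rels A z" "arr LP v w f" "arr LP v w g" "matched v w"
  shows "evrel f g"
  using assms(1)
proof (cases rule: LAH_rels.cases)
  case 1
  then have rel: "(f, g) \<in> AH_rels A z" by auto
  then have "wt H f \<and> wt H g \<and> msrc H f = msrc H g \<and> mtgt H f = mtgt H g"
    by (intro AH_rels_wt)
  then show ?thesis
    using rel by (intro evrelI) (simp add: ev_AH H.eqv_rel)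
next
  case (7 Q')
  \<comment> \<open>A word led by a red letter other than \<open>Q\<close> is not good, so matched
    ends fix the label.\<close>
  then have Q': "Q' = Q"
    using assms(2,4) by (auto simp: arr_iff matched_def)
  have "eqv H (ev f) (Zer [II] [II])"
    unfolding 7 using H.eqv_Zer_Comp[of "Zer [II] [II]" "[II]" "[II]"]
    by (simp add: image_iff)
  moreover have "eqv H (ev g) (bracket Q)"
    unfolding 7 Q' using H.eqv_unit_Tens[OF wt_bracket(1)] wt_H_imp_LAH[OF wt_bracket(1)[of A z Q]]
    by (simp add: good_def wt_bracket ev_AH)
  \<comment> \<open>Members of \<open>first_Q\<close> carry a right-hand identity; here it is the
    one on the empty word.\<close>
  moreover have "eqv H (bracket Q) (bracket Q \<otimes>\<^sub>t Idm [])"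
    by (intro H.eqv_sym[OF H.eqv_Tens_unit] wt_bracket)
  moreover have "qeq H first_Q (bracket Q \<otimes>\<^sub>t Idm []) (Zer [II] [II])"
    using qeq_null[of "bracket Q \<otimes>\<^sub>t Idm []" first_Q H] by (simp add: first_Q_def wt_bracket)
  ultimately have "qeq H first_Q (ev f) (ev g)"
    by (meson qeq_eqv qeq_sym qeq_trans)
  then show ?thesis
    using assms(2) by (auto simp: evrel_def 7 Q' arr_iff)
qed (use assms(2,4) in \<open>auto simp: arr_iff matched_def\<close>)

text \<open>Clauses without tensor products carry over directly, those with an identity once the
  good shape of its word is known. In the tensor clauses the evaluation depends on the shape of the
  words, so unmatched ends are discarded first; matched ends make both end words good.\<close>

lemma meq_evrel: "meq LP v w f g \<Longrightarrow> evrel f g"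
proof (induction rule: meq.induct)
  case (meq_rel f g v w)
  then show ?case
    using evrel_LAH_rels[of f g v w] evrel_unmatched[of v w f g] by (auto simp del: ev.simps)
next
  case (meq_refl v w f)
  then show ?case using ev_wt[of f] by (intro evrelI H.eqv_refl) (auto simp: arr_iff)
next
  case (meq_sym v w f g)
  then show ?case
    using L.meq_arr[OF meq_sym.hyps] by (auto simp: evrel_def arr_iff intro: qeq_sym H.eqv_sym)
next
  case (meq_trans v w f g h)
  then show ?case
    using L.meq_arr[OF meq_trans.hyps(1)]
    by (auto simp: evrel_def arr_iff intro: qeq_trans H.eqv_trans split: if_splits)
next
  case (cong_Comp v w g g' u f f')
  note t = L.meq_arr[OF cong_Comp.hyps(1)] L.meq_arr[OF cong_Comp.hyps(2)]
  show ?case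
  proof (cases "matched u w")
    case True
    \<comment> \<open>The middle word \<open>v\<close> is arbitrary. A pure end makes the hypothesis
      on the adjacent factor exact whatever \<open>v\<close> is; between words led by
      \<open>Q\<close> both hypotheses are used modulo \<open>Q_1\<close>, of which exact equality
      is a special case.\<close>
    then consider "pure u" "pure w" | "qtype u" "qtype w" by (auto simp: matched_def)
    then show ?thesis
    proof cases
      case 1
      then have "eqv H (ev g) (ev g')" "eqv H (ev f) (ev f')"
        using cong_Comp.IH t not_pure_qtype by (auto simp: evrel_def arr_iff)
      then show ?thesis
        using t ev_wt[of f] ev_wt[of g]
        by (intro evrelI) (auto simp: arr_iff intro!: H.eqv_cong_Comp)
    next
      case 2
      then have "qeq H first_Q (ev (g \<circ>\<^sub>t f)) (ev (g' \<circ>\<^sub>t f'))"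
        using t ev_wt[of f] ev_wt[of g] evrel_qeq[OF cong_Comp.IH(1)] evrel_qeq[OF cong_Comp.IH(2)]
        by (auto simp: arr_iff intro!: qeq_Comp)
      then show ?thesis
        using 2 t by (simp add: evrel_def arr_iff)
    qed
  qed (use t in \<open>auto intro: evrel_unmatched arr_Comp\<close>)
next
  case (cong_Tens v w f f' v' w' g g')
  note t = L.meq_arr[OF cong_Tens.hyps(1)] L.meq_arr[OF cong_Tens.hyps(2)]
  note e = ev_wt[of f] ev_wt[of f'] ev_wt[of g] ev_wt[of g']
  show ?case
  proof (cases "matched (v @ v') (w @ w')")
    case True
    then have good: "good (v @ v')" "good (w @ w')"
      using matched_good by auto
    consider "\<not> matched v w" | "\<not> matched v' w'" | "matched v w" "matched v' w'" by blast
    then show ?thesis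
    proof cases
      case 1
      then have "H.null (ev f)" "H.null (ev f')"
        using t by (auto intro!: ev_null simp: arr_iff)
      then show ?thesis
        using t e good by (intro evrelI) (auto simp: arr_iff intro!: H.null_null H.null_Tens_left)
    next
      case 2
      then have "H.null (ev g)" "H.null (ev g')"
        using t by (auto intro!: ev_null simp: arr_iff)
      then show ?thesis
        using t e good by (intro evrelI) (auto simp: arr_iff intro!: H.null_null H.null_Tens_right)
    next
      case 3
      consider "pure v" "pure v'" | "qtype v" "pure v'" | "v = []" "qtype v'"
        using good(1) by (auto simp: good_append)
      then show ?thesis
      proof cases
        case 1
        then show ?thesis
          using t good evrel_pure[OF cong_Tens.IH(1)] evrel_pure[OF cong_Tens.IH(2)]
          by (intro evrelI) (auto simp: arr_iff intro!: H.eqv_cong_Tens)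
      next
        case 2
        \<comment> \<open>Here \<open>Q\<close> leads the left factor. That factor is replaced
          modulo \<open>Q_1\<close>, with strands only on its right; the pure right factor is
          replaced exactly.\<close>
        have "qeq H first_Q (ev f \<otimes>\<^sub>t ev g) (ev f' \<otimes>\<^sub>t ev g)"
          using t e by (intro first_Q_Tens_right evrel_qeq[OF cong_Tens.IH(1)]) (auto simp: arr_iff)
        also have "eqv H \<dots> (ev f' \<otimes>\<^sub>t ev g')"
          using t e 2 evrel_pure[OF cong_Tens.IH(2)]
          by (intro H.eqv_cong_Tens H.eqv_refl) (auto simp: arr_iff)
        finally have "qeq H first_Q (ev f \<otimes>\<^sub>t ev g) (ev f' \<otimes>\<^sub>t ev g')" .
        moreover have "qtype w" "pure w'"
          using 2 3 not_pure_qtype by (auto simp: matched_def)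
        ultimately show ?thesis
          using t good 2 by (auto simp: evrel_def arr_iff qtype_append)
      next
        case Unit: 3
        then have w: "w = []"
          using 3 by (simp add: matched_def)
        have f: "eqv H (ev f) (ev f')"
          using evrel_pure[OF cong_Tens.IH(1)] t Unit by (auto simp: arr_iff)
        \<comment> \<open>Now \<open>Q\<close> leads the right factor, and the left one is an
          endomorphism of the unit object. Being a scalar, it does not shift the strands on which
          \<open>Q_1\<close> acts.\<close>
        obtain c where c: "eqv H (ev f) (c *\<^sub>t Idm [])"
          using H.endomorphism_of_unit_scalar[of "ev f"] t e(1) Unit w mset_gen gen_src_nonempty
          by (auto simp: arr_iff)
        have c': "eqv H (ev f') (c *\<^sub>t Idm [])"
          using H.eqv_trans[OF H.eqv_sym[OF f] c] .
        have "eqv H (ev f \<otimes>\<^sub>t ev g) (c *\<^sub>t ev g)"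
          using t e by (intro H.eqv_scalar_Tens[OF c]) (auto simp: arr_iff)
        also have "qeq H first_Q \<dots> (c *\<^sub>t ev g')"
          by (intro qeq_Scl evrel_qeq[OF cong_Tens.IH(2)])
        also have "eqv H \<dots> (ev f' \<otimes>\<^sub>t ev g')"
          using t e by (intro H.eqv_sym[OF H.eqv_scalar_Tens[OF c']]) (auto simp: arr_iff)
        finally have "qeq H first_Q (ev f \<otimes>\<^sub>t ev g) (ev f' \<otimes>\<^sub>t ev g')" .
        moreover have "qtype w'"
          using Unit 3 not_pure_qtype by (auto simp: matched_def)
        ultimately show ?thesis
          using t good Unit w by (auto simp: evrel_def arr_iff)
      qed
    qed
  qed (use t in \<open>auto intro: evrel_unmatched arr_Tens\<close>)
next
  case (cong_Add v w f f' g g')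
  note t = L.meq_arr[OF cong_Add.hyps(1)] L.meq_arr[OF cong_Add.hyps(2)]
  show ?case
    using cong_Add.IH t ev_wt[of f] ev_wt[of g]
    by (auto simp: evrel_def arr_iff intro!: qeq_Add H.eqv_cong_Add split: if_splits)
next
  case (cong_Scl v w f f' c)
  then show ?case
    by (auto simp: evrel_def intro!: qeq_Scl H.eqv_cong_Scl split: if_splits)
next
  case (Comp_assoc v w h u g t f)
  then show ?case using ev_wt[of f] ev_wt[of g] ev_wt[of h]
    by (intro evrelI) (auto simp: arr_iff intro!: H.eqv_Comp_assoc)
next
  case (Id_Comp v w f)
  show ?case
  proof (cases "matched v w")
    case True
    then show ?thesis
      using matched_good[OF True] Id_Comp ev_wt[of f]
      by (intro evrelI) (auto simp: arr_iff intro!: H.eqv_Id_Comp)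
  next
    case False
    then show ?thesis
      using Id_Comp L.wt_letters[of f] by (intro evrel_unmatched[of v w]) (auto simp: arr_iff)
  qed
next
  case (Comp_Id v w f)
  show ?case
  proof (cases "matched v w")
    case True
    then show ?thesis
      using matched_good[OF True] Comp_Id ev_wt[of f]
      by (intro evrelI) (auto simp: arr_iff intro!: H.eqv_Comp_Id)
  next
    case False
    then show ?thesis
      using Comp_Id L.wt_letters[of f] by (intro evrel_unmatched[of v w]) (auto simp: arr_iff)
  qed
next
  case (Add_assoc v w f g h)
  then show ?case using ev_wt[of f] ev_wt[of g] ev_wt[of h]
    by (intro evrelI) (auto simp: arr_iff intro!: H.eqv_Add_assoc)
next
  case (Add_comm v w f g)
  then show ?case using ev_wt[of f] ev_wt[of g]
    by (intro evrelI) (auto simp: arr_iff intro!: H.eqv_Add_comm)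
next
  case (Add_Zer v w f)
  then show ?case using ev_wt[of f]
    by (intro evrelI) (auto simp: arr_iff intro!: H.eqv_Add_Zer)
next
  case (Scl_zero v w f)
  then show ?case using ev_wt[of f] H.eqv_Scl_zero[of "ev f"]
    by (intro evrelI) (auto simp: arr_iff)
next
  case (Scl_one v w f)
  then show ?case using ev_wt[of f]
    by (intro evrelI) (auto simp: arr_iff intro!: H.eqv_Scl_one)
next
  case (Scl_Scl v w f c c')
  then show ?case using ev_wt[of f]
    by (intro evrelI) (auto simp: arr_iff intro!: H.eqv_Scl_Scl)
next
  case (Scl_add v w f c c')
  then show ?case using ev_wt[of f]
    by (intro evrelI) (auto simp: arr_iff intro!: H.eqv_Scl_add)
next
  case (Scl_Add v w f g c)
  then show ?case using ev_wt[of f] ev_wt[of g]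
    by (intro evrelI) (auto simp: arr_iff intro!: H.eqv_Scl_Add)
next
  case (Add_Comp v w g g' u f)
  then show ?case using ev_wt[of f] ev_wt[of g] ev_wt[of g']
    by (intro evrelI) (auto simp: arr_iff intro!: H.eqv_Add_Comp)
next
  case (Comp_Add v w g u f f')
  then show ?case using ev_wt[of f] ev_wt[of g] ev_wt[of f']
    by (intro evrelI) (auto simp: arr_iff intro!: H.eqv_Comp_Add)
next
  case (Scl_Comp v w g u f c)
  then show ?case using ev_wt[of f] ev_wt[of g]
    by (intro evrelI) (auto simp: arr_iff intro!: H.eqv_Scl_Comp)
next
  case (Comp_Scl v w g u f c)
  then show ?case using ev_wt[of f] ev_wt[of g]
    by (intro evrelI) (auto simp: arr_iff intro!: H.eqv_Comp_Scl)
next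
  case (Add_Tens v w f f' v' w' g)
  show ?case
  proof (cases "matched (v @ v') (w @ w')")
    case True
    then show ?thesis
      using matched_good[OF True] Add_Tens ev_wt[of f] ev_wt[of g] ev_wt[of f']
      by (intro evrelI) (auto simp: arr_iff intro!: H.eqv_Add_Tens)
  next
    case False
    then show ?thesis
      using Add_Tens by (intro evrel_unmatched[OF _ _ False]) (auto simp: arr_iff)
  qed
next
  case (Tens_Add v w f v' w' g g')
  show ?case
  proof (cases "matched (v @ v') (w @ w')")
    case True
    then show ?thesis
      using matched_good[OF True] Tens_Add ev_wt[of f] ev_wt[of g] ev_wt[of g']
      by (intro evrelI) (auto simp: arr_iff intro!: H.eqv_Tens_Add)
  next
    case False
    then show ?thesis
      using Tens_Add by (intro evrel_unmatched[OF _ _ False]) (auto simp: arr_iff)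
  qed
next
  case (Scl_Tens v w f v' w' g c)
  show ?case
  proof (cases "matched (v @ v') (w @ w')")
    case True
    then show ?thesis
      using matched_good[OF True] Scl_Tens ev_wt[of f] ev_wt[of g]
      by (intro evrelI) (auto simp: arr_iff intro!: H.eqv_Scl_Tens)
  next
    case False
    then show ?thesis
      using Scl_Tens by (intro evrel_unmatched[OF _ _ False]) (auto simp: arr_iff)
  qed
next
  case (Tens_Scl v w f v' w' g c)
  show ?case
  proof (cases "matched (v @ v') (w @ w')")
    case True
    then show ?thesis
      using matched_good[OF True] Tens_Scl ev_wt[of f] ev_wt[of g]
      by (intro evrelI) (auto simp: arr_iff intro!: H.eqv_Tens_Scl)
  next
    case False
    then show ?thesis
      using Tens_Scl by (intro evrel_unmatched[OF _ _ False]) (auto simp: arr_iff)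
  qed
next
  case (Tens_assoc u u' f v v' g w w' h)
  show ?case
  proof (cases "matched (u @ v @ w) (u' @ v' @ w')")
    case True
    then have "good (u @ v @ w)" "good (u' @ v' @ w')"
      using matched_good by auto
    \<comment> \<open>Prefixes and suffixes of a good word are good, so both bracketings pass every
      shape test.\<close>
    moreover from this have "good (u @ v)" "good (v @ w)" "good (u' @ v')" "good (v' @ w')"
      by (auto simp: good_append good_def qtype_append)
    ultimately have "ev ((f \<otimes>\<^sub>t g) \<otimes>\<^sub>t h) = (ev f \<otimes>\<^sub>t ev g) \<otimes>\<^sub>t ev h"
      "ev (f \<otimes>\<^sub>t g \<otimes>\<^sub>t h) = ev f \<otimes>\<^sub>t ev g \<otimes>\<^sub>t ev h"
      using Tens_assoc by (auto simp: arr_iff)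
    then show ?thesis
      using Tens_assoc ev_wt[of f] ev_wt[of g] ev_wt[of h]
      by (intro evrelI) (auto simp: arr_iff simp del: ev.simps intro!: H.eqv_Tens_assoc)
  next
    case False
    then show ?thesis
      using Tens_assoc by (intro evrel_unmatched[OF _ _ False]) (auto simp: arr_iff)
  qed
next
  case (unit_Tens v w f)
  show ?case
  proof (cases "matched v w")
    case True
    then show ?thesis
      using matched_good[OF True] unit_Tens ev_wt[of f]
      by (intro evrelI) (auto simp: arr_iff good_def[of "[]"] intro!: H.eqv_unit_Tens)
  next
    case False
    then show ?thesis
      using unit_Tens by (intro evrel_unmatched[OF _ _ False]) (auto simp: arr_iff)
  qed
next
  case (Tens_unit v w f)
  show ?case
  proof (cases "matched v w")
    case True
    then show ?thesis
      using matched_good[OF True] Tens_unit ev_wt[of f]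
      by (intro evrelI) (auto simp: arr_iff good_def[of "[]"] intro!: H.eqv_Tens_unit)
  next
    case False
    then show ?thesis
      using Tens_unit by (intro evrel_unmatched[OF _ _ False]) (auto simp: arr_iff)
  qed
next
  case (Id_Tens_Id v w)
  show ?case
  proof (cases "good (v @ w)")
    case True
    then have "good v" "good w"
      unfolding good_append by (auto simp: good_def)
    then show ?thesis
      using True by (intro evrelI) (auto intro!: H.eqv_Id_Tens_Id)
  next
    case False
    then have "\<not> matched (v @ w) (v @ w)"
      using matched_good by auto
    then show ?thesis
      using Id_Tens_Id by (intro evrel_unmatched[of "v @ w" "v @ w"]) (auto simp: arr_iff)
  qed
next
  case (interchange v w f' u f v' w' g u' g' p q)
  note e = ev_wt[of f] ev_wt[of f'] ev_wt[of g] ev_wt[of g']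
  define c where "c = koszul (p * q) (1 :: 'k)"
  let ?l = "(f' \<otimes>\<^sub>t g) \<circ>\<^sub>t (f \<otimes>\<^sub>t g')" and ?r = "c *\<^sub>t ((f' \<circ>\<^sub>t f) \<otimes>\<^sub>t (g \<circ>\<^sub>t g'))"
  have "evrel ?l ?r"
  proof (cases "matched (u @ u') (w @ w')")
    case True
    then have good: "good (u @ u')" "good (w @ w')"
      using matched_good by auto
    then have r: "ev ?r = c *\<^sub>t ((ev f' \<circ>\<^sub>t ev f) \<otimes>\<^sub>t (ev g \<circ>\<^sub>t ev g'))"
      using interchange by (simp add: arr_iff)
    show ?thesis
    proof (cases "good (v @ v')")
      case True
      then have "ev ?l = (ev f' \<otimes>\<^sub>t ev g) \<circ>\<^sub>t (ev f \<otimes>\<^sub>t ev g')"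
        using interchange good by (simp add: arr_iff)
      moreover have "eqv H \<dots> (c *\<^sub>t ((ev f' \<circ>\<^sub>t ev f) \<otimes>\<^sub>t (ev g \<circ>\<^sub>t ev g')))"
        unfolding c_def using interchange e ev_mpar
        by (intro H.eqv_interchange) (auto simp: arr_iff)
      ultimately show ?thesis
        unfolding r[symmetric] by (intro evrelI) simp
    next
      case False
      \<comment> \<open>The left side vanishes by the shape test at the middle word. On the right
        side the middle word is not visible, but one of \<open>f\<close> and \<open>g'\<close> must
        have unmatched ends, for otherwise \<open>v @ v'\<close> would be good.\<close>
      then have "\<not> matched u v \<or> \<not> matched u' v'"
        using good matched_append matched_good by blast
      then have "H.null (ev f) \<or> H.null (ev g')"
        using interchange ev_null[of f] ev_null[of g'] by (auto simp: arr_iff)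
      then have "H.null (ev f' \<circ>\<^sub>t ev f) \<or> H.null (ev g \<circ>\<^sub>t ev g')"
        using interchange e H.null_Comp_right[of "ev f" "ev f'"] H.null_Comp_right[of "ev g'" "ev g"]
        by (auto simp: arr_iff)
      then have "H.null ((ev f' \<circ>\<^sub>t ev f) \<otimes>\<^sub>t (ev g \<circ>\<^sub>t ev g'))"
        using interchange e H.null_Tens_left[of "ev f' \<circ>\<^sub>t ev f" "ev g \<circ>\<^sub>t ev g'"]
          H.null_Tens_right[of "ev g \<circ>\<^sub>t ev g'" "ev f' \<circ>\<^sub>t ev f"]
        by (auto simp: arr_iff)
      then have "H.null (ev ?r)"
        unfolding r by (rule H.null_Scl)
      moreover have "H.null (ev (f' \<otimes>\<^sub>t g))"
        using False interchange by (auto simp: arr_iff)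
      then have "H.null (ev ?l)"
        using interchange ev_wt[of ?l] by (simp only: ev.simps(3)) (intro H.null_Comp_left, auto simp: arr_iff)
      ultimately show ?thesis
        using interchange ev_wt[of ?l] ev_wt[of ?r] by (intro evrelI H.null_null) (auto simp: arr_iff)
    qed
  next
    case False
    then show ?thesis
      using interchange by (intro evrel_unmatched[OF _ _ False]) (auto simp: arr_iff)
  qed
  then show ?case by (simp only: c_def)
qed

end


section \<open>Lifting along the evaluation\<close>

lemma mset_subseq: "subseq xs ys \<Longrightarrow> mset xs \<subseteq># mset ys"
  by (induction rule: list_emb.induct) (auto intro: subset_mset.order_trans)

context cyclotomic
begin

lemma H_null_imp_LAH: "H.null f \<Longrightarrow> L.null f"
  using eqv_H_imp_LAH[of f "Zer (msrc H f) (mtgt H f)"] wt_H_imp_LAH[of f] H.null_wt[of f]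
  by (simp add: H.null_def L.null_def)

lemma mset_gen_LAH: "g \<in> gens LP \<Longrightarrow> mset (src LP g) = mset (tgt LP g)"
  by (simp add: mset_gen)

text \<open>A composite of pure ends through a word with a red letter changes the letters twice, so
  it vanishes, and so does its evaluation. Elsewhere only generators of \<open>AH\<close> occur. The
  equality is exact, as is needed to the right of \<open>Q\<close>.\<close>

lemma lift_pure: "wt LP f \<Longrightarrow> pure (msrc LP f) \<Longrightarrow> pure (mtgt LP f) \<Longrightarrow> eqv LP f (ev f)"
proof (induction f)
  case (Gen g)
  then show ?case by (cases g) (auto intro!: L.eqv_refl)
next
  case (Idm w)
  then show ?case by (auto simp: good_def strip_pure intro!: L.eqv_refl)
next
  case (Comp g f)
  show ?case
  proof (cases "pure (mtgt LP f)")
    case True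
    then show ?thesis
      using Comp by (auto intro!: L.eqv_cong_Comp)
  next
    case False
    then have "mset (msrc LP f) \<noteq> mset (mtgt LP f)"
      using Comp.prems by (auto dest: mset_eq_setD)
    then have "L.null f"
      using Comp.prems by (intro L.null_if_mset_neq mset_gen_LAH) auto
    moreover have "L.null (ev f)"
      using Comp.prems False not_pure_qtype
      by (intro H_null_imp_LAH ev_null) (auto simp: matched_def)
    ultimately show ?thesis
      using Comp.prems ev_wt[of "g \<circ>\<^sub>t f"] wt_H_imp_LAH[of "ev (g \<circ>\<^sub>t f)"] strip_pure
      by (intro L.null_null) (auto intro!: L.null_Comp_right)
  qed
next
  case (Tens f g)
  then show ?case by (auto simp: good_def intro!: L.eqv_cong_Tens)
next
  case (Zer v w)
  then show ?case by (auto simp: strip_pure intro!: L.eqv_refl)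
next
  case (Add f g)
  then show ?case by (auto intro!: L.eqv_cong_Add)
next
  case (Scl c f)
  then show ?case by (auto intro!: L.eqv_cong_Scl)
qed

lemma lift_typing:
  assumes "wt LP f" "qtype (msrc LP f)" "qtype (mtgt LP f)"
  shows "msrc LP (oneQ Q \<otimes>\<^sub>t ev f) = msrc LP f \<and> mtgt LP (oneQ Q \<otimes>\<^sub>t ev f) = mtgt LP f"
proof -
  have "msrc LP (ev f) = strip (msrc LP f)" "mtgt LP (ev f) = strip (mtgt LP f)"
    using ev_wt[OF assms(1)] wt_H_imp_LAH[of "ev f"] by auto
  then show ?thesis
    using qtype_eq[OF assms(2)] qtype_eq[OF assms(3)] by simp
qed

text \<open>By induction on the term: whenever the evaluation discards something, the term itself is
  zero or passes through a word with first letter \<open>I\<close>. Modulo \<open>via_I\<close> the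
  evaluation thus loses nothing, which gives surjectivity of
  \<open>1\<^sub>Q \<otimes> f\<close>.\<close>

lemma lift_Q:
  "wt LP f \<Longrightarrow> qtype (msrc LP f) \<Longrightarrow> qtype (mtgt LP f) \<Longrightarrow> qeq LP via_I f (oneQ Q \<otimes>\<^sub>t ev f)"
proof (induction f)
  case (Gen g)
  then show ?case by (cases g) auto
next
  case (Idm w)
  have "eqv LP (oneQ Q \<otimes>\<^sub>t Idm (strip w)) (Idm ([Red Q] @ strip w))"
    using Idm Q by (intro L.eqv_Id_Tens_Id) auto
  then have "eqv LP (Idm w) (oneQ Q \<otimes>\<^sub>t ev (Idm w))"
    using Idm qtype_eq[of w, symmetric] by (auto simp: good_def intro: L.eqv_sym)
  then show ?case by (rule qeq_eqv)
next
  case (Comp g f)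
  note t = Comp.prems(1) ev_wt[of f] ev_wt[of g] wt_H_imp_LAH[of "ev f"] wt_H_imp_LAH[of "ev g"]
  show ?case
  proof (cases "qtype (mtgt LP f)")
    case True
    have "qeq LP via_I (g \<circ>\<^sub>t f) ((oneQ Q \<otimes>\<^sub>t ev g) \<circ>\<^sub>t (oneQ Q \<otimes>\<^sub>t ev f))"
      using Comp True by (intro qeq_Comp) auto
    also have "eqv LP \<dots> (oneQ Q \<otimes>\<^sub>t (ev g \<circ>\<^sub>t ev f))"
      using t Q by (intro L.eqv_sym[OF L.eqv_Id_Tens_Comp]) auto
    finally show ?thesis by simp
  next
    case False
    then have unmatched: "\<not> matched (msrc LP f) (mtgt LP f)"
      using Comp.prems not_pure_qtype by (auto simp: matched_def)
    \<comment> \<open>The middle word is not led by \<open>Q\<close>. If it has the letters of the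
      source, it begins with \<open>I\<close> and the composite lies in \<open>via_I\<close>;
      otherwise \<open>f\<close> is zero.\<close>
    have zero: "qeq LP via_I (g \<circ>\<^sub>t f) (Zer (msrc LP f) (mtgt LP g))"
    proof (cases "mset (msrc LP f) = mset (mtgt LP f)")
      case True
      then have "g \<circ>\<^sub>t f \<in> via_I"
        using matched_mset_cases[OF True _ unmatched] Comp.prems by (auto simp: good_def via_I_def)
      then show ?thesis
        using qeq_null[of "g \<circ>\<^sub>t f" via_I LP] t by simp
    next
      case False
      then have "L.null f"
        using t by (intro L.null_if_mset_neq mset_gen_LAH) auto
      then have "L.null (g \<circ>\<^sub>t f)"
        using t by (intro L.null_Comp_right) auto
      then show ?thesis
        using qeq_eqv[of LP "g \<circ>\<^sub>t f" "Zer (msrc LP f) (mtgt LP g)"] by (simp add: L.null_def)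
    qed
    have "L.null (ev f)"
      using t unmatched by (intro H_null_imp_LAH ev_null) auto
    then have "L.null (oneQ Q \<otimes>\<^sub>t ev (g \<circ>\<^sub>t f))"
      using t Q by (auto intro!: L.null_Tens_right L.null_Comp_right)
    moreover have "msrc LP (oneQ Q \<otimes>\<^sub>t ev (g \<circ>\<^sub>t f)) = msrc LP f"
      "mtgt LP (oneQ Q \<otimes>\<^sub>t ev (g \<circ>\<^sub>t f)) = mtgt LP g"
      using lift_typing[of "g \<circ>\<^sub>t f"] Comp.prems by simp_all
    ultimately have "eqv LP (Zer (msrc LP f) (mtgt LP g)) (oneQ Q \<otimes>\<^sub>t ev (g \<circ>\<^sub>t f))"
      unfolding L.null_def by (metis L.eqv_sym)
    with zero show ?thesis by (meson qeq_eqv qeq_trans)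
  qed
next
  case (Tens f g)
  note t = Tens.prems(1) ev_wt[of f] ev_wt[of g] wt_H_imp_LAH[of "ev f"] wt_H_imp_LAH[of "ev g"]
  have ev: "ev (f \<otimes>\<^sub>t g) = ev f \<otimes>\<^sub>t ev g"
    using Tens.prems by (simp add: good_def)
  \<comment> \<open>Either \<open>Q\<close> sits in the left factor at both ends, or in the right
    factor at both ends behind an empty left one. In the mixed case exactly one end of
    \<open>f\<close> is empty, so \<open>f\<close> changes its letters.\<close>
  consider (left) "qtype (msrc LP f)" "pure (msrc LP g)" "qtype (mtgt LP f)" "pure (mtgt LP g)"
    | (right) "msrc LP f = []" "qtype (msrc LP g)" "mtgt LP f = []" "qtype (mtgt LP g)"
    | (neq) "mset (msrc LP f) \<noteq> mset (mtgt LP f)" "\<not> matched (msrc LP f) (mtgt LP f)"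
    using Tens.prems(2,3)
    by (cases "msrc LP f"; cases "mtgt LP f") (auto simp: matched_def)
  then show ?case
  proof cases
    case left
    have "qeq LP via_I (f \<otimes>\<^sub>t g) ((oneQ Q \<otimes>\<^sub>t ev f) \<otimes>\<^sub>t g)"
      using Tens left by (intro via_I_Tens_right) auto
    also have "eqv LP \<dots> ((oneQ Q \<otimes>\<^sub>t ev f) \<otimes>\<^sub>t ev g)"
      using t Q left by (intro L.eqv_cong_Tens L.eqv_refl lift_pure) auto
    also have "eqv LP \<dots> (oneQ Q \<otimes>\<^sub>t ev f \<otimes>\<^sub>t ev g)"
      using t Q by (intro L.eqv_Tens_assoc) auto
    finally show ?thesis by (simp only: ev)
  next
    case right
    have "eqv LP f (ev f)"
      using t right by (intro lift_pure) auto
    moreover obtain c where c: "eqv H (ev f) (c *\<^sub>t Idm [])"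
      using H.endomorphism_of_unit_scalar[of "ev f"] t right mset_gen gen_src_nonempty by auto
    ultimately have fc: "eqv LP f (c *\<^sub>t Idm [])"
      using eqv_H_imp_LAH L.eqv_trans by blast
    have "eqv LP (f \<otimes>\<^sub>t g) (c *\<^sub>t g)"
      using t by (intro L.eqv_scalar_Tens[OF fc]) auto
    also have "qeq LP via_I \<dots> (c *\<^sub>t (oneQ Q \<otimes>\<^sub>t ev g))"
      using Tens right by (intro qeq_Scl) auto
    also have "eqv LP \<dots> (oneQ Q \<otimes>\<^sub>t (c *\<^sub>t ev g))"
      using t Q by (intro L.eqv_sym[OF L.eqv_Tens_Scl]) auto
    also have "eqv LP \<dots> (oneQ Q \<otimes>\<^sub>t ev f \<otimes>\<^sub>t ev g)"
      using t Q
      by (intro L.eqv_cong_Tens L.eqv_refl L.eqv_sym[OF L.eqv_scalar_Tens[OF eqv_H_imp_LAH[OF c]]]) auto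
    finally show ?thesis by (simp only: ev)
  next
    case neq
    then have "L.null f"
      using t by (intro L.null_if_mset_neq mset_gen_LAH) auto
    then have "L.null (f \<otimes>\<^sub>t g)"
      using t by (intro L.null_Tens_left) auto
    moreover have "L.null (ev f)"
      using t neq by (intro H_null_imp_LAH ev_null) auto
    then have "L.null (oneQ Q \<otimes>\<^sub>t ev (f \<otimes>\<^sub>t g))"
      unfolding ev using t Q by (intro L.null_Tens_right[OF L.null_Tens_left]) auto
    ultimately have "eqv LP (f \<otimes>\<^sub>t g) (oneQ Q \<otimes>\<^sub>t ev (f \<otimes>\<^sub>t g))"
      using lift_typing[OF Tens.prems] by (intro L.null_null) simp_all
    then show ?thesis by (rule qeq_eqv)
  qed
next
  case (Zer v w)
  have "L.null (oneQ Q \<otimes>\<^sub>t ev (Zer v w))"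
    using Q by (intro L.null_Tens_right) auto
  then have "eqv LP (Zer v w) (oneQ Q \<otimes>\<^sub>t ev (Zer v w))"
    using Zer.prems(1) lift_typing[OF Zer.prems] by (intro L.null_null) simp_all
  then show ?case by (rule qeq_eqv)
next
  case (Add f g)
  note t = Add.prems(1) ev_wt[of f] ev_wt[of g] wt_H_imp_LAH[of "ev f"] wt_H_imp_LAH[of "ev g"]
  have "qeq LP via_I (f +\<^sub>t g) ((oneQ Q \<otimes>\<^sub>t ev f) +\<^sub>t (oneQ Q \<otimes>\<^sub>t ev g))"
    using Add by (intro qeq_Add) auto
  also have "eqv LP \<dots> (oneQ Q \<otimes>\<^sub>t (ev f +\<^sub>t ev g))"
    using t Q by (intro L.eqv_sym[OF L.eqv_Tens_Add]) auto
  finally show ?case by simp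
next
  case (Scl c f)
  note t = Scl.prems(1) ev_wt[of f] wt_H_imp_LAH[of "ev f"]
  have "qeq LP via_I (c *\<^sub>t f) (c *\<^sub>t (oneQ Q \<otimes>\<^sub>t ev f))"
    using Scl by (intro qeq_Scl) auto
  also have "eqv LP \<dots> (oneQ Q \<otimes>\<^sub>t (c *\<^sub>t ev f))"
    using t Q by (intro L.eqv_sym[OF L.eqv_Tens_Scl]) auto
  finally show ?case by simp
qed

end

section \<open>Words with \<open>d\<close> letters \<open>I\<close> and one letter
  \<open>Q\<close>\<close>

locale cyclotomic_words = cyclotomic A z Q
  for A :: "('k::{comm_ring,comm_monoid_mult}, 'a::{ring,monoid_mult}) frobenius_data" and z Q +
  fixes d :: nat
  assumes d: "d \<ge> 1"
begin

abbreviation Iw where "Iw \<equiv> replicate d (II :: (int \<Rightarrow>\<^sub>0 'a) letter)"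
abbreviation w0 where "w0 \<equiv> Red Q # Iw"
abbreviation Words where "Words \<equiv> Lambda_words A d [Q]"

text \<open>The two subwords bound the letter counts from below, and the length leaves room for
  nothing else. As rearrangements of one word, the summands form a full block under
  letter-preserving morphisms.\<close>

lemma Words_iff: "w \<in> Words \<longleftrightarrow> mset w = mset w0"
proof
  assume w: "w \<in> Words"
  then have sub: "mset Iw \<subseteq># mset w" "mset [Red Q] \<subseteq># mset w" and len: "length w = d + 1"
    by (simp_all add: Lambda_words_def mset_subseq del: mset.simps mset_replicate)
  have "mset w0 \<subseteq># mset w"
    unfolding subseteq_mset_def
  proof
    fix l
    have "count (mset w0) l = count (mset [Red Q]) l + count (mset Iw) l"
      by simp
    \<comment> \<open>The letters \<open>I\<close> and \<open>Q\<close> are distinct, so at each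
      letter one of the two counts is zero and the separate bounds combine.\<close>
    moreover have "count (mset Iw) l = 0 \<or> count (mset [Red Q]) l = 0"
      by (auto simp: count_mset_0_iff)
    moreover have "count (mset Iw) l \<le> count (mset w) l" "count (mset [Red Q]) l \<le> count (mset w) l"
      by (rule mset_subset_eq_count[OF sub(1)], rule mset_subset_eq_count[OF sub(2)])
    ultimately show "count (mset w0) l \<le> count (mset w) l"
      by linarith
  qed
  moreover have "size (mset w0) = size (mset w)"
    using len by simp
  ultimately show "mset w = mset w0"
    using mset_subset_size[of "mset w0" "mset w"] by (metis less_irrefl subset_mset.le_less)
next
  assume w: "mset w = mset w0"
  have "subseq (replicate (count (mset w) l) l) w" for l
    unfolding replicate_count_mset_eq_filter_eq by (rule subseq_filter_left)
  from this[of II] this[of "Red Q"] have "subseq Iw w" "subseq [Red Q] w"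
    unfolding w by simp_all
  then show "w \<in> Words"
    using mset_eq_length[OF w] mset_eq_setD[OF w] Q by (auto simp: Lambda_words_def)
qed

lemma finite_Words: "finite Words"
proof (rule finite_subset)
  show "Words \<subseteq> {w. set w \<subseteq> set w0 \<and> length w = d + 1}"
  proof
    fix w assume "w \<in> Words"
    then have w: "mset w = mset w0"
      by (simp only: Words_iff)
    show "w \<in> {w. set w \<subseteq> set w0 \<and> length w = d + 1}"
      using mset_eq_length[OF w] mset_eq_setD[OF w] by simp
  qed
  show "finite {w. set w \<subseteq> set w0 \<and> length w = d + 1}"
    by (rule finite_lists_length_eq) simp
qed

lemma Words_letters: "w \<in> Words \<Longrightarrow> set w \<subseteq> letters LP"
  by (auto simp: Lambda_words_def)

sublocale M: word_matrices LP Words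
  by unfold_locales (use finite_Words Words_letters in auto)

lemma w0_Words: "w0 \<in> Words"
  by (simp add: Words_iff)

lemma qtype_w0: "qtype w0"
  by auto

lemma pure_length_eq: "pure w \<Longrightarrow> length w = d \<Longrightarrow> w = Iw"
  by (intro replicate_eqI) auto

text \<open>A rearrangement not beginning with \<open>I\<close> has \<open>Q\<close> in front and
  only letters \<open>I\<close> behind it. So exactly one summand is not killed by the
  ideal.\<close>

lemma Words_first: "w \<in> Words \<Longrightarrow> w \<noteq> w0 \<longleftrightarrow> hd w = II"
proof -
  assume w: "w \<in> Words"
  have "hd w = II" if "w \<noteq> w0"
  proof (cases "matched w0 w")
    case True
    then have q: "qtype w" "length w = d + 1"
      using not_pure_qtype by (auto simp: matched_def)
    then have "length (strip w) = d"
      by (simp add: strip_qtype)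
    then have "strip w = Iw"
      by (intro pure_length_eq) auto
    then show ?thesis
      using that qtype_eq[OF q(1)] by metis
  next
    case False
    then show ?thesis
      using w by (metis Words_iff good_def matched_mset_cases qtype_w0)
  qed
  then show ?thesis by auto
qed

end


section \<open>The isomorphism\<close>

lemma (in ring) mult_zero_between: "a \<in> carrier R \<Longrightarrow> b \<in> carrier R \<Longrightarrow> a \<otimes> (\<zero> \<otimes> b) = \<zero>"
  by simp

context wf_presentation
begin

lemma scalar_ring_End_algebra:
  assumes "set w \<subseteq> letters P"
  shows "scalar_ring (End_algebra P w)"
proof (rule scalar_ring.intro[OF ring_End_algebra[OF assms]], unfold_locales)
  fix c
  show "c \<odot>\<^bsub>End_algebra P w\<^esub> \<one>\<^bsub>End_algebra P w\<^esub> \<in> carrier (End_algebra P w)"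
    using assms by (simp add: End_algebra_def Hom_scale_closed Hom_id_closed)
  fix X assume "X \<in> carrier (End_algebra P w)"
  then show "c \<odot>\<^bsub>End_algebra P w\<^esub> X = c \<odot>\<^bsub>End_algebra P w\<^esub> \<one>\<^bsub>End_algebra P w\<^esub> \<otimes>\<^bsub>End_algebra P w\<^esub> X"
    using assms by (simp add: End_algebra_def Hom_scale_comp[OF Hom_id_closed] Hom_id_comp)
next
  fix p
  show "homog (End_algebra P w) p \<subseteq> carrier (End_algebra P w)"
    by (auto simp: End_algebra_def Hom_homog_def)
qed

end

lemma (in word_matrices) scalar_ring_Mat: "scalar_ring Mat"
proof (rule scalar_ring.intro[OF ring_Mat], unfold_locales)
  fix c
  show "c \<odot>\<^bsub>Mat\<^esub> \<one>\<^bsub>Mat\<^esub> \<in> carrier Mat"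
    by (rule Mat_smult_closed[OF Mat_one_closed])
  fix M assume "M \<in> carrier Mat"
  then show "c \<odot>\<^bsub>Mat\<^esub> M = c \<odot>\<^bsub>Mat\<^esub> \<one>\<^bsub>Mat\<^esub> \<otimes>\<^bsub>Mat\<^esub> M"
    by (rule Mat_smult)
next
  fix p
  have "Hom_homog P i j p \<subseteq> Hom_set P i j" for i j
    by (auto simp: Hom_homog_def)
  then have "(\<Pi>\<^sub>E (j, i)\<in>L \<times> L. Hom_homog P i j p) \<subseteq> (\<Pi>\<^sub>E (j, i)\<in>L \<times> L. Hom_set P i j)"
    by (intro PiE_mono) auto
  then show "homog Mat p \<subseteq> carrier Mat"
    by (simp add: Add_End_algebra_def)
qed

context cyclotomic_words
begin

abbreviation S where "S \<equiv> End_algebra H Iw"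
abbreviation R where "R \<equiv> Add_End_algebra LP Words"

definition Q_ideal where "Q_ideal = Idl\<^bsub>S\<^esub> {on_strand A z d 1 Q}"
definition I_ideal where "I_ideal = Idl\<^bsub>R\<^esub> (summand_id LP Words ` {w \<in> Words. hd w = II})"

abbreviation cl where "cl \<equiv> mclass H Iw Iw"

abbreviation arrI where "arrI \<equiv> arr H Iw Iw"

lemma Iw_letters: "set Iw \<subseteq> letters H"
  by auto

lemmas S_scalar = H.scalar_ring_End_algebra[OF Iw_letters]
lemmas S_ring = H.ring_End_algebra[OF Iw_letters]

lemma S_carrier: "X \<in> carrier S \<longleftrightarrow> (\<exists>f. arrI f \<and> X = cl f)"
  by (auto simp: End_algebra_def Hom_set_def)

lemma cl_closed: "arrI f \<Longrightarrow> cl f \<in> carrier S"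
  by (auto simp: S_carrier)

lemma cl_ops:
  shows cl_mult: "arrI f \<Longrightarrow> arrI g \<Longrightarrow> cl f \<otimes>\<^bsub>S\<^esub> cl g = cl (f \<circ>\<^sub>t g)"
    and cl_add: "arrI f \<Longrightarrow> arrI g \<Longrightarrow> cl f \<oplus>\<^bsub>S\<^esub> cl g = cl (f +\<^sub>t g)"
    and cl_smult: "arrI f \<Longrightarrow> c \<odot>\<^bsub>S\<^esub> cl f = cl (c *\<^sub>t f)"
    and cl_one: "\<one>\<^bsub>S\<^esub> = cl (Idm Iw)"
    and cl_zero: "\<zero>\<^bsub>S\<^esub> = cl (Zer Iw Iw)"
  by (simp_all add: End_algebra_def H.Hom_comp_mclass H.Hom_add_mclass H.Hom_scale_mclass
      Hom_id_def Hom_zero_def)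

text \<open>This is where \<open>d \<ge> 1\<close> enters: there is a first strand for
  \<open>Q_1\<close> to act on.\<close>

lemma Iw_eq: "II # replicate (d - Suc 0) II = Iw"
  using d by (cases d) auto

abbreviation Q1 where "Q1 \<equiv> bracket Q \<otimes>\<^sub>t Idm (replicate (d - Suc 0) II)"

lemma on_strand_eq: "on_strand A z d 1 Q = cl Q1"
  unfolding on_strand_def
  by (rule H.mclass_cong) (auto simp: wt_bracket intro!: H.eqv_unit_Tens)

lemma Q1_arr: "arrI Q1"
  by (auto simp: arr_iff wt_bracket Iw_eq)

lemma ideal_J: "ideal Q_ideal S"
  unfolding Q_ideal_def on_strand_eq by (rule ring.genideal_ideal[OF S_ring]) (simp add: cl_closed Q1_arr)

lemma Q1_J: "cl Q1 \<in> Q_ideal"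
  unfolding Q_ideal_def on_strand_eq by (rule ring.genideal_self'[OF S_ring]) (rule cl_closed[OF Q1_arr])

lemma summand_closed: "w \<in> Words \<Longrightarrow> summand_id LP Words w \<in> carrier R"
  using M.mat_diag_closed[of "{w}"] by (simp only: M.mat_diag_singleton)

lemma ideal_I: "ideal I_ideal R"
  unfolding I_ideal_def by (rule ring.genideal_ideal[OF M.ring_Mat]) (use summand_closed in auto)

lemma summand_I: "w \<in> Words \<Longrightarrow> hd w = II \<Longrightarrow> summand_id LP Words w \<in> I_ideal"
  unfolding I_ideal_def by (rule subsetD[OF ring.genideal_self[OF M.ring_Mat]]) (use summand_closed in auto)

section \<open>Cosets of terms in the two quotients\<close>

definition coset_H where "coset_H f = Q_ideal +>\<^bsub>S\<^esub> cl f"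

text \<open>A term is placed at the matrix position given by its own ends, so terms that are not
  endomorphisms also have a coset, and composition through any summand becomes
  multiplication.\<close>

definition coset_L where
  "coset_L f = I_ideal +>\<^bsub>R\<^esub> M.mat_unit (mtgt LP f) (msrc LP f) (mclass LP (msrc LP f) (mtgt LP f) f)"

lemmas rcos_J = ideal.rcos_ring_hom[OF ideal_J]
lemmas rcos_I = ideal.rcos_ring_hom[OF ideal_I]

lemma coset_H_comp:
  "arrI g \<Longrightarrow> arrI f \<Longrightarrow> coset_H (g \<circ>\<^sub>t f) = coset_H g \<otimes>\<^bsub>S Quot Q_ideal\<^esub> coset_H f"
  using ring_hom_mult[OF rcos_J cl_closed cl_closed] by (simp add: coset_H_def cl_mult)

lemma coset_H_add:
  "arrI g \<Longrightarrow> arrI f \<Longrightarrow> coset_H (g +\<^sub>t f) = coset_H g \<oplus>\<^bsub>S Quot Q_ideal\<^esub> coset_H f"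
  using ring_hom_add[OF rcos_J cl_closed cl_closed] by (simp add: coset_H_def cl_add)

lemma coset_H_scale:
  "arrI f \<Longrightarrow> coset_H (c *\<^sub>t f) = c \<odot>\<^bsub>quot_superalgebra S Q_ideal\<^esub> coset_H f"
  using scalar_ring.quot_smult[OF S_scalar ideal_J cl_closed] by (simp add: coset_H_def cl_smult)

lemma coset_H_zero: "coset_H (Zer Iw Iw) = Q_ideal"
  using ring.a_rcos_zero[OF S_ring ideal_J additive_subgroup.zero_closed[OF ideal.axioms(1)[OF ideal_J]]]
  by (simp add: coset_H_def cl_zero)

lemma coset_H_J: "arrI f \<Longrightarrow> cl f \<in> Q_ideal \<Longrightarrow> coset_H f = Q_ideal"
  unfolding coset_H_def by (rule ring.a_rcos_zero[OF S_ring ideal_J])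

lemma coset_H_eqv: "eqv H f g \<Longrightarrow> coset_H f = coset_H g"
  unfolding coset_H_def by (simp only: H.mclass_cong[of f g])

text \<open>Here \<open>qeq_imp_eq\<close> is used with the single word \<open>Iw\<close>: a term
  leaving it changes the number of strands and vanishes. Among the terms in \<open>first_Q\<close>,
  the type leaves only the generator of the cyclotomic ideal.\<close>

lemma coset_H_cong:
  assumes "qeq H first_Q f g" "arrI f"
  shows "coset_H f = coset_H g"
proof (rule H.qeq_imp_eq[where L = "{Iw}" and \<theta> = coset_H, OF _ _ _ _ _ _ assms(1)])
  fix f :: "('k, 'a) amor" assume f: "wt H f" "msrc H f \<in> {Iw}" "mtgt H f \<notin> {Iw}"
  have "mset (msrc H f) \<noteq> mset (mtgt H f)"
  proof
    assume "mset (msrc H f) = mset (mtgt H f)"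
    from mset_eq_length[OF this] have "length (mtgt H f) = d"
      using f by simp
    then show False
      using pure_length_eq[of "mtgt H f"] H.wt_letters(2)[OF f(1)] f(3) by simp
  qed
  then show "H.null f"
    using f(1) by (intro H.null_if_mset_neq) (simp_all add: mset_gen)
next
  fix f assume f: "f \<in> first_Q" "wt H f" "msrc H f \<in> {Iw}" "mtgt H f \<in> {Iw}"
  then obtain u where u: "f = bracket Q \<otimes>\<^sub>t Idm u" by (auto simp: first_Q_def)
  have "II # u = Iw"
    using f(3) by (simp add: u wt_bracket)
  then have "f = Q1"
    using Iw_eq u by (metis list.inject)
  then show "coset_H f = coset_H (Zer (msrc H f) (mtgt H f))"
    using coset_H_J[OF Q1_arr Q1_J] coset_H_zero f(3,4) by simp
qed (use assms(2) in \<open>auto simp: arr_iff coset_H_eqv coset_H_comp coset_H_add coset_H_scale\<close>)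

lemma coset_L_closed: "wt LP f \<Longrightarrow>
    M.mat_unit (mtgt LP f) (msrc LP f) (mclass LP (msrc LP f) (mtgt LP f) f) \<in> carrier R"
  by (intro M.mat_unit_closed L.Hom_setI wt_imp_arr)

lemma coset_L_carrier: "wt LP f \<Longrightarrow> coset_L f \<in> carrier (R Quot I_ideal)"
  unfolding coset_L_def by (rule ring_hom_closed[OF rcos_I coset_L_closed])

lemma coset_L_eqv: "eqv LP f g \<Longrightarrow> coset_L f = coset_L g"
  unfolding coset_L_def by (simp only: L.mclass_cong[of f g] L.eqvD(3,4)[of f g])

lemma coset_L_comp:
  assumes "wt LP (g \<circ>\<^sub>t f)" "msrc LP f \<in> Words" "mtgt LP f \<in> Words" "mtgt LP g \<in> Words"
  shows "coset_L (g \<circ>\<^sub>t f) = coset_L g \<otimes>\<^bsub>R Quot I_ideal\<^esub> coset_L f"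
  unfolding coset_L_def
  using assms ring_hom_mult[OF rcos_I coset_L_closed[of g] coset_L_closed[of f]]
    M.mat_unit_mult[of "mclass LP (msrc LP g) (mtgt LP g) g" "mtgt LP f" "mtgt LP g"
      "mclass LP (msrc LP f) (mtgt LP f) f" "msrc LP f"]
    L.Hom_comp_mclass[of "msrc LP g" "mtgt LP g" g "msrc LP f" f]
  by (simp add: arr_iff L.Hom_setI)

lemma coset_L_add:
  assumes "wt LP (f +\<^sub>t g)"
  shows "coset_L (f +\<^sub>t g) = coset_L f \<oplus>\<^bsub>R Quot I_ideal\<^esub> coset_L g"
  unfolding coset_L_def
  using assms ring_hom_add[OF rcos_I coset_L_closed[of f] coset_L_closed[of g]]
    M.mat_unit_add[of "mclass LP (msrc LP f) (mtgt LP f) f" "msrc LP f" "mtgt LP f"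
      "mclass LP (msrc LP g) (mtgt LP g) g"]
    L.Hom_add_mclass[of "msrc LP f" "mtgt LP f" f g]
  by (simp add: arr_iff L.Hom_setI)

lemma coset_L_scale:
  assumes "wt LP f"
  shows "coset_L (c *\<^sub>t f) = c \<odot>\<^bsub>quot_superalgebra R I_ideal\<^esub> coset_L f"
  unfolding coset_L_def
  using assms scalar_ring.quot_smult[OF M.scalar_ring_Mat ideal_I coset_L_closed[of f]]
    M.mat_unit_scale[of "mclass LP (msrc LP f) (mtgt LP f) f" "msrc LP f" "mtgt LP f"]
    L.Hom_scale_mclass[of "msrc LP f" "mtgt LP f" f]
  by (simp add: arr_iff L.Hom_setI)

lemma coset_L_zero: "coset_L (Zer v w) = I_ideal"
  using ring.a_rcos_zero[OF M.ring_Mat ideal_I additive_subgroup.zero_closed[OF ideal.axioms(1)[OF ideal_I]]]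
    M.mat_unit_zero[of w v]
  by (simp add: coset_L_def Hom_zero_def)

lemma coset_L_null: "L.null f \<Longrightarrow> coset_L f = I_ideal"
  unfolding L.null_def using coset_L_eqv coset_L_zero by metis

lemma coset_L_summand: "coset_L (Idm u) = I_ideal +>\<^bsub>R\<^esub> summand_id LP Words u"
  unfolding coset_L_def M.mat_unit_def summand_id_def Hom_id_def msrc.simps mtgt.simps ..

lemma Words_mset: "mset v = mset w \<Longrightarrow> v \<in> Words \<Longrightarrow> w \<in> Words"
  by (simp only: Words_iff)

lemma coset_L_outside:
  "wt LP f \<Longrightarrow> msrc LP f \<in> Words \<Longrightarrow> mtgt LP f \<notin> Words \<Longrightarrow> L.null f"
  using Words_mset by (intro L.null_if_mset_neq mset_gen_LAH) auto

text \<open>A term in \<open>via_I\<close> with ends among the summands has its middle word among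
  them too, or its first factor is zero. In the former case it factors through an idempotent that
  generates the ideal.\<close>

lemma coset_L_cong:
  assumes "qeq LP via_I f g" "msrc LP f \<in> Words" "mtgt LP f \<in> Words"
  shows "coset_L f = coset_L g"
proof (rule L.qeq_imp_eq[where L = Words and \<theta> = coset_L, OF _ _ _ _ _ _ assms])
  fix f assume f: "f \<in> via_I" "wt LP f" "msrc LP f \<in> Words" "mtgt LP f \<in> Words"
  then obtain g h where gh: "f = g \<circ>\<^sub>t h" "hd (mtgt LP h) = II" by (auto simp: via_I_def)
  let ?u = "mtgt LP h"
  have "coset_L f = I_ideal"
  proof (cases "?u \<in> Words")
    case True
    have carr: "coset_L g \<in> carrier (R Quot I_ideal)" "coset_L h \<in> carrier (R Quot I_ideal)"
      using coset_L_carrier[of g] coset_L_carrier[of h] f gh by simp_all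
    have zero: "\<zero>\<^bsub>R Quot I_ideal\<^esub> = I_ideal"
      by (simp add: FactRing_def)
    have "coset_L (Idm ?u) = I_ideal"
      unfolding coset_L_summand
      by (rule ring.a_rcos_zero[OF M.ring_Mat ideal_I summand_I[OF True gh(2)]])
    \<comment> \<open>Inserting the identity of the middle word exhibits that idempotent as a
      factor, and its coset is zero.\<close>
    moreover have "eqv LP f (g \<circ>\<^sub>t (Idm ?u \<circ>\<^sub>t h))"
      unfolding gh(1) using f gh
      by (intro L.eqv_cong_Comp L.eqv_refl L.eqv_sym[OF L.eqv_Id_Comp]) auto
    then have "coset_L f = coset_L (g \<circ>\<^sub>t (Idm ?u \<circ>\<^sub>t h))"
      by (rule coset_L_eqv)
    moreover have "coset_L (g \<circ>\<^sub>t (Idm ?u \<circ>\<^sub>t h)) = coset_L g \<otimes>\<^bsub>R Quot I_ideal\<^esub> coset_L (Idm ?u \<circ>\<^sub>t h)"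
      using f gh True Words_letters[OF True] by (intro coset_L_comp) simp_all
    moreover have "coset_L (Idm ?u \<circ>\<^sub>t h) = coset_L (Idm ?u) \<otimes>\<^bsub>R Quot I_ideal\<^esub> coset_L h"
      using f gh True Words_letters[OF True] by (intro coset_L_comp) simp_all
    ultimately have "coset_L f = coset_L g \<otimes>\<^bsub>R Quot I_ideal\<^esub> (\<zero>\<^bsub>R Quot I_ideal\<^esub> \<otimes>\<^bsub>R Quot I_ideal\<^esub> coset_L h)"
      using zero by metis
    also have "\<dots> = \<zero>\<^bsub>R Quot I_ideal\<^esub>"
      by (rule ring.mult_zero_between[OF ideal.quotient_is_ring[OF ideal_I] carr])
    finally show ?thesis by (simp only: zero)
  next
    case False
    then have "L.null h"
      using f gh by (intro coset_L_outside) auto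
    then have "L.null f"
      unfolding gh(1) using f gh by (intro L.null_Comp_right) auto
    then show ?thesis by (rule coset_L_null)
  qed
  then show "coset_L f = coset_L (Zer (msrc LP f) (mtgt LP f))"
    by (simp only: coset_L_zero)
next
  show "coset_L f = coset_L g" if "eqv LP f g" for f g
    by (rule coset_L_eqv[OF that])
qed (auto simp: coset_L_outside coset_L_comp coset_L_add coset_L_scale)


section \<open>The maps between the matrix algebra and the affine algebra\<close>

abbreviation cl0 where "cl0 \<equiv> mclass LP w0 w0"

definition corner_incl where
  "corner_incl X = M.mat_unit w0 w0 (\<Union>f\<in>X. cl0 (oneQ Q \<otimes>\<^sub>t f))"

definition eval_class where "eval_class X = (\<Union>f\<in>X. coset_H (ev f))"

definition corner_eval where "corner_eval M = eval_class (M (w0, w0))"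

lemma arrI_lift:
  assumes "arrI f"
  shows "arr LP w0 w0 (oneQ Q \<otimes>\<^sub>t f)"
  using assms wt_H_imp_LAH[of f] Q by (simp add: arr_iff)

lemma ev_arrI:
  assumes "arr LP w0 w0 f"
  shows "arrI (ev f)"
  using assms ev_wt[of f] by (auto simp: arr_iff)

lemma corner_incl_cl:
  assumes "arrI f"
  shows "corner_incl (cl f) = M.mat_unit w0 w0 (cl0 (oneQ Q \<otimes>\<^sub>t f))"
proof -
  have "cl0 (oneQ Q \<otimes>\<^sub>t g) = cl0 (oneQ Q \<otimes>\<^sub>t f)" if "eqv H f g" for g
    using Q by (intro L.mclass_cong L.eqv_cong_Tens L.eqv_refl L.eqv_sym[OF eqv_H_imp_LAH[OF that]]) auto
  then have "(\<Union>g\<in>cl f. cl0 (oneQ Q \<otimes>\<^sub>t g)) = cl0 (oneQ Q \<otimes>\<^sub>t f)"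
    by (rule H.UN_mclass[OF assms])
  then show ?thesis by (simp only: corner_incl_def)
qed

lemma corner_incl_closed: "X \<in> carrier S \<Longrightarrow> corner_incl X \<in> carrier R"
  using arrI_lift corner_incl_cl by (auto simp: S_carrier intro!: M.mat_unit_closed L.Hom_setI)

lemma coset_corner_incl:
  assumes "arrI f"
  shows "I_ideal +>\<^bsub>R\<^esub> corner_incl (cl f) = coset_L (oneQ Q \<otimes>\<^sub>t f)"
  using arrI_lift[OF assms] unfolding corner_incl_cl[OF assms] coset_L_def by (simp only: arr_iff)

text \<open>Stated modulo \<open>I_ideal\<close> because the unit is sent to the idempotent of
  \<open>w0\<close>, which \<open>corner_mod_ideal\<close> identifies with the unit only in the
  quotient.\<close>

lemma corner_incl_hom: "(\<lambda>X. I_ideal +>\<^bsub>R\<^esub> corner_incl X) \<in> ring_hom S (R Quot I_ideal)"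
proof (rule ring_hom_memI)
  fix X assume X: "X \<in> carrier S"
  then show "I_ideal +>\<^bsub>R\<^esub> corner_incl X \<in> carrier (R Quot I_ideal)"
    by (intro ring_hom_closed[OF rcos_I] corner_incl_closed)
  obtain f where f: "arrI f" "X = cl f"
    using X S_carrier by blast
  fix Y assume Y: "Y \<in> carrier S"
  then obtain g where g: "arrI g" "Y = cl g"
    using S_carrier by blast
  note fg = arrI_lift[OF f(1)] arrI_lift[OF g(1)]
  have "I_ideal +>\<^bsub>R\<^esub> corner_incl (X \<otimes>\<^bsub>S\<^esub> Y) = coset_L (oneQ Q \<otimes>\<^sub>t (f \<circ>\<^sub>t g))"
    unfolding f g cl_mult[OF f(1) g(1)] by (rule coset_corner_incl[OF arr_Comp[OF f(1) g(1)]])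
  also have "\<dots> = coset_L ((oneQ Q \<otimes>\<^sub>t f) \<circ>\<^sub>t (oneQ Q \<otimes>\<^sub>t g))"
    using f(1) g(1) Q wt_H_imp_LAH[of f] wt_H_imp_LAH[of g]
    by (intro coset_L_eqv L.eqv_Id_Tens_Comp) (auto simp: arr_iff)
  also have "\<dots> = coset_L (oneQ Q \<otimes>\<^sub>t f) \<otimes>\<^bsub>R Quot I_ideal\<^esub> coset_L (oneQ Q \<otimes>\<^sub>t g)"
    using fg w0_Words by (intro coset_L_comp) (simp_all only: arr_iff wt.simps)
  finally show "I_ideal +>\<^bsub>R\<^esub> corner_incl (X \<otimes>\<^bsub>S\<^esub> Y) = (I_ideal +>\<^bsub>R\<^esub> corner_incl X) \<otimes>\<^bsub>R Quot I_ideal\<^esub> (I_ideal +>\<^bsub>R\<^esub> corner_incl Y)"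
    by (simp only: f(2) g(2) coset_corner_incl[OF f(1)] coset_corner_incl[OF g(1)])
  have "I_ideal +>\<^bsub>R\<^esub> corner_incl (X \<oplus>\<^bsub>S\<^esub> Y) = coset_L (oneQ Q \<otimes>\<^sub>t (f +\<^sub>t g))"
    unfolding f g cl_add[OF f(1) g(1)] by (rule coset_corner_incl[OF arr_Add[OF f(1) g(1)]])
  also have "\<dots> = coset_L ((oneQ Q \<otimes>\<^sub>t f) +\<^sub>t (oneQ Q \<otimes>\<^sub>t g))"
    using f(1) g(1) Q wt_H_imp_LAH[of f] wt_H_imp_LAH[of g]
    by (intro coset_L_eqv L.eqv_Tens_Add) (auto simp: arr_iff)
  also have "\<dots> = coset_L (oneQ Q \<otimes>\<^sub>t f) \<oplus>\<^bsub>R Quot I_ideal\<^esub> coset_L (oneQ Q \<otimes>\<^sub>t g)"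
    using fg by (intro coset_L_add) (simp only: arr_iff wt.simps)
  finally show "I_ideal +>\<^bsub>R\<^esub> corner_incl (X \<oplus>\<^bsub>S\<^esub> Y) = (I_ideal +>\<^bsub>R\<^esub> corner_incl X) \<oplus>\<^bsub>R Quot I_ideal\<^esub> (I_ideal +>\<^bsub>R\<^esub> corner_incl Y)"
    by (simp only: f(2) g(2) coset_corner_incl[OF f(1)] coset_corner_incl[OF g(1)])
next
  have Iw: "arrI (Idm Iw)"
    by (rule arr_Id[OF Iw_letters])
  have "I_ideal +>\<^bsub>R\<^esub> corner_incl \<one>\<^bsub>S\<^esub> = coset_L (oneQ Q \<otimes>\<^sub>t Idm Iw)"
    unfolding cl_one by (rule coset_corner_incl[OF Iw])
  also have "\<dots> = coset_L (Idm ([Red Q] @ Iw))"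
    using Q by (intro coset_L_eqv L.eqv_Id_Tens_Id) auto
  also have "\<dots> = I_ideal +>\<^bsub>R\<^esub> M.mat_unit w0 w0 (\<one>\<^bsub>R\<^esub> (w0, w0))"
    using w0_Words by (simp add: coset_L_def M.Mat_one_apply Hom_id_def)
  also have "\<dots> = I_ideal +>\<^bsub>R\<^esub> \<one>\<^bsub>R\<^esub>"
    using Words_first summand_I
    by (intro M.corner_mod_ideal[symmetric] ideal_I w0_Words M.Mat_one_closed) blast
  also have "\<dots> = \<one>\<^bsub>R Quot I_ideal\<^esub>"
    by (rule ring_hom_one[OF rcos_I])
  finally show "I_ideal +>\<^bsub>R\<^esub> corner_incl \<one>\<^bsub>S\<^esub> = \<one>\<^bsub>R Quot I_ideal\<^esub>" .
qed

lemma FactRing_zero: "\<zero>\<^bsub>R' Quot K\<^esub> = K"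
  by (simp add: FactRing_def)

text \<open>
  The relation \<open>\<lambda>\<^sub>Q \<rho>\<^sub>Q = 1\<^sub>Q \<otimes> [Q]\<close> makes \<open>Q\<^sub>1\<close> factor through a word with first letter \<open>I\<close>.
\<close>

lemma coset_L_Q1: "coset_L (oneQ Q \<otimes>\<^sub>t Q1) = I_ideal"
proof -
  let ?u = "replicate (d - Suc 0) II"
  let ?g = "lam Q \<otimes>\<^sub>t Idm ?u" and ?f = "rho Q \<otimes>\<^sub>t Idm ?u"
  note B = wt_bracket(1)[of A z Q] wt_H_imp_LAH[OF wt_bracket(1)[of A z Q]] wt_bracket(2,3)[of A z Q]
  have "eqv LP (oneQ Q \<otimes>\<^sub>t Q1) ((oneQ Q \<otimes>\<^sub>t bracket Q) \<otimes>\<^sub>t Idm ?u)"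
    using Q B by (intro L.eqv_sym[OF L.eqv_Tens_assoc]) auto
  also have "eqv LP \<dots> ((lam Q \<circ>\<^sub>t rho Q) \<otimes>\<^sub>t Idm ?u)"
    using Q B
    by (intro L.eqv_cong_Tens L.eqv_refl L.eqv_sym[OF L.eqv_rel]) (auto intro: LAH_rels.intros)
  also have "eqv LP \<dots> (?g \<circ>\<^sub>t ?f)"
    using Q by (intro L.eqv_Comp_Tens_Id) auto
  finally have eq: "eqv LP (oneQ Q \<otimes>\<^sub>t Q1) (?g \<circ>\<^sub>t ?f)" .
  have types: "msrc LP (?g \<circ>\<^sub>t ?f) = w0" "mtgt LP (?g \<circ>\<^sub>t ?f) = w0"
    by (simp_all add: Iw_eq)
  have "mtgt LP ?f \<noteq> [] \<and> hd (mtgt LP ?f) = II"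
    by simp
  then have "?g \<circ>\<^sub>t ?f \<in> via_I"
    unfolding via_I_def by blast
  moreover have "wt LP (?g \<circ>\<^sub>t ?f)"
    using Q by auto
  ultimately have "qeq LP via_I (?g \<circ>\<^sub>t ?f) (Zer w0 w0)"
    using qeq_null[of "?g \<circ>\<^sub>t ?f" via_I LP] unfolding types by blast
  then have "coset_L (?g \<circ>\<^sub>t ?f) = coset_L (Zer w0 w0)"
    using w0_Words by (intro coset_L_cong) (simp_all only: types)
  then show ?thesis
    by (simp only: coset_L_eqv[OF eq] coset_L_zero)
qed

text \<open>The kernel of a ring homomorphism is an ideal, so it is enough that the one generator
  \<open>Q_1\<close> is sent into \<open>I_ideal\<close>. This is the purpose of
  \<open>corner_incl_hom\<close>.\<close>

lemma corner_incl_J: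
  assumes "X \<in> Q_ideal"
  shows "corner_incl X \<in> I_ideal"
proof -
  interpret hom: ring_hom_ring S "R Quot I_ideal" "\<lambda>X. I_ideal +>\<^bsub>R\<^esub> corner_incl X"
    by (rule ring_hom_ringI2[OF S_ring ideal.quotient_is_ring[OF ideal_I] corner_incl_hom])
  have "cl Q1 \<in> a_kernel S (R Quot I_ideal) (\<lambda>X. I_ideal +>\<^bsub>R\<^esub> corner_incl X)"
    unfolding a_kernel_def' FactRing_zero
    using coset_corner_incl[OF Q1_arr] coset_L_Q1 cl_closed[OF Q1_arr] by blast
  then have "Q_ideal \<subseteq> a_kernel S (R Quot I_ideal) (\<lambda>X. I_ideal +>\<^bsub>R\<^esub> corner_incl X)"
    unfolding Q_ideal_def on_strand_eq by (intro ring.genideal_minimal[OF S_ring] hom.kernel_is_ideal) blast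
  then have "X \<in> carrier S" "I_ideal +>\<^bsub>R\<^esub> corner_incl X = I_ideal"
    using assms unfolding a_kernel_def' FactRing_zero by blast+
  then show ?thesis
    using ideal.rcos_const_imp_mem[OF ideal_I corner_incl_closed] by blast
qed

text \<open>Modulo the ideal a matrix reduces to its entry at \<open>w0\<close>, and
  \<open>lift_Q\<close> turns that entry into \<open>1\<^sub>Q \<otimes> f\<close>.\<close>

lemma corner_incl_surj:
  assumes "M \<in> carrier R"
  shows "\<exists>X\<in>carrier S. I_ideal +>\<^bsub>R\<^esub> M = I_ideal +>\<^bsub>R\<^esub> corner_incl X"
proof -
  obtain f where f: "arr LP w0 w0 f" "M (w0, w0) = cl0 f"
    using M.Mat_carrierD[OF assms w0_Words w0_Words] by (rule L.Hom_setE)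
  then have t: "wt LP f" "msrc LP f = w0" "mtgt LP f = w0"
    by (simp_all add: arr_iff)
  have "I_ideal +>\<^bsub>R\<^esub> M = I_ideal +>\<^bsub>R\<^esub> M.mat_unit w0 w0 (M (w0, w0))"
    using Words_first summand_I
    by (intro M.corner_mod_ideal ideal_I w0_Words assms) blast
  also have "\<dots> = coset_L f"
    unfolding f(2) coset_L_def t ..
  also have "\<dots> = coset_L (oneQ Q \<otimes>\<^sub>t ev f)"
    using t w0_Words qtype_w0 by (intro coset_L_cong lift_Q) simp_all
  also have "\<dots> = I_ideal +>\<^bsub>R\<^esub> corner_incl (cl (ev f))"
    by (rule coset_corner_incl[OF ev_arrI[OF f(1)], symmetric])
  finally show ?thesis
    using cl_closed[OF ev_arrI[OF f(1)]] by blast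
qed

lemma corner_incl_homog:
  assumes "X \<in> homog S p"
  shows "corner_incl X \<in> homog R p"
proof -
  obtain f where f: "arrI f" "mpar H f p" "X = cl f"
    using assms by (auto simp: End_algebra_def Hom_homog_def)
  have "mpar LP f p"
    using mpar_mono[of H LP f p] f(2) by simp
  from mpar_Tens[OF mpar_Id this] have "mpar LP (oneQ Q \<otimes>\<^sub>t f) p"
    by (simp only: add_0)
  then have "cl0 (oneQ Q \<otimes>\<^sub>t f) \<in> Hom_homog LP w0 w0 p"
    using arrI_lift[OF f(1)] unfolding Hom_homog_def by blast
  \<comment> \<open>The zero entries off the corner are homogeneous of every parity.\<close>
  moreover have "Hom_zero LP i j \<in> Hom_homog LP i j p" if "i \<in> Words" "j \<in> Words" for i j
    using arr_Zer[OF Words_letters[OF that(1)] Words_letters[OF that(2)]] mpar_Zer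
    unfolding Hom_zero_def Hom_homog_def by blast
  ultimately show ?thesis
    unfolding f(3) corner_incl_cl[OF f(1)] by (auto simp: Add_End_algebra_def M.mat_unit_def simp del: replicate.simps)
qed

lemma coset_ev_cong:
  assumes "arr LP w0 w0 f" "eqv LP f g"
  shows "coset_H (ev g) = coset_H (ev f)"
proof -
  have "evrel f g"
    using assms by (intro meq_evrel[of w0 w0]) (simp add: L.meq_iff arr_iff)
  then show ?thesis
    using coset_H_cong[OF evrel_qeq ev_arrI] assms(1) by simp
qed

lemma eval_class_cl: "arr LP w0 w0 f \<Longrightarrow> eval_class (cl0 f) = coset_H (ev f)"
  unfolding eval_class_def using coset_ev_cong by (intro L.UN_mclass) auto

lemma coset_H_carrier: "arrI f \<Longrightarrow> coset_H f \<in> carrier (S Quot Q_ideal)"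
  unfolding coset_H_def by (rule ring_hom_closed[OF rcos_J cl_closed])

lemma eval_class_hom: "eval_class \<in> hom (L.hom_group w0 w0) (add_monoid (S Quot Q_ideal))"
proof (rule homI)
  fix X assume "X \<in> carrier (L.hom_group w0 w0)"
  then obtain f where f: "arr LP w0 w0 f" "X = cl0 f"
    by (auto elim: L.Hom_setE)
  then show "eval_class X \<in> carrier (add_monoid (S Quot Q_ideal))"
    by (simp add: eval_class_cl coset_H_carrier ev_arrI)
  fix Y assume "Y \<in> carrier (L.hom_group w0 w0)"
  then obtain g where g: "arr LP w0 w0 g" "Y = cl0 g"
    by (auto elim: L.Hom_setE)
  show "eval_class (X \<otimes>\<^bsub>L.hom_group w0 w0\<^esub> Y) = eval_class X \<otimes>\<^bsub>add_monoid (S Quot Q_ideal)\<^esub> eval_class Y"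
    using f g arr_Add[OF f(1) g(1)] coset_H_add[OF ev_arrI[OF f(1)] ev_arrI[OF g(1)]]
    by (simp add: L.Hom_add_mclass eval_class_cl)
qed

text \<open>Every summand other than \<open>w0\<close> begins with \<open>I\<close>, hence is
  unmatched with \<open>w0\<close>, and the first factor already evaluates to zero.\<close>

lemma eval_class_comp_outside:
  assumes "X \<in> Hom_set LP k w0" "Y \<in> Hom_set LP w0 k" "k \<in> Words" "k \<noteq> w0"
  shows "eval_class (Hom_comp LP w0 w0 X Y) = Q_ideal"
proof -
  obtain f g where fg: "arr LP k w0 g" "X = mclass LP k w0 g" "arr LP w0 k f" "Y = mclass LP w0 k f"
    using assms(1,2) by (meson L.Hom_setE)
  have "\<not> matched w0 k"
  proof
    assume "matched w0 k"
    then have "qtype k"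
      using qtype_w0 not_pure_qtype by (auto simp: matched_def)
    then show False
      using Words_first[OF assms(3)] assms(4) by (cases k) auto
  qed
  then have "H.null (ev f)"
    using fg(3) by (intro ev_null) (simp_all add: arr_iff)
  then have "H.null (ev (g \<circ>\<^sub>t f))"
    using fg ev_wt[of f] ev_wt[of g] by (auto simp: arr_iff intro!: H.null_Comp_right)
  then have "eqv H (ev (g \<circ>\<^sub>t f)) (Zer Iw Iw)"
    using ev_arrI[OF arr_Comp[OF fg(1,3)]] by (simp add: H.null_def arr_iff)
  then have "coset_H (ev (g \<circ>\<^sub>t f)) = Q_ideal"
    using coset_H_eqv coset_H_zero by metis
  then show ?thesis
    using eval_class_cl[OF arr_Comp[OF fg(1,3)]] fg by (simp only: L.Hom_comp_mclass)
qed

lemma eval_class_comp: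
  assumes "X \<in> Hom_set LP w0 w0" "Y \<in> Hom_set LP w0 w0"
  shows "eval_class (Hom_comp LP w0 w0 X Y) = eval_class X \<otimes>\<^bsub>S Quot Q_ideal\<^esub> eval_class Y"
proof -
  obtain f g where fg: "arr LP w0 w0 g" "X = cl0 g" "arr LP w0 w0 f" "Y = cl0 f"
    using assms by (meson L.Hom_setE)
  then show ?thesis
    using coset_H_comp[OF ev_arrI[OF fg(1)] ev_arrI[OF fg(3)]] arr_Comp[OF fg(1,3)]
    by (simp add: L.Hom_comp_mclass eval_class_cl)
qed

lemma eval_class_carrier: "X \<in> Hom_set LP w0 w0 \<Longrightarrow> eval_class X \<in> carrier (S Quot Q_ideal)"
  using hom_in_carrier[OF eval_class_hom, of X] by simp

text \<open>The entry of a product at \<open>w0\<close> is a sum over all intermediate words, so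
  taking that entry is not multiplicative by itself. After evaluation only the summand through
  \<open>w0\<close> survives. Additivity of \<open>eval_class\<close> lets it pass through the
  sum.\<close>

lemma corner_eval_mult:
  assumes M: "M \<in> carrier R" and N: "N \<in> carrier R"
  shows "corner_eval (M \<otimes>\<^bsub>R\<^esub> N) = corner_eval M \<otimes>\<^bsub>S Quot Q_ideal\<^esub> corner_eval N"
proof -
  let ?G = "add_monoid (S Quot Q_ideal)" and ?F = "\<lambda>k. Hom_comp LP w0 w0 (M (w0, k)) (N (k, w0))"
  interpret G: comm_group ?G
    by (rule abelian_group.a_comm_group[OF ring.is_abelian_group[OF ideal.quotient_is_ring[OF ideal_J]]])
  have one: "\<one>\<^bsub>?G\<^esub> = Q_ideal"
    by (simp add: FactRing_zero)
  have F: "?F k \<in> Hom_set LP w0 w0" if "k \<in> Words" for k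
    by (rule M.Mat_comp_closed[OF M N w0_Words that w0_Words])
  have F0: "eval_class (?F k) = (if w0 = k then eval_class (?F w0) else \<one>\<^bsub>?G\<^esub>)" if "k \<in> Words" for k
    using eval_class_comp_outside[OF M.Mat_carrierD[OF M w0_Words that] M.Mat_carrierD[OF N that w0_Words] that]
    unfolding one by (cases "k = w0") auto
  have "corner_eval (M \<otimes>\<^bsub>R\<^esub> N) = eval_class (finprod (L.hom_group w0 w0) ?F Words)"
    by (simp only: corner_eval_def M.Mat_mult_apply[OF w0_Words w0_Words] L.Hom_sum_finprod)
  also have "\<dots> = finprod ?G (\<lambda>k. eval_class (?F k)) Words"
    using F Words_letters[OF w0_Words]
    by (intro finprod_hom L.hom_comm_group G.comm_group_axioms eval_class_hom) simp_all
  also have "\<dots> = finprod ?G (\<lambda>k. if w0 = k then eval_class (?F w0) else \<one>\<^bsub>?G\<^esub>) Words"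
    using F0 eval_class_carrier[OF F[OF w0_Words]] G.one_closed by (intro G.finprod_cong') auto
  also have "\<dots> = eval_class (?F w0)"
    using eval_class_carrier[OF F[OF w0_Words]] finite_Words w0_Words by (intro G.finprod_singleton) auto
  also have "\<dots> = corner_eval M \<otimes>\<^bsub>S Quot Q_ideal\<^esub> corner_eval N"
    unfolding corner_eval_def using M N w0_Words by (intro eval_class_comp M.Mat_carrierD)
  finally show ?thesis .
qed

lemma corner_eval_hom: "corner_eval \<in> ring_hom R (S Quot Q_ideal)"
proof (rule ring_hom_memI)
  fix M assume M: "M \<in> carrier R"
  show "corner_eval M \<in> carrier (S Quot Q_ideal)"
    unfolding corner_eval_def by (rule eval_class_carrier[OF M.Mat_carrierD[OF M w0_Words w0_Words]])
  fix N assume N: "N \<in> carrier R"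
  show "corner_eval (M \<otimes>\<^bsub>R\<^esub> N) = corner_eval M \<otimes>\<^bsub>S Quot Q_ideal\<^esub> corner_eval N"
    by (rule corner_eval_mult[OF M N])
  show "corner_eval (M \<oplus>\<^bsub>R\<^esub> N) = corner_eval M \<oplus>\<^bsub>S Quot Q_ideal\<^esub> corner_eval N"
    using hom_mult[OF eval_class_hom, of "M (w0, w0)" "N (w0, w0)"]
      M.Mat_carrierD[OF M w0_Words w0_Words] M.Mat_carrierD[OF N w0_Words w0_Words]
    by (simp add: corner_eval_def M.Mat_add_apply[OF w0_Words w0_Words])
next
  have "arr LP w0 w0 (Idm w0)"
    by (rule arr_Id[OF Words_letters[OF w0_Words]])
  then have "corner_eval \<one>\<^bsub>R\<^esub> = coset_H (ev (Idm w0))"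
    using eval_class_cl w0_Words by (simp add: corner_eval_def M.Mat_one_apply Hom_id_def)
  also have "ev (Idm w0) = Idm Iw"
    by (auto simp: good_def)
  also have "coset_H (Idm Iw) = \<one>\<^bsub>S Quot Q_ideal\<^esub>"
    using ring_hom_one[OF rcos_J] by (simp only: coset_H_def cl_one)
  finally show "corner_eval \<one>\<^bsub>R\<^esub> = \<one>\<^bsub>S Quot Q_ideal\<^esub>" .
qed

text \<open>The generators are idempotents of words other than \<open>w0\<close>, so their entry at
  \<open>w0\<close> is zero; the kernel, being an ideal, then contains everything they
  generate.\<close>

lemma corner_eval_I:
  assumes "M \<in> I_ideal"
  shows "corner_eval M = Q_ideal"
proof -
  interpret hom: ring_hom_ring R "S Quot Q_ideal" corner_eval
    by (rule ring_hom_ringI2[OF M.ring_Mat ideal.quotient_is_ring[OF ideal_J] corner_eval_hom])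
  have "summand_id LP Words w \<in> a_kernel R (S Quot Q_ideal) corner_eval" if w: "w \<in> Words" "hd w = II" for w
  proof -
    have "w \<noteq> w0"
      using w(2) by auto
    then have "summand_id LP Words w (w0, w0) = cl0 (Zer w0 w0)"
      using w0_Words by (simp add: summand_id_def Hom_zero_def)
    then have "corner_eval (summand_id LP Words w) = coset_H (ev (Zer w0 w0))"
      using eval_class_cl[OF arr_Zer[OF Words_letters Words_letters]] w0_Words by (simp only: corner_eval_def)
    then show ?thesis
      unfolding a_kernel_def' FactRing_zero using coset_H_zero summand_closed[OF w(1)] by simp
  qed
  then have "I_ideal \<subseteq> a_kernel R (S Quot Q_ideal) corner_eval"
    unfolding I_ideal_def by (intro ring.genideal_minimal[OF M.ring_Mat] hom.kernel_is_ideal) blast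
  then show ?thesis
    using assms unfolding a_kernel_def' FactRing_zero by blast
qed

text \<open>Forgetting \<open>Q\<close> turns \<open>1\<^sub>Q\<close> into the identity of the unit
  object, and terms of \<open>AH\<close> evaluate to themselves. This makes the evaluation a left
  inverse of the inclusion.\<close>

lemma coset_ev_lift:
  assumes "arrI f"
  shows "coset_H (ev (oneQ Q \<otimes>\<^sub>t f)) = coset_H f"
proof (rule coset_H_eqv)
  have f: "wt H f" "msrc LP f = Iw" "mtgt LP f = Iw"
    using assms wt_H_imp_LAH[of f] by (simp_all add: arr_iff)
  then have "ev (oneQ Q \<otimes>\<^sub>t f) = Idm [] \<otimes>\<^sub>t f"
    by (auto simp: good_def ev_AH)
  then show "eqv H (ev (oneQ Q \<otimes>\<^sub>t f)) f"
    using H.eqv_unit_Tens[OF f(1)] by simp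
qed

lemma corner_eval_corner_incl_smult:
  assumes "X \<in> carrier S"
  shows "corner_eval (c \<odot>\<^bsub>R\<^esub> corner_incl X) = Q_ideal +>\<^bsub>S\<^esub> (c \<odot>\<^bsub>S\<^esub> X)"
proof -
  obtain f where f: "arrI f" "X = cl f"
    using assms S_carrier by blast
  note lift = arrI_lift[OF f(1)]
  have "corner_eval (c \<odot>\<^bsub>R\<^esub> corner_incl X) = eval_class (Hom_scale LP w0 w0 c (cl0 (oneQ Q \<otimes>\<^sub>t f)))"
    using w0_Words by (simp add: corner_eval_def M.Mat_smult_apply f(2) corner_incl_cl[OF f(1)] M.mat_unit_apply)
  also have "\<dots> = coset_H (c *\<^sub>t ev (oneQ Q \<otimes>\<^sub>t f))"
    using eval_class_cl[OF arr_Scl[OF lift]] by (simp only: L.Hom_scale_mclass[OF lift] ev.simps)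
  also have "\<dots> = coset_H (c *\<^sub>t f)"
    by (simp only: coset_H_scale[OF ev_arrI[OF lift]] coset_H_scale[OF f(1)] coset_ev_lift[OF f(1)])
  also have "\<dots> = Q_ideal +>\<^bsub>S\<^esub> (c \<odot>\<^bsub>S\<^esub> X)"
    by (simp only: coset_H_def f(2) cl_smult[OF f(1)])
  finally show ?thesis .
qed

lemma corner_eval_corner_incl:
  assumes "X \<in> carrier S"
  shows "corner_eval (corner_incl X) = Q_ideal +>\<^bsub>S\<^esub> X"
proof -
  obtain f where f: "arrI f" "X = cl f"
    using assms S_carrier by blast
  have "corner_eval (corner_incl X) = eval_class (cl0 (oneQ Q \<otimes>\<^sub>t f))"
    using w0_Words by (simp add: corner_eval_def f(2) corner_incl_cl[OF f(1)] M.mat_unit_apply)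
  also have "\<dots> = coset_H f"
    by (simp only: eval_class_cl[OF arrI_lift[OF f(1)]] coset_ev_lift[OF f(1)])
  finally show ?thesis
    by (simp only: coset_H_def f(2))
qed

lemma corner_eval_homog:
  assumes "M \<in> homog R p"
  shows "\<exists>X\<in>homog S p. corner_eval M = Q_ideal +>\<^bsub>S\<^esub> X"
proof -
  have "M (w0, w0) \<in> Hom_homog LP w0 w0 p"
    using assms w0_Words by (auto simp: Add_End_algebra_def dest!: PiE_mem[of _ _ _ "(w0, w0)"])
  then obtain f where f: "arr LP w0 w0 f" "mpar LP f p" "M (w0, w0) = cl0 f"
    by (auto simp: Hom_homog_def)
  have "cl (ev f) \<in> homog S p"
    using ev_arrI[OF f(1)] ev_mpar[OF f(2)] by (auto simp: End_algebra_def Hom_homog_def)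
  moreover have "corner_eval M = Q_ideal +>\<^bsub>S\<^esub> cl (ev f)"
    by (simp only: corner_eval_def f(3) eval_class_cl[OF f(1)] coset_H_def)
  ultimately show ?thesis by blast
qed

theorem HL_cyclotomic_iso:
  "\<exists>h. h \<in> superalgebra_iso (HL_cyclotomic A z d [Q]) (H_cyclotomic A z d Q)"
proof -
  have "\<exists>h. h \<in> superalgebra_iso (quot_superalgebra R I_ideal) (quot_superalgebra S Q_ideal)"
    using corner_incl_closed corner_incl_J corner_incl_surj corner_incl_homog corner_eval_hom corner_eval_corner_incl corner_eval_I corner_eval_corner_incl_smult corner_eval_homog
    by (rule quot_superalgebra_iso[OF M.scalar_ring_Mat S_scalar ideal_I ideal_J])
  then show ?thesis
    by (simp only: HL_cyclotomic_def H_cyclotomic_def HL_aff_def H_aff_def I_ideal_def Q_ideal_def)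
qed

end

theorem theorem7p16:
  fixes A :: "('k::{comm_ring,comm_monoid_mult}, 'a::{ring,monoid_mult}) frobenius_data"
    and z :: 'k
    and d :: nat
    and Q :: "int \<Rightarrow>\<^sub>0 'a"
  assumes "symmetric_frobenius_superalgebra A"
    and "d \<ge> 1"
    and "Q \<in> EP1 A"
  shows "\<exists>h. h \<in> superalgebra_iso (HL_cyclotomic A z d [Q]) (H_cyclotomic A z d Q)"
proof -
  interpret cyclotomic_words A z Q d
    using assms by (intro cyclotomic_words.intro cyclotomic.intro cyclotomic_axioms.intro
        cyclotomic_words_axioms.intro)
  show ?thesis by (rule HL_cyclotomic_iso)
qed

end
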